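(* Let $n\ge1$ and $k\ge2$ be integers. There exists a generic set $\Omega\subset(\mathbb{C}^{(n+k-1)\times n})^k$ such that for each $A\in\mathbb{C}^{(n+k-1)\times n}$ and each $(B_1,\dots,B_k)\in\Omega$ the following is true, where $\widetilde\Delta_0,\dots,\widetilde\Delta_k$, $L$, $T$ are the matrices defined in the context and $D_i=L\,\widetilde\Delta_i\,T$ for $i=0,1,\dots,k$: 1) The matrix $D_0$ is nonsingular. 2) The linear rectangular multiparameter eigenvalue problem $(A+\lambda_1B_1+\cdots+\lambda_kB_k)\,\mathbf{x}=\mathbf{0}$ has $\binom{n+k-1}{k}$ eigenvalues counting multiplicities. 3) The matrices $D_0^{-1}D_1,\dots,D_0^{-1}D_k$ commute. 4) $(\lambda_1,\dots,\lambda_k)\in\mathbb{C}^k$ is a common eigenvalue of $D_0^{-1}D_1,\dots,D_0^{-1}D_k$ if and only if $(\lambda_1,\dots,\lambda_k)$ is an eigenvalue of $(A+\lambda_1B_1+\cdots+\lambda_kB_k)\,\mathbf{x}=\mathbf{0}$.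
   Context: Generic sets: a set $\mathcal{S}\subseteq\mathbb{C}^r$ is an algebraic variety if it is the set of common zeros of finitely many complex polynomials in $r$ variables, and it is proper if $\mathcal{S}\ne\mathbb{C}^r$. A set $\Omega\subset\mathbb{C}^r$ is generic if its complement is contained in a proper algebraic variety. Tuples of matrices are identified with points of $\mathbb{C}^r$ via their entries. Eigenvalues: a tuple $(\lambda_1,\dots,\lambda_k)\in\mathbb{C}^k$ is an eigenvalue of $(A+\lambda_1B_1+\cdots+\lambda_kB_k)\mathbf{x}=\mathbf{0}$ if there is a nonzero $\mathbf{x}\in\mathbb{C}^n$ satisfying this equation, i.e., if $\operatorname{rank}(A+\lambda_1B_1+\cdots+\lambda_kB_k)<n$. The multiplicity of an eigenvalue is the intersection multiplicity, at the corresponding point, of the affine space $\{A+\lambda_1B_1+\cdots+\lambda_kB_k\}$ with the determinantal variety of $(n+k-1)\times n$ matrices of rank less than $n$; equivalently, it is the dimension over $\mathbb{C}$ of the local ring at $(\lambda_1,\dots,\lambda_k)$ of $\mathbb{C}[\lambda_1,\dots,\lambda_k]$ modulo the ideal generated by the $n\times n$ minors of $A+\lambda_1B_1+\cdots+\lambda_kB_k$. A tuple $(\lambda_1,\dots,\lambda_k)$ is a common eigenvalue of square matrices $G_1,\dots,G_k$ of the same size if there is a nonzero vector $\mathbf{w}$ with $G_i\mathbf{w}=\lambda_i\mathbf{w}$ for all $i=1,\dots,k$. Rectangular operator determinants: for matrices $C_1,\dots,C_k\in\mathbb{C}^{(n+k-1)\times n}$ put $[C_1,\dots,C_k]_\otimes=\sum_{\sigma\in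 S_k}\operatorname{sgn}(\sigma)\,C_{\sigma(1)}\otimes C_{\sigma(2)}\otimes\cdots\otimes C_{\sigma(k)}$ (Kronecker products), an $(n+k-1)^k\times n^k$ matrix. Then $\widetilde\Delta_0=[B_1,\dots,B_k]_\otimes$, and for $i=1,\dots,k$, $\widetilde\Delta_i=-[B_1,\dots,B_{i-1},A,B_{i+1},\dots,B_k]_\otimes$ (the matrix $B_i$ is replaced by $A$). Compression matrices: $T$ is the $n^k\times\binom{n+k-1}{k}$ matrix whose rows are indexed by multi-indices $(i_1,\dots,i_k)$ with $1\le i_1,\dots,i_k\le n$, listed in lexicographic order (row number $(i_1-1)n^{k-1}+\cdots+(i_{k-1}-1)n+i_k$), and whose columns are indexed by multi-indices $(j_1,\dots,j_k)$ with $1\le j_1\le\cdots\le j_k\le n$ (in a fixed order, say lexicographic). The entry of $T$ is $1$ if $(i_1,\dots,i_k)$ is a permutation of $(j_1,\dots,j_k)$, and $0$ otherwise. $L$ is the $\binom{n+k-1}{k}\times(n+k-1)^k$ matrix whose rows are indexed by strictly ordered multi-indices $1\le i_1<\cdots<i_k\le n+k-1$ (in a fixed order, say lexicographic) and whose columns are indexed by multi-indices $(q_1,\dots,q_k)$ with $1\le q_1,\dots,q_k\le n+k-1$ in lexicographic order (column number $(q_1-1)(n+k-1)^{k-1}+\cdots+(q_{k-1}-1)(n+k-1)+q_k$). The entry of $L$ is $1$ if $(i_1,\dots,i_k)=(q_1,\dots,q_k)$, and $0$ otherwise. *)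

theory Defs
  imports
    Complex_Main
    "HOL-Library.Poly_Mapping"
    "HOL-Library.Extended_Nat"
    "HOL-Combinatorics.Permutations"
    "HOL-Computational_Algebra.Fraction_Field"
    "HOL-Algebra.QuotRing"
    "HOL-Algebra.Embedded_Algebras"
    "Jordan_Normal_Form.Matrix"
    "Jordan_Normal_Form.Determinant"
    "Jordan_Normal_Form.DL_Submatrix"
    "Jordan_Normal_Form.Char_Poly"
    "Jordan_Normal_Form.Gauss_Jordan_Elimination"
begin

text \<open>
  All families are indexed from 0: a tuple \<open>(B\<^sub>1, \<dots>, B\<^sub>k)\<close> is a list \<open>Bs\<close> of length \<open>k\<close> with
  \<open>Bs ! i\<close> in the role of \<open>B\<^sub>i\<^sub>+\<^sub>1\<close>, and points of complex affine \<open>r\<close>-space are the elements of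
  \<open>carrier_vec r\<close>.
\<close>

section \<open>Polynomials in several variables\<close>

text \<open>
  A polynomial maps monomials (exponent vectors) to coefficients. The type has countably many
  variables; \<open>polys r\<close> is the polynomial ring in the variables with index below \<open>r\<close>.
\<close>

type_synonym mpoly = "(nat \<Rightarrow>\<^sub>0 nat) \<Rightarrow>\<^sub>0 complex"

definition mconst :: "complex \<Rightarrow> mpoly" where
  "mconst c = Poly_Mapping.single 0 c"

definition mvar :: "nat \<Rightarrow> mpoly" where
  "mvar i = Poly_Mapping.single (Poly_Mapping.single i 1) 1"

definition polys :: "nat \<Rightarrow> mpoly set" where
  "polys r = {p. \<forall>m \<in> Poly_Mapping.keys p. Poly_Mapping.keys m \<subseteq> {..<r}}"

definition meval :: "mpoly \<Rightarrow> complex vec \<Rightarrow> complex" where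
  "meval p x = (\<Sum>m\<in>Poly_Mapping.keys p.
     Poly_Mapping.lookup p m * (\<Prod>i\<in>Poly_Mapping.keys m. (x $ i) ^ Poly_Mapping.lookup m i))"

section \<open>Generic sets\<close>

definition algebraic_variety :: "nat \<Rightarrow> complex vec set \<Rightarrow> bool" where
  "algebraic_variety r S \<longleftrightarrow>
     (\<exists>P. finite P \<and> P \<subseteq> polys r \<and> S = {x \<in> carrier_vec r. \<forall>p\<in>P. meval p x = 0})"

definition generic :: "nat \<Rightarrow> complex vec set \<Rightarrow> bool" where
  "generic r \<Omega> \<longleftrightarrow> \<Omega> \<subseteq> carrier_vec r \<and>
     (\<exists>S. algebraic_variety r S \<and> S \<noteq> carrier_vec r \<and> carrier_vec r - \<Omega> \<subseteq> S)"

definition mat_tuples :: "nat \<Rightarrow> nat \<Rightarrow> nat \<Rightarrow> complex mat list set" where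
  "mat_tuples k m n = {Bs. length Bs = k \<and> set Bs \<subseteq> carrier_mat m n}"

text \<open>Entries are listed matrix by matrix, each matrix row by row.\<close>

definition tuple_point :: "nat \<Rightarrow> nat \<Rightarrow> nat \<Rightarrow> complex mat list \<Rightarrow> complex vec" where
  "tuple_point k m n Bs = vec (k * (m * n))
     (\<lambda>t. (Bs ! (t div (m * n))) $$ ((t mod (m * n)) div n, (t mod (m * n)) mod n))"

definition generic_tuples :: "nat \<Rightarrow> nat \<Rightarrow> nat \<Rightarrow> complex mat list set \<Rightarrow> bool" where
  "generic_tuples k m n \<Omega> \<longleftrightarrow>
     \<Omega> \<subseteq> mat_tuples k m n \<and> generic (k * (m * n)) (tuple_point k m n ` \<Omega>)"

section \<open>Eigenvalues and multiplicities\<close>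

text \<open>
  The matrix \<open>A + \<lambda>\<^sub>1 B\<^sub>1 + \<dots> + \<lambda>\<^sub>k B\<^sub>k\<close>, over an arbitrary ring so that it can be used both with
  complex numbers and with indeterminates \<open>\<lambda>\<^sub>i\<close>.
\<close>

definition pencil :: "'a::comm_ring_1 mat \<Rightarrow> 'a mat list \<Rightarrow> 'a vec \<Rightarrow> 'a mat" where
  "pencil A Bs v = mat (dim_row A) (dim_col A)
     (\<lambda>(i, j). A $$ (i, j) + (\<Sum>l<length Bs. v $ l * (Bs ! l) $$ (i, j)))"

definition rmep_eigenvalue :: "complex mat \<Rightarrow> complex mat list \<Rightarrow> complex vec \<Rightarrow> bool" where
  "rmep_eigenvalue A Bs v \<longleftrightarrow> v \<in> carrier_vec (length Bs) \<and>
     (\<exists>x \<in> carrier_vec (dim_col A). x \<noteq> 0\<^sub>v (dim_col A) \<and>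
        pencil A Bs v *\<^sub>v x = 0\<^sub>v (dim_row A))"

definition poly_pencil :: "complex mat \<Rightarrow> complex mat list \<Rightarrow> mpoly mat" where
  "poly_pencil A Bs =
     pencil (map_mat mconst A) (map (map_mat mconst) Bs) (vec (length Bs) mvar)"

definition maximal_minors :: "'a::comm_ring_1 mat \<Rightarrow> 'a set" where
  "maximal_minors M =
     {det (submatrix M I UNIV) | I. I \<subseteq> {..<dim_row M} \<and> card I = dim_col M}"

text \<open>
  The local ring of affine \<open>k\<close>-space at the point \<open>v\<close>: the localization of \<open>polys k\<close> at the
  maximal ideal of \<open>v\<close>, realised inside a field of fractions.
\<close>

definition local_ring :: "nat \<Rightarrow> complex vec \<Rightarrow> mpoly fract ring" where
  "local_ring k v =
     \<lparr>carrier = {Fraction_Field.Fract p q | p q. p \<in> polys k \<and> q \<in> polys k \<and> meval q v \<noteq> 0},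
      monoid.mult = (*), one = 1, zero = 0, add = (+)\<rparr>"

text \<open>
  The local ring at \<open>v\<close> of the polynomial ring modulo the ideal of maximal minors (localization
  commutes with quotients); its dimension is taken over the image of the constants.
\<close>

definition minors_ideal :: "complex mat \<Rightarrow> complex mat list \<Rightarrow> complex vec \<Rightarrow> mpoly fract set" where
  "minors_ideal A Bs v = genideal (local_ring (length Bs) v)
     ((\<lambda>p. Fraction_Field.Fract p 1) ` maximal_minors (poly_pencil A Bs))"

definition eigen_local_ring ::
    "complex mat \<Rightarrow> complex mat list \<Rightarrow> complex vec \<Rightarrow> mpoly fract set ring" where
  "eigen_local_ring A Bs v = local_ring (length Bs) v Quot minors_ideal A Bs v"

definition eigen_constants ::
    "complex mat \<Rightarrow> complex mat list \<Rightarrow> complex vec \<Rightarrow> mpoly fract set set" where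
  "eigen_constants A Bs v =
     (\<lambda>c. minors_ideal A Bs v +>\<^bsub>local_ring (length Bs) v\<^esub> Fraction_Field.Fract (mconst c) 1) ` UNIV"

definition rmep_multiplicity :: "complex mat \<Rightarrow> complex mat list \<Rightarrow> complex vec \<Rightarrow> enat" where
  "rmep_multiplicity A Bs v =
     (let Q = eigen_local_ring A Bs v; K = eigen_constants A Bs v in
      if ring.finite_dimension Q K (carrier Q) then enat (ring.dim Q K (carrier Q)) else \<infinity>)"

definition common_eigenvalue :: "complex mat list \<Rightarrow> complex vec \<Rightarrow> bool" where
  "common_eigenvalue Gs v \<longleftrightarrow> v \<in> carrier_vec (length Gs) \<and>
     (\<exists>w. \<forall>i<length Gs. eigenvector (Gs ! i) w (v $ i))"

section \<open>Rectangular operator determinants\<close>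

definition kronecker :: "'a::times mat \<Rightarrow> 'a mat \<Rightarrow> 'a mat" where
  "kronecker A B = mat (dim_row A * dim_row B) (dim_col A * dim_col B)
     (\<lambda>(i, j). A $$ (i div dim_row B, j div dim_col B) * B $$ (i mod dim_row B, j mod dim_col B))"

definition kronecker_list :: "'a::semiring_1 mat list \<Rightarrow> 'a mat" where
  "kronecker_list Cs = foldr kronecker Cs (1\<^sub>m 1)"

definition op_det :: "nat \<Rightarrow> nat \<Rightarrow> complex mat list \<Rightarrow> complex mat" where
  "op_det m n Cs = mat (m ^ length Cs) (n ^ length Cs)
     (\<lambda>ij. \<Sum>\<sigma> | \<sigma> permutes {..<length Cs}.
        of_int (sign \<sigma>) * kronecker_list (map (\<lambda>l. Cs ! \<sigma> l) [0..<length Cs]) $$ ij)"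

definition op_Delta :: "nat \<Rightarrow> nat \<Rightarrow> complex mat \<Rightarrow> complex mat list \<Rightarrow> nat \<Rightarrow> complex mat" where
  "op_Delta m n A Bs i = (if i = 0 then op_det m n Bs else - op_det m n (Bs[i - 1 := A]))"

section \<open>Compression\<close>

text \<open>
  The multi-indices of length \<open>k\<close> with values below \<open>n\<close>, in lexicographic order; there are
  \<open>n ^ k\<close> of them. Filtering keeps the lexicographic order.
\<close>

definition multi_indices :: "nat \<Rightarrow> nat \<Rightarrow> nat list list" where
  "multi_indices n k = product_lists (replicate k [0..<n])"

definition compression_T :: "nat \<Rightarrow> nat \<Rightarrow> complex mat" where
  "compression_T n k = mat (n ^ k) ((n + k - 1) choose k)
     (\<lambda>(r, c). if mset (multi_indices n k ! r) = mset (filter sorted (multi_indices n k) ! c)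
               then 1 else 0)"

definition compression_L :: "nat \<Rightarrow> nat \<Rightarrow> complex mat" where
  "compression_L n k = mat ((n + k - 1) choose k) ((n + k - 1) ^ k)
     (\<lambda>(r, c). if filter (sorted_wrt (<)) (multi_indices (n + k - 1) k) ! r
                  = multi_indices (n + k - 1) k ! c
               then 1 else 0)"

definition compressed_Delta ::
    "nat \<Rightarrow> nat \<Rightarrow> complex mat \<Rightarrow> complex mat list \<Rightarrow> nat \<Rightarrow> complex mat" where
  "compressed_Delta n k A Bs i =
     compression_L n k * op_Delta (n + k - 1) n A Bs i * compression_T n k"

end

theory Submission
  imports Defs
    "HOL-Computational_Algebra.Field_as_Ring"
    "HOL-Computational_Algebra.Fundamental_Theorem_Algebra"
    "HOL-Computational_Algebra.Polynomial_Factorial"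
    "Jordan_Normal_Form.VS_Connect"
begin

text \<open>
  Write \<open>m = n + k - 1\<close>, let \<open>x\<close> be a vector of \<open>n\<close> variables and \<open>\<lambda>\<close> one of \<open>k\<close> variables. By Cramer's
  rule, modulo the rows of \<open>(A + \<Sum> \<lambda>\<^sub>i B\<^sub>i) x\<close> one has \<open>\<lambda>\<^sub>i d\<^sub>0 = d\<^sub>i\<close>, where \<open>d\<^sub>0\<close> is a maximal minor of
  \<open>[B\<^sub>1 x | \<dots> | B\<^sub>k x]\<close> and \<open>d\<^sub>i\<close> arises from it by replacing column \<open>i\<close> by \<open>- A x\<close>; the rows of \<open>D\<^sub>0\<close> and
  \<open>D\<^sub>i\<close> are the coefficient vectors of these forms. There are as many minors as monomials of degree \<open>k\<close>
  in \<open>x\<close>, so \<open>D\<^sub>0\<close> is nonsingular exactly if the minors form a basis, and then \<open>D\<^sub>0\<^sup>-\<^sup>1 D\<^sub>i\<close> is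
  multiplication by \<open>\<lambda>\<^sub>i\<close>. Commutation and the common eigenvectors follow from this description.

  For the count of multiplicities the same is done with \<open>\<lambda>\<close> and \<open>x\<close> exchanged: the maximal minors of
  \<open>\<Sum> \<lambda>\<^sub>i B\<^sub>i\<close> generically form a basis of the forms of degree \<open>n\<close> in \<open>\<lambda>\<close>. Hence reduction modulo the
  minors of \<open>A + \<Sum> \<lambda>\<^sub>i B\<^sub>i\<close> leaves the polynomials of degree less than \<open>n\<close>, a space of dimension
  \<open>m choose k\<close>. The reduction is well defined because every linear syzygy of the leading forms comes
  from repeating a column (the second map of the Eagon-Northcott complex), so that it lifts. The quotient is
  then split by idempotents into its local rings.

  Both genericity conditions are polynomial in \<open>B\<close> and hold for banded Toeplitz matrices.
\<close>

text \<open>\<open>A\<close> is arbitrary, so eigenvalues may be multiple and the matrices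
  \<open>D_0^-1 D_i\<close> may fail to be diagonalisable. Commutation therefore cannot be read off
  from eigenvectors, nor the count from distinct points; both are derived from identities between
  minors that hold for every \<open>A\<close>. Only \<open>B\<close> has to be generic because
  \<open>D_0\<close> and the leading forms of the minors in \<lambda> are free of \<open>A\<close>.

  Spanning is deduced from independence. The number of rows \<open>n + k - 1\<close> makes three
  systems square: minors against monomials; cofactor vectors against tuples of forms of degree
  \<open>k - 1\<close> in \<open>x\<close>; and relations together with preimages of the monomials
  of degree \<open>n + 1\<close> against linear multiples of the minors. To each of them
  \<open>square_span\<close> applies.

  The normal form arises from operators: multiply by a variable and reduce. On the polynomials of
  degree less than \<open>n\<close> these operators commute, so applying them to \<open>1\<close> in
  any order is meaningful, and this is where the syzygies enter. The idempotents are products of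
  univariate ones, obtained by the Chinese remainder theorem from one annihilating polynomial per
  coordinate.\<close>

abbreviation mcoeff :: "mpoly \<Rightarrow> (nat \<Rightarrow>\<^sub>0 nat) \<Rightarrow> complex" where
  "mcoeff \<equiv> Poly_Mapping.lookup"

abbreviation mmonom :: "(nat \<Rightarrow>\<^sub>0 nat) \<Rightarrow> mpoly" where
  "mmonom m \<equiv> Poly_Mapping.single m 1"

lemma mconst_0 [simp]: "mconst 0 = 0"
  and mconst_1 [simp]: "mconst 1 = 1"
  and mconst_add: "mconst (a + b) = mconst a + mconst b"
  and mconst_diff: "mconst (a - b) = mconst a - mconst b"
  and mconst_uminus: "mconst (- a) = - mconst a"
  and mconst_mult: "mconst (a * b) = mconst a * mconst b"
  by (simp_all add: mconst_def single_add single_diff single_uminus mult_single)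

lemma mconst_sum: "mconst (sum f A) = (\<Sum>x\<in>A. mconst (f x))"
  by (induct A rule: infinite_finite_induct) (simp_all add: mconst_add)

lemma mconst_power: "mconst (a ^ n) = mconst a ^ n"
  by (induct n) (simp_all add: mconst_mult)

lemma mconst_of_int: "mconst (of_int z) = of_int z"
  by (simp add: mconst_def)

lemma mconst_single: "mconst c * Poly_Mapping.single m d = Poly_Mapping.single m (c * d)"
  by (simp add: mconst_def mult_single)

lemma mcoeff_mconst_mult [simp]: "mcoeff (mconst c * p) m = c * mcoeff p m"
proof -
  have "mconst c * p = Poly_Mapping.map ((*) c) p"
    by (simp add: mconst_def mult_map_scale_conv_mult)
  then show ?thesis
    by (simp add: Poly_Mapping.map.rep_eq when_def)
qed

interpretation mp: vector_space "\<lambda>c p. mconst c * (p :: mpoly)"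
  by unfold_locales (simp_all add: algebra_simps mconst_add mconst_mult)

lemma mpoly_expand:
  assumes "finite S" "Poly_Mapping.keys p \<subseteq> S"
  shows "p = (\<Sum>m\<in>S. mconst (mcoeff p m) * mmonom m)"
proof (rule poly_mapping_eqI)
  fix m
  have "(\<Sum>x\<in>S. mcoeff p x * mcoeff (mmonom x) m) = (\<Sum>x\<in>S. if x = m then mcoeff p x else 0)"
    by (rule sum.cong) (auto simp: lookup_single)
  also have "\<dots> = mcoeff p m"
    using assms by (auto simp: sum.delta in_keys_iff)
  finally show "mcoeff p m = mcoeff (\<Sum>m\<in>S. mconst (mcoeff p m) * mmonom m) m"
    by (simp add: lookup_sum)
qed

lemma mpoly_induct [case_names single add]:
  fixes p :: mpoly
  assumes "\<And>m c. P (Poly_Mapping.single m c)" and "\<And>p q. P p \<Longrightarrow> P q \<Longrightarrow> P (p + q)"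
  shows "P p"
proof -
  have "P (\<Sum>m\<in>S. Poly_Mapping.single m (mcoeff p m))" if "finite S" for S
    using that
  proof induct
    case empty
    show ?case using assms(1)[of 0 0] by simp
  qed (simp add: assms)
  from this[OF finite_keys[of p]] show ?thesis
    by (subst mpoly_expand[of "Poly_Mapping.keys p"]) (simp_all add: mconst_single)
qed

section \<open>Monomials and degrees\<close>

definition mdeg :: "(nat \<Rightarrow>\<^sub>0 nat) \<Rightarrow> nat" where
  "mdeg m = sum (Poly_Mapping.lookup m) (Poly_Mapping.keys m)"

lemma mdeg_superset:
  assumes "finite S" "Poly_Mapping.keys m \<subseteq> S"
  shows "mdeg m = sum (Poly_Mapping.lookup m) S"
  unfolding mdeg_def by (rule sum.mono_neutral_left) (use assms in \<open>auto simp: in_keys_iff\<close>)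

lemma keys_add_nat:
  fixes a b :: "nat \<Rightarrow>\<^sub>0 nat"
  shows "Poly_Mapping.keys (a + b) = Poly_Mapping.keys a \<union> Poly_Mapping.keys b"
  by (auto simp: in_keys_iff lookup_add)

lemma mdeg_add [simp]: "mdeg (a + b) = mdeg a + mdeg b"
proof -
  let ?S = "Poly_Mapping.keys a \<union> Poly_Mapping.keys b"
  have "mdeg (a + b) = sum (Poly_Mapping.lookup (a + b)) ?S"
    by (rule mdeg_superset) (simp_all add: keys_add_nat)
  also have "\<dots> = sum (Poly_Mapping.lookup a) ?S + sum (Poly_Mapping.lookup b) ?S"
    by (simp add: lookup_add sum.distrib)
  also have "\<dots> = mdeg a + mdeg b"
    by (simp add: mdeg_superset[of ?S a] mdeg_superset[of ?S b])
  finally show ?thesis .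
qed

lemma mdeg_0 [simp]: "mdeg 0 = 0"
  by (simp add: mdeg_def)

lemma mdeg_single [simp]: "mdeg (Poly_Mapping.single i e) = e"
  by (simp add: mdeg_def)

lemma mdeg_eq_0: "mdeg m = 0 \<longleftrightarrow> m = 0"
  by (auto simp: mdeg_def in_keys_iff) (metis keys_eq_empty sum_eq_0_iff finite_keys in_keys_iff equals0I)

definition monoms :: "nat \<Rightarrow> (nat \<Rightarrow>\<^sub>0 nat) set" where
  "monoms v = {m. Poly_Mapping.keys m \<subseteq> {..<v}}"

text \<open>A set of degrees in place of a single one: forms, polynomials of degree below
  \<open>d\<close> and of degree at most \<open>d\<close> become instances of one notion and share
  \<open>mult_monoms_deg\<close>.\<close>

definition monoms_deg :: "nat \<Rightarrow> nat set \<Rightarrow> (nat \<Rightarrow>\<^sub>0 nat) set" where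
  "monoms_deg v D = {m \<in> monoms v. mdeg m \<in> D}"

definition supported :: "(nat \<Rightarrow>\<^sub>0 nat) set \<Rightarrow> mpoly set" where
  "supported S = {p. Poly_Mapping.keys p \<subseteq> S}"

abbreviation homog :: "nat \<Rightarrow> nat \<Rightarrow> mpoly set" where
  "homog v d \<equiv> supported (monoms_deg v {d})"

abbreviation deglt :: "nat \<Rightarrow> nat \<Rightarrow> mpoly set" where
  "deglt v d \<equiv> supported (monoms_deg v {..<d})"

abbreviation degle :: "nat \<Rightarrow> nat \<Rightarrow> mpoly set" where
  "degle v d \<equiv> supported (monoms_deg v {..d})"

lemma polys_eq: "polys v = supported (monoms v)"
  by (auto simp: polys_def supported_def monoms_def)

lemma supportedI: "(\<And>m. mcoeff p m \<noteq> 0 \<Longrightarrow> m \<in> S) \<Longrightarrow> p \<in> supported S"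
  by (auto simp: supported_def in_keys_iff)

lemma supportedD: "p \<in> supported S \<Longrightarrow> m \<notin> S \<Longrightarrow> mcoeff p m = 0"
  by (auto simp: supported_def in_keys_iff)

lemma supported_0 [simp]: "0 \<in> supported S"
  by (simp add: supported_def)

lemma supported_add: "p \<in> supported S \<Longrightarrow> q \<in> supported S \<Longrightarrow> p + q \<in> supported S"
  by (rule supportedI) (metis add.right_neutral lookup_add supportedD)

lemma supported_uminus: "p \<in> supported S \<Longrightarrow> - p \<in> supported S"
  by (simp add: supported_def)

lemma supported_diff: "p \<in> supported S \<Longrightarrow> q \<in> supported S \<Longrightarrow> p - q \<in> supported S"
  using supported_add[of p S "- q"] supported_uminus[of q S] by simp

lemma supported_scale: "p \<in> supported S \<Longrightarrow> mconst c * p \<in> supported S"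
  by (rule supportedI) (metis mcoeff_mconst_mult mult_eq_0_iff supportedD)

lemma supported_sum: "(\<And>x. x \<in> A \<Longrightarrow> f x \<in> supported S) \<Longrightarrow> sum f A \<in> supported S"
  by (induct A rule: infinite_finite_induct) (simp_all add: supported_add)

lemma supported_mult:
  assumes "p \<in> supported S" "q \<in> supported T" "\<And>a b. a \<in> S \<Longrightarrow> b \<in> T \<Longrightarrow> a + b \<in> U"
  shows "p * q \<in> supported U"
  using assms keys_mult[of p q] by (fastforce simp: supported_def)

lemma supported_single: "m \<in> S \<Longrightarrow> Poly_Mapping.single m c \<in> supported S"
  by (auto simp: supported_def)

lemma supported_disjoint:
  "p \<in> supported S \<Longrightarrow> p \<in> supported T \<Longrightarrow> S \<inter> T = {} \<Longrightarrow> p = 0"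
  unfolding supported_def using keys_eq_empty[of p] by blast

lemma monoms_0 [simp]: "0 \<in> monoms v"
  and monoms_add: "a \<in> monoms v \<Longrightarrow> b \<in> monoms v \<Longrightarrow> a + b \<in> monoms v"
  and monoms_single [simp]: "i < v \<Longrightarrow> Poly_Mapping.single i e \<in> monoms v"
  by (auto simp: monoms_def keys_add_nat)

lemma mult_monoms_deg:
  assumes "p \<in> supported (monoms_deg v D)" "q \<in> supported (monoms_deg v E)"
    and "\<And>a b. a \<in> D \<Longrightarrow> b \<in> E \<Longrightarrow> a + b \<in> F"
  shows "p * q \<in> supported (monoms_deg v F)"
  by (rule supported_mult[OF assms(1,2)]) (use assms(3) in \<open>auto simp: monoms_deg_def monoms_add\<close>)

lemma homog_mult: "p \<in> homog v a \<Longrightarrow> q \<in> homog v b \<Longrightarrow> p * q \<in> homog v (a + b)"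
  by (erule (1) mult_monoms_deg) simp

lemma deglt_mult: "p \<in> deglt v a \<Longrightarrow> q \<in> degle v b \<Longrightarrow> p * q \<in> deglt v (a + b)"
  by (erule (1) mult_monoms_deg) simp

lemma homog_degle: "p \<in> homog v a \<Longrightarrow> p \<in> degle v a"
  and deglt_degle: "p \<in> deglt v a \<Longrightarrow> p \<in> degle v a"
  and deglt_Suc: "deglt v (Suc a) = degle v a"
  and homog_polys: "p \<in> homog v a \<Longrightarrow> p \<in> polys v"
  and deglt_polys: "p \<in> deglt v a \<Longrightarrow> p \<in> polys v"
  and degle_polys: "p \<in> degle v a \<Longrightarrow> p \<in> polys v"
  unfolding polys_eq by (auto simp: supported_def monoms_deg_def)

lemma homog_deglt_0: "p \<in> homog v a \<Longrightarrow> p \<in> deglt v a \<Longrightarrow> p = 0"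
  by (erule (1) supported_disjoint) (auto simp: monoms_deg_def)

lemma mvar_homog [simp]: "i < v \<Longrightarrow> mvar i \<in> homog v (Suc 0)"
  by (auto simp: mvar_def monoms_deg_def intro!: supported_single)

lemma mconst_homog [simp]: "mconst c \<in> homog v 0"
  by (auto simp: mconst_def monoms_deg_def intro!: supported_single)

lemma polys_mvar [simp]: "i < v \<Longrightarrow> mvar i \<in> polys v"
  by (rule homog_polys[OF mvar_homog])

lemma polys_mconst [simp]: "mconst c \<in> polys v"
  by (rule homog_polys[OF mconst_homog])

lemma polys_0 [simp]: "0 \<in> polys v" and polys_1 [simp]: "1 \<in> polys v"
  using polys_mconst[of 0 v] polys_mconst[of 1 v] by simp_all

lemma polys_add: "p \<in> polys v \<Longrightarrow> q \<in> polys v \<Longrightarrow> p + q \<in> polys v"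
  and polys_diff: "p \<in> polys v \<Longrightarrow> q \<in> polys v \<Longrightarrow> p - q \<in> polys v"
  and polys_uminus: "p \<in> polys v \<Longrightarrow> - p \<in> polys v"
  and polys_mult: "p \<in> polys v \<Longrightarrow> q \<in> polys v \<Longrightarrow> p * q \<in> polys v"
  and polys_sum: "(\<And>x. x \<in> A \<Longrightarrow> f x \<in> polys v) \<Longrightarrow> sum f A \<in> polys v"
  unfolding polys_eq
  by (auto intro: supported_add supported_diff supported_uminus supported_mult supported_sum monoms_add)

lemma polys_of_int [simp]: "of_int z \<in> polys v"
  by (metis mconst_of_int polys_mconst)

lemma polys_prod: "(\<And>x. x \<in> A \<Longrightarrow> f x \<in> polys v) \<Longrightarrow> prod f A \<in> polys v"
  by (induct A rule: infinite_finite_induct) (simp_all add: polys_mult)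

lemma polys_power: "p \<in> polys v \<Longrightarrow> p ^ e \<in> polys v"
  by (induct e) (simp_all add: polys_mult)

lemma mvar_power: "mvar i ^ e = mmonom (Poly_Mapping.single i e)"
  by (induct e) (simp_all add: mvar_def mult_single flip: single_add)

lemma update_eq_add:
  fixes m :: "nat \<Rightarrow>\<^sub>0 nat"
  assumes "i \<notin> Poly_Mapping.keys m"
  shows "Poly_Mapping.update i e m = Poly_Mapping.single i e + m"
  using assms by (intro poly_mapping_eqI) (auto simp: lookup_update lookup_add lookup_single in_keys_iff when_def)

text \<open>Induction over the algebra generated by constants and variables, for properties that
  pass through products, such as preserving the kernel of \<open>NF\<close> or being constant modulo
  nilpotents.\<close>

lemma polys_induct [consumes 1, case_names const var add mult]:
  assumes "p \<in> polys v"
    and const: "\<And>c. P (mconst c)" and var: "\<And>i. i < v \<Longrightarrow> P (mvar i)"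
    and add: "\<And>p q. p \<in> polys v \<Longrightarrow> q \<in> polys v \<Longrightarrow> P p \<Longrightarrow> P q \<Longrightarrow> P (p + q)"
    and mult: "\<And>p q. p \<in> polys v \<Longrightarrow> q \<in> polys v \<Longrightarrow> P p \<Longrightarrow> P q \<Longrightarrow> P (p * q)"
  shows "P p"
proof -
  have pw: "P (mvar i ^ e)" if "i < v" for i e
    using const[of 1] var[OF that] by (induct e) (simp_all add: mult that polys_power)
  have mon: "m \<in> monoms v \<Longrightarrow> P (mmonom m)" for m :: "nat \<Rightarrow>\<^sub>0 nat"
  proof (induct m rule: update_induct)
    case (const)
    show ?case using assms(2)[of 1] by simp
  next
    case (update f a b)
    then have a: "a < v" and f: "f \<in> monoms v"
      by (auto simp: monoms_def keys_update)
    have "mmonom (Poly_Mapping.update a b f) = mvar a ^ b * mmonom f"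
      using update(1) by (simp add: update_eq_add mvar_power mult_single)
    moreover have "mmonom f \<in> polys v"
      unfolding polys_eq by (rule supported_single[OF f])
    ultimately show ?case
      using mult[OF polys_power[OF polys_mvar[OF a]] _ pw[OF a] update(3)[OF f]] by simp
  qed
  have "P (\<Sum>m\<in>S. mconst (mcoeff p m) * mmonom m) \<and>
      (\<Sum>m\<in>S. mconst (mcoeff p m) * mmonom m) \<in> polys v" if "finite S" "S \<subseteq> monoms v" for S
    using that
  proof (induct S)
    case empty
    show ?case using const[of 0] by simp
  next
    case (insert m S)
    have "mmonom m \<in> polys v"
      unfolding polys_eq by (rule supported_single) (use insert in auto)
    then show ?case
      using insert by (auto intro!: add mult mon const polys_add polys_mult)
  qed
  from this[of "Poly_Mapping.keys p"] show ?thesis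
    using assms(1) mpoly_expand[of "Poly_Mapping.keys p" p] by (auto simp: polys_eq supported_def)
qed

section \<open>Evaluation\<close>

definition monom_eval :: "(nat \<Rightarrow>\<^sub>0 nat) \<Rightarrow> complex vec \<Rightarrow> complex" where
  "monom_eval m x = (\<Prod>i\<in>Poly_Mapping.keys m. (x $ i) ^ Poly_Mapping.lookup m i)"

lemma monom_eval_superset:
  assumes "finite S" "Poly_Mapping.keys m \<subseteq> S"
  shows "monom_eval m x = (\<Prod>i\<in>S. (x $ i) ^ Poly_Mapping.lookup m i)"
  unfolding monom_eval_def by (rule prod.mono_neutral_left) (use assms in \<open>auto simp: in_keys_iff\<close>)

lemma monom_eval_add: "monom_eval (a + b) x = monom_eval a x * monom_eval b x"
proof -
  let ?S = "Poly_Mapping.keys a \<union> Poly_Mapping.keys b"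
  show ?thesis
    by (simp add: monom_eval_superset[of ?S] keys_add_nat lookup_add power_add prod.distrib)
qed

lemma meval_superset:
  assumes "finite S" "Poly_Mapping.keys p \<subseteq> S"
  shows "meval p x = (\<Sum>m\<in>S. mcoeff p m * monom_eval m x)"
  unfolding meval_def monom_eval_def[symmetric]
  by (rule sum.mono_neutral_left) (use assms in \<open>auto simp: in_keys_iff\<close>)

lemma meval_0 [simp]: "meval 0 x = 0"
  by (simp add: meval_def)

lemma meval_add: "meval (p + q) x = meval p x + meval q x"
proof -
  let ?S = "Poly_Mapping.keys p \<union> Poly_Mapping.keys q"
  show ?thesis
    using Poly_Mapping.keys_add[of p q]
    by (simp add: meval_superset[of ?S] lookup_add sum.distrib algebra_simps)
qed

lemma meval_single: "meval (Poly_Mapping.single m c) x = c * monom_eval m x"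
  by (subst meval_superset[of "{m}"]) auto

lemma meval_mult: "meval (p * q) x = meval p x * meval q x"
proof (induct p rule: mpoly_induct)
  case (single m c)
  show ?case
    by (induct q rule: mpoly_induct)
      (simp_all add: mult_single meval_single monom_eval_add meval_add algebra_simps)
qed (simp add: meval_add algebra_simps)

lemma meval_mconst [simp]: "meval (mconst c) x = c"
  by (simp add: mconst_def meval_single monom_eval_def)

lemma meval_1 [simp]: "meval 1 x = 1"
  using meval_mconst[of 1] by simp

lemma meval_mvar [simp]: "meval (mvar i) x = x $ i"
  by (simp add: mvar_def meval_single monom_eval_def)

interpretation meval: comm_ring_hom "\<lambda>p. meval p x" for x
  by unfold_locales (simp_all add: meval_add meval_mult)

section \<open>Monomials as multi-indices, and their number\<close>

definition list_monom :: "nat list \<Rightarrow> (nat \<Rightarrow>\<^sub>0 nat)" where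
  "list_monom xs = (\<Sum>i\<leftarrow>xs. Poly_Mapping.single i 1)"

lemma list_monom_simps [simp]:
  "list_monom [] = 0" "list_monom (x # xs) = Poly_Mapping.single x 1 + list_monom xs"
  by (simp_all add: list_monom_def)

lemma lookup_list_monom: "Poly_Mapping.lookup (list_monom xs) i = count (mset xs) i"
  by (induct xs) (auto simp: lookup_add lookup_single when_def)

text \<open>The right-hand side is the condition for an entry 1 of \<open>T\<close>, which is why
  \<open>T\<close> collects the terms belonging to one monomial.\<close>

lemma list_monom_eq_iff: "list_monom xs = list_monom ys \<longleftrightarrow> mset xs = mset ys"
  by (metis lookup_list_monom multiset_eqI poly_mapping_eqI)

lemma mdeg_list_monom [simp]: "mdeg (list_monom xs) = length xs"
  by (induct xs) auto

lemma keys_list_monom: "Poly_Mapping.keys (list_monom xs) = set xs"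
  by (auto simp: in_keys_iff lookup_list_monom)

definition monom_mset :: "(nat \<Rightarrow>\<^sub>0 nat) \<Rightarrow> nat multiset" where
  "monom_mset m = Abs_multiset (Poly_Mapping.lookup m)"

lemma count_monom_mset: "count (monom_mset m) = Poly_Mapping.lookup m"
  unfolding monom_mset_def by (rule count_Abs_multiset) (simp add: finite_lookup_nat)

lemma list_monom_surj: "\<exists>xs. sorted xs \<and> list_monom xs = m"
proof (intro exI conjI)
  show "sorted (sorted_list_of_multiset (monom_mset m))"
    by simp
  show "list_monom (sorted_list_of_multiset (monom_mset m)) = m"
    by (rule poly_mapping_eqI) (simp add: lookup_list_monom count_monom_mset)
qed

definition index_lists :: "nat \<Rightarrow> nat \<Rightarrow> nat list set" where
  "index_lists n k = {xs. length xs = k \<and> set xs \<subseteq> {..<n}}"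

definition sorted_lists :: "nat \<Rightarrow> nat \<Rightarrow> nat list set" where
  "sorted_lists n k = {xs \<in> index_lists n k. sorted xs}"

definition strict_lists :: "nat \<Rightarrow> nat \<Rightarrow> nat list set" where
  "strict_lists n k = {xs \<in> index_lists n k. sorted_wrt (<) xs}"

lemma finite_index_lists [simp]: "finite (index_lists n k)"
  using finite_lists_length_eq[of "{..<n}" k] by (simp add: index_lists_def conj_commute)

lemma finite_sorted_lists [simp]: "finite (sorted_lists n k)"
  and finite_strict_lists [simp]: "finite (strict_lists n k)"
  by (simp_all add: sorted_lists_def strict_lists_def)

lemma bij_list_monom: "bij_betw list_monom (sorted_lists n k) (monoms_deg n {k})"
proof (rule bij_betwI')
  fix xs ys assume "xs \<in> sorted_lists n k" "ys \<in> sorted_lists n k"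
  then show "(list_monom xs = list_monom ys) = (xs = ys)"
    by (auto simp: list_monom_eq_iff sorted_lists_def) (metis sorted_sort_id properties_for_sort)
next
  fix xs assume "xs \<in> sorted_lists n k"
  then show "list_monom xs \<in> monoms_deg n {k}"
    by (auto simp: monoms_deg_def monoms_def keys_list_monom sorted_lists_def index_lists_def)
next
  fix m assume m: "m \<in> monoms_deg n {k}"
  obtain xs where "sorted xs" "list_monom xs = m"
    using list_monom_surj by blast
  then show "\<exists>x\<in>sorted_lists n k. m = list_monom x"
    using m by (auto simp: monoms_deg_def monoms_def keys_list_monom sorted_lists_def index_lists_def
        intro!: bexI[of _ xs])
qed

lemma strict_lists_bij: "bij_betw set (strict_lists n k) {S. S \<subseteq> {..<n} \<and> card S = k}"
proof (rule bij_betwI')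
  fix xs ys assume "xs \<in> strict_lists n k" "ys \<in> strict_lists n k"
  then show "(set xs = set ys) = (xs = ys)"
    by (auto simp: strict_lists_def strict_sorted_equal)
next
  fix xs assume "xs \<in> strict_lists n k"
  then show "set xs \<in> {S. S \<subseteq> {..<n} \<and> card S = k}"
    by (auto simp: strict_lists_def index_lists_def strict_sorted_iff distinct_card)
next
  fix S assume S: "S \<in> {S. S \<subseteq> {..<n} \<and> card S = k}"
  then have "finite S" using finite_subset by blast
  then show "\<exists>x\<in>strict_lists n k. S = set x"
    using S by (intro bexI[of _ "sorted_list_of_set S"]) (auto simp: strict_lists_def index_lists_def)
qed

lemma card_strict_lists: "card (strict_lists n k) = n choose k"
  using bij_betw_same_card[OF strict_lists_bij[of n k]] n_subsets[of "{..<n}" k] by simp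

lemma strict_nth_add_le:
  assumes "sorted_wrt (<) (xs :: nat list)" "i \<le> j" "j < length xs"
  shows "xs ! i + (j - i) \<le> xs ! j"
  using assms(2,3)
proof (induct j rule: dec_induct)
  case (step j)
  have "xs ! j < xs ! Suc j"
    using assms(1) step by (simp add: sorted_wrt_iff_nth_less)
  with step show ?case by simp
qed simp

text \<open>Adding \<open>i\<close> to entry number \<open>i\<close> turns weakly into strictly
  increasing lists and raises the last bound by \<open>k - 1\<close>.\<close>

lemma card_sorted_lists: "card (sorted_lists n k) = (n + k - 1) choose k"
proof -
  let ?f = "\<lambda>xs. map (\<lambda>i. xs ! i + i) [0..<length xs]"
  let ?g = "\<lambda>xs. map (\<lambda>i. xs ! i - i) [0..<length xs]"
  have "bij_betw ?f (sorted_lists n k) (strict_lists (n + k - 1) k)"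
  proof (rule bij_betw_byWitness[of _ ?g])
    show "\<forall>a\<in>sorted_lists n k. ?g (?f a) = a"
      by (auto intro!: nth_equalityI)
    \<comment> \<open>Guarantees that the subtraction in \<open>?g\<close> is not truncated.\<close>
    have lo: "i \<le> xs ! i" if "xs \<in> strict_lists (n + k - 1) k" "i < length xs" for xs i
      using strict_nth_add_le[of xs 0 i] that by (auto simp: strict_lists_def)
    show "\<forall>a\<in>strict_lists (n + k - 1) k. ?f (?g a) = a"
      using lo by (auto intro!: nth_equalityI)
    show "?f ` sorted_lists n k \<subseteq> strict_lists (n + k - 1) k"
    proof (clarify)
      fix xs assume xs: "xs \<in> sorted_lists n k"
      then have len: "length xs = k" and s: "sorted xs" and "set xs \<subseteq> {..<n}"
        by (auto simp: sorted_lists_def index_lists_def)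
      then have "xs ! i < n" if "i < k" for i using that nth_mem by blast
      then have "xs ! i + i < n + k - 1" if "i < k" for i
        using that by fastforce
      then show "?f xs \<in> strict_lists (n + k - 1) k"
        using len s by (auto simp: strict_lists_def index_lists_def sorted_wrt_iff_nth_less
            sorted_iff_nth_mono intro!: add_le_less_mono)
    qed
    show "?g ` strict_lists (n + k - 1) k \<subseteq> sorted_lists n k"
    proof (clarify)
      fix xs assume xs: "xs \<in> strict_lists (n + k - 1) k"
      then have len: "length xs = k" and s: "sorted_wrt (<) xs" and sub: "set xs \<subseteq> {..<n + k - 1}"
        by (auto simp: strict_lists_def index_lists_def)
      have 1: "xs ! i - i < n" if "i < k" for i
      proof -
        have "xs ! (k - 1) \<in> set xs" using len that by (intro nth_mem) simp
        then have "xs ! (k - 1) < n + k - 1" using sub by blast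
        then show ?thesis
          using strict_nth_add_le[OF s, of i "k - 1"] len that lo[OF xs, of i] by linarith
      qed
      have 2: "xs ! i - i \<le> xs ! j - j" if "i \<le> j" "j < k" for i j
        using strict_nth_add_le[OF s, of i j] len that by linarith
      show "?g xs \<in> sorted_lists n k"
        using len 1 2 by (auto simp: sorted_lists_def index_lists_def sorted_iff_nth_mono)
    qed
  qed
  from bij_betw_same_card[OF this] show ?thesis
    by (simp add: card_strict_lists)
qed

lemma finite_monoms_homog [simp]: "finite (monoms_deg n {k})"
  using bij_betw_finite[OF bij_list_monom] by simp

lemma card_monoms_homog: "card (monoms_deg n {k}) = (n + k - 1) choose k"
  using bij_betw_same_card[OF bij_list_monom[of n k]] card_sorted_lists by simp

lemma finite_monoms_lt [simp]: "finite (monoms_deg n {..<k})"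
proof -
  have "monoms_deg n {..<k} = (\<Union>d<k. monoms_deg n {d})"
    by (auto simp: monoms_deg_def)
  then show ?thesis by simp
qed

text \<open>Induction on \<open>n\<close> adds the forms of degree \<open>n\<close>, and Pascal's
  rule sums up. With \<open>v = k\<close> this is the dimension of the space of normal
  forms.\<close>

lemma card_monoms_lt:
  assumes "v > 0" "n > 0"
  shows "card (monoms_deg v {..<n}) = (n + v - 1) choose v"
  using assms(2)
proof (induct n rule: nat_induct_non_zero)
  case 1
  have "monoms_deg v {..<1} = {0}"
    by (auto simp: monoms_deg_def mdeg_eq_0)
  then show ?case by simp
next
  case (Suc n)
  have "monoms_deg v {..<Suc n} = monoms_deg v {..<n} \<union> monoms_deg v {n}"
    by (auto simp: monoms_deg_def)
  moreover have "monoms_deg v {..<n} \<inter> monoms_deg v {n} = {}"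
    by (auto simp: monoms_deg_def)
  ultimately have "card (monoms_deg v {..<Suc n}) = ((n + v - 1) choose v) + ((v + n - 1) choose n)"
    using Suc by (simp add: card_Un_disjoint card_monoms_homog)
  also have "(v + n - 1) choose n = (n + v - 1) choose (v - 1)"
    using binomial_symmetric[of n "v + n - 1"] assms(1) by (simp add: add.commute)
  also have "((n + v - 1) choose v) + ((n + v - 1) choose (v - 1)) = (Suc n + v - 1) choose v"
    using assms(1) Suc(1) by (cases v) (auto simp: numeral_eq_Suc)
  finally show ?case .
qed

section \<open>Square systems\<close>

text \<open>\<open>X\<close> indexes the unknowns and \<open>Y\<close> the equations. Equal
  cardinalities make the matrix square, so trivial kernel means invertible. Arbitrary finite index
  sets let it be applied to lists, monomials and pairs of these alike.\<close>

lemma square_span: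
  fixes M :: "'x \<Rightarrow> 'y \<Rightarrow> complex"
  assumes fin: "finite X" "finite Y" and card: "card X = card Y"
    and indep: "\<And>c. (\<And>y. y \<in> Y \<Longrightarrow> (\<Sum>x\<in>X. c x * M x y) = 0) \<Longrightarrow> \<forall>x\<in>X. c x = 0"
  shows "\<exists>c. \<forall>y\<in>Y. (\<Sum>x\<in>X. c x * M x y) = t y"
proof -
  define N where "N = card X"
  obtain f where f: "bij_betw f {0..<N} X" 
    unfolding N_def using ex_bij_betw_nat_finite[OF fin(1)] by blast
  obtain g where g: "bij_betw g {0..<N} Y" 
    unfolding N_def card using ex_bij_betw_nat_finite[OF fin(2)] by blast
  have Y: "Y = g ` {0..<N}" using g by (simp add: bij_betw_def)
  define A where "A = mat N N (\<lambda>(i, j). M (f j) (g i))"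
  have A: "A \<in> carrier_mat N N" by (simp add: A_def)
  define f' where "f' = the_inv_into {0..<N} f"
  have f': "f' (f i) = i" if "i < N" for i
    unfolding f'_def using f that by (simp add: the_inv_into_f_f bij_betw_def)
  have Av: "(A *\<^sub>v v) $ i = (\<Sum>x\<in>X. v $ f' x * M x (g i))" if "v \<in> carrier_vec N" "i < N" for v i
  proof -
    have "(A *\<^sub>v v) $ i = (\<Sum>j = 0..<N. v $ f' (f j) * M (f j) (g i))"
      using that by (simp add: A_def scalar_prod_def f' mult.commute)
    also have "\<dots> = (\<Sum>x\<in>X. v $ f' x * M x (g i))"
      by (rule sum.reindex_bij_betw[OF f])
    finally show ?thesis .
  qed
  have "det A \<noteq> 0"
  proof
    assume "det A = 0"
    then obtain v where v: "v \<in> carrier_vec N" "v \<noteq> 0\<^sub>v N" "A *\<^sub>v v = 0\<^sub>v N"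
      using det_0_iff_vec_prod_zero[OF A] by blast
    have "(\<Sum>x\<in>X. v $ f' x * M x y) = 0" if y: "y \<in> Y" for y
    proof -
      obtain i where "i < N" "y = g i" using y unfolding Y by auto
      then show ?thesis using Av[OF v(1)] v(3) by auto
    qed
    then have "\<forall>x\<in>X. v $ f' x = 0" by (rule indep)
    then have "v $ i = 0" if "i < N" for i
      using f'[OF that] bij_betwE[OF f] that by force
    then have "v = 0\<^sub>v N" using v(1) by (intro eq_vecI) auto
    then show False using v(2) by simp
  qed
  \<comment> \<open>The solution by the adjugate matrix.\<close>
  define v where "v = (1 / det A) \<cdot>\<^sub>v (adj_mat A *\<^sub>v vec N (\<lambda>i. t (g i)))"
  have adj: "adj_mat A \<in> carrier_mat N N" "A * adj_mat A = det A \<cdot>\<^sub>m 1\<^sub>m N"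
    using adj_mat[OF A] by auto
  have v: "v \<in> carrier_vec N"
    using adj by (simp add: v_def)
  have "A *\<^sub>v v = (1 / det A) \<cdot>\<^sub>v ((A * adj_mat A) *\<^sub>v vec N (\<lambda>i. t (g i)))"
  proof -
    have "A *\<^sub>v v = (1 / det A) \<cdot>\<^sub>v (A *\<^sub>v (adj_mat A *\<^sub>v vec N (\<lambda>i. t (g i))))"
      unfolding v_def by (rule mult_mat_vec[OF A]) (use adj in auto)
    then show ?thesis
      by (simp only: assoc_mult_mat_vec[OF A adj(1) vec_carrier])
  qed
  also have "\<dots> = vec N (\<lambda>i. t (g i))"
  proof (rule eq_vecI)
    fix i assume i: "i < dim_vec (vec N (\<lambda>i. t (g i)))"
    have "(\<Sum>j = 0..<N. det A * (if j = i then 1 else 0) * t (g j))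
        = (\<Sum>j = 0..<N. if j = i then det A * t (g j) else 0)"
      by (rule sum.cong) auto
    then show "((1 / det A) \<cdot>\<^sub>v ((A * adj_mat A) *\<^sub>v vec N (\<lambda>i. t (g i)))) $ i = vec N (\<lambda>i. t (g i)) $ i"
      unfolding adj(2) using i \<open>det A \<noteq> 0\<close> by (simp add: scalar_prod_def)
  qed (simp add: adj(2))
  finally have *: "A *\<^sub>v v = vec N (\<lambda>i. t (g i))" .
  show ?thesis
  proof (intro exI ballI)
    fix y assume "y \<in> Y"
    then obtain i where "i < N" "y = g i" unfolding Y by auto
    then show "(\<Sum>x\<in>X. v $ f' x * M x y) = t y"
      using Av[OF v] * by simp
  qed
qed

text \<open>Otherwise any \<open>card Y\<close> of the vectors would be independent, hence would
  span by \<open>square_span\<close> and express one of the others.\<close>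

lemma exists_dependency:
  fixes M :: "'x \<Rightarrow> 'y \<Rightarrow> complex"
  assumes fin: "finite X" "finite Y" and card: "card Y < card X"
  shows "\<exists>c. (\<exists>x\<in>X. c x \<noteq> 0) \<and> (\<forall>y\<in>Y. (\<Sum>x\<in>X. c x * M x y) = 0)"
proof (rule ccontr)
  assume no: "\<not> ?thesis"
  then have no': "\<forall>x\<in>X. c x = 0" if "\<forall>y\<in>Y. (\<Sum>x\<in>X. c x * M x y) = 0" for c
    using that by blast
  obtain X' where X': "X' \<subseteq> X" "card X' = card Y"
    using obtain_subset_with_card_n[OF less_imp_le[OF card]] by blast
  then have "X' \<noteq> X" using card by auto
  then obtain x0 where x0: "x0 \<in> X" "x0 \<notin> X'" using X' by blast
  have fin': "finite X'" using X' fin finite_subset by blast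
  have "\<exists>c. \<forall>y\<in>Y. (\<Sum>x\<in>X'. c x * M x y) = M x0 y"
  proof (rule square_span[OF fin' fin(2) X'(2)])
    fix c assume c: "\<And>y. y \<in> Y \<Longrightarrow> (\<Sum>x\<in>X'. c x * M x y) = 0"
    let ?c = "\<lambda>x. if x \<in> X' then c x else 0"
    have "(\<Sum>x\<in>X. ?c x * M x y) = (\<Sum>x\<in>X'. c x * M x y)" for y
      by (rule sum.mono_neutral_cong_right) (use fin X' in auto)
    then have "\<forall>x\<in>X. ?c x = 0" by (intro no' ballI) (simp only: c)
    moreover have "?c x = c x" if "x \<in> X'" for x using that by simp
    ultimately show "\<forall>x\<in>X'. c x = 0" using X'(1) by (metis subsetD)
  qed
  then obtain c where c: "\<forall>y\<in>Y. (\<Sum>x\<in>X'. c x * M x y) = M x0 y" by blast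
  let ?c = "\<lambda>x. if x = x0 then -1 else if x \<in> X' then c x else 0"
  have "(\<Sum>x\<in>X. ?c x * M x y) = 0" if "y \<in> Y" for y
  proof -
    have "(\<Sum>x\<in>X. ?c x * M x y) = (\<Sum>x\<in>insert x0 X'. ?c x * M x y)"
      by (rule sum.mono_neutral_right) (use fin x0 X' in auto)
    also have "\<dots> = - M x0 y + (\<Sum>x\<in>X'. ?c x * M x y)"
      using fin' x0 by simp
    also have "(\<Sum>x\<in>X'. ?c x * M x y) = (\<Sum>x\<in>X'. c x * M x y)"
      using x0 by (intro sum.cong) auto
    finally show ?thesis using c that by simp
  qed
  then have "\<forall>x\<in>X. ?c x = 0" by (intro no' ballI)
  then show False using x0(1) by (metis one_neq_zero neg_equal_0_iff_equal)
qed

section \<open>Minors\<close>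

text \<open>Entries come from a function and rows from a list, while the columns are always the
  first \<open>length xs\<close>. Replacing, prepending or deleting a column is then an operation on
  functions, and a row may be repeated.\<close>

definition minor :: "(nat \<Rightarrow> nat \<Rightarrow> 'a::comm_ring_1) \<Rightarrow> nat list \<Rightarrow> 'a" where
  "minor F xs = det (mat (length xs) (length xs) (\<lambda>(p, q). F (xs ! p) q))"

definition minor_cofactor :: "(nat \<Rightarrow> nat \<Rightarrow> 'a::comm_ring_1) \<Rightarrow> nat list \<Rightarrow> nat \<Rightarrow> nat \<Rightarrow> 'a" where
  "minor_cofactor F xs p q = cofactor (mat (length xs) (length xs) (\<lambda>(p, q). F (xs ! p) q)) p q"

definition replace_col :: "(nat \<Rightarrow> nat \<Rightarrow> 'a) \<Rightarrow> nat \<Rightarrow> (nat \<Rightarrow> 'a) \<Rightarrow> nat \<Rightarrow> nat \<Rightarrow> 'a" where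
  "replace_col F i y = (\<lambda>r q. if q = i then y r else F r q)"

lemma minor_cong:
  "(\<And>r q. r \<in> set xs \<Longrightarrow> q < length xs \<Longrightarrow> F r q = G r q) \<Longrightarrow> minor F xs = minor G xs"
  unfolding minor_def by (rule arg_cong[where f = det]) (auto intro!: eq_matI)

lemma minor_Leibniz:
  "minor F xs = (\<Sum>\<sigma> | \<sigma> permutes {..<length xs}. of_int (sign \<sigma>) * (\<Prod>l<length xs. F (xs ! l) (\<sigma> l)))"
proof -
  have "minor F xs = (\<Sum>\<sigma> | \<sigma> permutes {0..<length xs}. of_int (sign \<sigma>) *
      (\<Prod>i = 0..<length xs. (mat (length xs) (length xs) (\<lambda>(p, q). F (xs ! p) q)) $$ (i, \<sigma> i)))"
    unfolding minor_def by (rule det_def'[OF mat_carrier])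
  also have "\<dots> = (\<Sum>\<sigma> | \<sigma> permutes {0..<length xs}. of_int (sign \<sigma>) *
      (\<Prod>i = 0..<length xs. F (xs ! i) (\<sigma> i)))"
    by (intro sum.cong refl arg_cong2[where f = "(*)"] prod.cong)
      (auto simp: permutes_in_image dest: permutes_in_image)
  finally show ?thesis by (simp add: atLeast0LessThan)
qed

text \<open>The cofactors of column \<open>i\<close> do not see the entries of that column, so they
  can be taken from \<open>F\<close>; this exhibits the linear dependence on
  \<open>y\<close>.\<close>

lemma minor_replace_col:
  assumes i: "i < length xs"
  shows "minor (replace_col F i y) xs = (\<Sum>p<length xs. y (xs ! p) * minor_cofactor F xs p i)"
proof -
  let ?n = "length xs"
  let ?A = "\<lambda>F. mat ?n ?n (\<lambda>(p, q). F (xs ! p) q)"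
  have "minor (replace_col F i y) xs
      = (\<Sum>p<?n. ?A (replace_col F i y) $$ (p, i) * cofactor (?A (replace_col F i y)) p i)"
    unfolding minor_def by (rule laplace_expansion_column[OF mat_carrier i])
  also have "\<dots> = (\<Sum>p<?n. y (xs ! p) * minor_cofactor F xs p i)"
  proof (rule sum.cong[OF refl], rule arg_cong2[where f = "(*)"])
    fix p assume p: "p \<in> {..<?n}"
    show "?A (replace_col F i y) $$ (p, i) = y (xs ! p)"
      using p i by (simp add: replace_col_def)
    have "mat_delete (?A (replace_col F i y)) p i = mat_delete (?A F) p i"
      using p i unfolding mat_delete_def by (intro eq_matI) (auto simp: replace_col_def)
    then show "cofactor (?A (replace_col F i y)) p i = minor_cofactor F xs p i"
      by (simp add: minor_cofactor_def cofactor_def)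
  qed
  finally show ?thesis .
qed

lemma minor_equal_cols:
  assumes "i < length xs" "j < length xs" "i \<noteq> j" "\<And>r. r \<in> set xs \<Longrightarrow> F r i = F r j"
  shows "minor F xs = 0"
  unfolding minor_def
  by (rule det_identical_columns[OF mat_carrier assms(3,1,2)])
    (use assms in \<open>auto intro!: eq_vecI\<close>)

lemma minor_swap_cols:
  assumes "i < length xs" "j < length xs" "i \<noteq> j"
  shows "minor (replace_col (replace_col F i a) j b) xs = - minor (replace_col (replace_col F i b) j a) xs"
proof -
  let ?A = "\<lambda>a b. mat (length xs) (length xs) (\<lambda>(p, q). replace_col (replace_col F i a) j b (xs ! p) q)"
  have "swapcols i j (?A b a) = ?A a b"
    using assms by (intro eq_matI) (auto simp: replace_col_def)
  then show ?thesis
    unfolding minor_def using det_swapcols[OF assms mat_carrier, of "\<lambda>(p, q). replace_col (replace_col F i b) j a (xs ! p) q"]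
    by simp
qed

definition drop_nth :: "nat \<Rightarrow> 'b list \<Rightarrow> 'b list" where
  "drop_nth p xs = take p xs @ drop (Suc p) xs"

lemma length_drop_nth [simp]: "p < length xs \<Longrightarrow> length (drop_nth p xs) = length xs - 1"
  by (simp add: drop_nth_def)

lemma nth_drop_nth:
  "p < length xs \<Longrightarrow> i < length xs - 1 \<Longrightarrow> drop_nth p xs ! i = xs ! (if i < p then i else Suc i)"
  by (auto simp: drop_nth_def nth_append)

text \<open>One row more than \<open>F\<close> has columns, and a new column in front: the expansion
  involves the \<open>n\<close>-rowed minors of \<open>F\<close>. With a column of \<open>F\<close>
  as \<open>y\<close> it becomes a relation between them.\<close>

lemma minor_first_col:
  assumes len: "length xs = Suc n"
  shows "minor (\<lambda>r q. if q = 0 then y r else F r (q - 1)) xs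
    = (\<Sum>p\<le>n. (-1) ^ p * y (xs ! p) * minor F (drop_nth p xs))"
proof -
  let ?A = "mat (length xs) (length xs) (\<lambda>(p, q). if q = 0 then y (xs ! p) else F (xs ! p) (q - 1))"
  have "minor (\<lambda>r q. if q = 0 then y r else F r (q - 1)) xs
      = (\<Sum>p<length xs. ?A $$ (p, 0) * cofactor ?A p 0)"
    unfolding minor_def by (rule laplace_expansion_column[OF mat_carrier]) (simp add: len)
  also have "\<dots> = (\<Sum>p<length xs. (-1) ^ p * y (xs ! p) * minor F (drop_nth p xs))"
  proof (rule sum.cong[OF refl])
    fix p assume p: "p \<in> {..<length xs}"
    have "mat_delete ?A p 0 = mat (length (drop_nth p xs)) (length (drop_nth p xs))
        (\<lambda>(i, q). F (drop_nth p xs ! i) q)"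
      using p len unfolding mat_delete_def by (intro eq_matI) (auto simp: nth_drop_nth)
    then show "?A $$ (p, 0) * cofactor ?A p 0 = (-1) ^ p * y (xs ! p) * minor F (drop_nth p xs)"
      using p len by (simp add: cofactor_def minor_def)
  qed
  finally show ?thesis by (simp add: len lessThan_Suc_atMost)
qed

lemma (in comm_ring_hom) hom_minor: "hom (minor F xs) = minor (\<lambda>r q. hom (F r q)) xs"
  unfolding minor_def hom_det[symmetric] by (rule arg_cong[where f = det]) auto

lemma drop_nth_strict:
  assumes "xs \<in> strict_lists m (Suc n)" "p \<le> n"
  shows "drop_nth p xs \<in> strict_lists m n"
proof -
  have "set (drop_nth p xs) \<subseteq> set xs"
    using set_take_subset[of p xs] set_drop_subset[of "Suc p" xs] by (auto simp: drop_nth_def)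
  moreover have "sorted_wrt (<) (drop_nth p xs)"
    using assms by (auto simp: strict_lists_def index_lists_def sorted_wrt_iff_nth_less nth_drop_nth)
  ultimately show ?thesis
    using assms by (auto simp: strict_lists_def index_lists_def)
qed

lemma strict_nth_less: "xs \<in> strict_lists m n \<Longrightarrow> p < n \<Longrightarrow> xs ! p < m"
  by (auto simp: strict_lists_def index_lists_def) (meson lessThan_iff nth_mem subsetD)

lemma strict_length: "xs \<in> strict_lists m n \<Longrightarrow> length xs = n"
  by (simp add: strict_lists_def index_lists_def)

lemma homog_prod: "finite A \<Longrightarrow> (\<And>i. i \<in> A \<Longrightarrow> f i \<in> homog v (Suc 0)) \<Longrightarrow> prod f A \<in> homog v (card A)"
proof (induct A rule: finite_induct)
  case empty
  then show ?case using mconst_homog[of 1 v] by simp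
next
  case (insert x F)
  then show ?case using homog_mult[of "f x" v "Suc 0" "prod f F" "card F"] by simp
qed

lemma supported_of_int: "p \<in> supported S \<Longrightarrow> of_int z * p \<in> supported S"
  using supported_scale[of p S "of_int z"] by (simp add: mconst_of_int)

lemma minor_homog:
  assumes "\<And>r q. r \<in> set xs \<Longrightarrow> q < length xs \<Longrightarrow> F r q \<in> homog v (Suc 0)"
  shows "minor F xs \<in> homog v (length xs)"
  unfolding minor_Leibniz
proof (intro supported_sum supported_of_int)
  fix \<sigma> assume "\<sigma> \<in> {\<sigma>. \<sigma> permutes {..<length xs}}"
  then have "\<sigma> l < length xs" if "l < length xs" for l
    using that permutes_in_image[of \<sigma> "{..<length xs}" l] by simp
  then have "(\<Prod>l<length xs. F (xs ! l) (\<sigma> l)) \<in> homog v (card {..<length xs})"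
    by (intro homog_prod assms) auto
  then show "(\<Prod>l<length xs. F (xs ! l) (\<sigma> l)) \<in> homog v (length xs)" by simp
qed

text \<open>Telescoping: exchanging one factor at a time costs one degree.\<close>

lemma prod_leading:
  assumes "finite A" "\<And>i. i \<in> A \<Longrightarrow> g i \<in> homog v (Suc 0)"
    and "\<And>i. i \<in> A \<Longrightarrow> f i - g i \<in> deglt v (Suc 0)"
  shows "prod f A - prod g A \<in> deglt v (card A)"
  using assms
proof (induct A rule: finite_induct)
  case (insert x B)
  have g: "prod g B \<in> degle v (card B)"
    by (rule homog_degle[OF homog_prod]) (use insert in auto)
  have fB: "prod f B - prod g B \<in> deglt v (card B)" using insert by simp
  have "prod f B = (prod f B - prod g B) + prod g B" by simp
  then have f: "prod f B \<in> degle v (card B)"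
    using supported_add[OF deglt_degle[OF fB] g] by simp
  have "prod f (insert x B) - prod g (insert x B)
      = (f x - g x) * prod f B + (prod f B - prod g B) * g x"
    using insert by (simp add: algebra_simps)
  moreover have "(f x - g x) * prod f B \<in> deglt v (Suc 0 + card B)"
    by (rule deglt_mult[OF _ f]) (use insert in auto)
  moreover have "(prod f B - prod g B) * g x \<in> deglt v (card B + Suc 0)"
    by (rule deglt_mult[OF fB homog_degle]) (use insert in auto)
  ultimately show ?case using insert by (auto intro: supported_add)
qed simp

text \<open>Applied with \<open>G\<close> the part of
  \<open>A + \<Sum> \<lambda>\<^sub>i B\<^sub>i\<close> that is linear in \<lambda>, so that the top
  forms of the minors depend on \<open>B\<close> alone.\<close>

lemma minor_leading:
  assumes "\<And>r q. r \<in> set xs \<Longrightarrow> q < length xs \<Longrightarrow> G r q \<in> homog v (Suc 0)"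
    and "\<And>r q. r \<in> set xs \<Longrightarrow> q < length xs \<Longrightarrow> F r q - G r q \<in> deglt v (Suc 0)"
  shows "minor F xs - minor G xs \<in> deglt v (length xs)"
  unfolding minor_Leibniz sum_subtractf[symmetric] right_diff_distrib[symmetric]
proof (intro supported_sum supported_of_int)
  fix \<sigma> assume "\<sigma> \<in> {\<sigma>. \<sigma> permutes {..<length xs}}"
  then have "\<sigma> l < length xs" if "l < length xs" for l
    using that permutes_in_image[of \<sigma> "{..<length xs}" l] by simp
  then have "(\<Prod>l<length xs. F (xs ! l) (\<sigma> l)) - (\<Prod>l<length xs. G (xs ! l) (\<sigma> l))
      \<in> deglt v (card {..<length xs})"
    by (intro prod_leading assms) auto
  then show "(\<Prod>l<length xs. F (xs ! l) (\<sigma> l)) - (\<Prod>l<length xs. G (xs ! l) (\<sigma> l))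
      \<in> deglt v (length xs)" by simp
qed

text \<open>The three-way tensor \<open>\<beta>\<close> has row \<open>r\<close>, column
  \<open>q\<close> and variable \<open>l\<close>. Taken with \<open>v = n\<close> and
  \<open>d = k\<close> it gives \<open>[B\<^sub>1 x | \<dots> | B\<^sub>k x]\<close>; with
  \<open>v = k\<close>, \<open>d = n\<close> and the last two indices exchanged it gives
  \<open>\<Sum> \<lambda>\<^sub>i B\<^sub>i\<close>.\<close>

definition linform :: "nat \<Rightarrow> (nat \<Rightarrow> nat \<Rightarrow> nat \<Rightarrow> complex) \<Rightarrow> nat \<Rightarrow> nat \<Rightarrow> mpoly" where
  "linform v \<beta> r q = (\<Sum>l<v. mconst (\<beta> r q l) * mvar l)"

lemma linform_homog [simp]: "linform v \<beta> r q \<in> homog v (Suc 0)"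
  unfolding linform_def by (intro supported_sum supported_scale mvar_homog) auto

definition nondegenerate :: "nat \<Rightarrow> nat \<Rightarrow> (nat \<Rightarrow> nat \<Rightarrow> nat \<Rightarrow> complex) \<Rightarrow> bool" where
  "nondegenerate v d \<beta> \<longleftrightarrow>
     (\<forall>c. (\<Sum>xs\<in>strict_lists (v + d - 1) d. mconst (c xs) * minor (linform v \<beta>) xs) = 0 \<longrightarrow>
        (\<forall>xs\<in>strict_lists (v + d - 1) d. c xs = 0))"

lemma homog_eqI:
  assumes "p \<in> homog v d" "q \<in> homog v d" "\<And>m. m \<in> monoms_deg v {d} \<Longrightarrow> mcoeff p m = mcoeff q m"
  shows "p = q"
  by (rule poly_mapping_eqI) (metis assms supportedD)

text \<open>There are as many minors as monomials of the same degree.\<close>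

lemma nondegenerate_span:
  assumes "nondegenerate v d \<beta>" "p \<in> homog v d"
  shows "\<exists>c. p = (\<Sum>xs\<in>strict_lists (v + d - 1) d. mconst (c xs) * minor (linform v \<beta>) xs)"
proof -
  let ?X = "strict_lists (v + d - 1) d" and ?f = "minor (linform v \<beta>)"
  have h: "(\<Sum>xs\<in>?X. mconst (c xs) * ?f xs) \<in> homog v d" for c
    by (intro supported_sum supported_scale) (metis linform_homog minor_homog strict_length)
  have coeff: "mcoeff (\<Sum>xs\<in>?X. mconst (c xs) * ?f xs) m = (\<Sum>xs\<in>?X. c xs * mcoeff (?f xs) m)" for c m
    by (simp add: lookup_sum)
  have "\<exists>c. \<forall>m\<in>monoms_deg v {d}. (\<Sum>xs\<in>?X. c xs * mcoeff (?f xs) m) = mcoeff p m"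
  proof (rule square_span)
    show "card ?X = card (monoms_deg v {d})"
      by (simp add: card_strict_lists card_monoms_homog)
    fix c assume "\<And>m. m \<in> monoms_deg v {d} \<Longrightarrow> (\<Sum>xs\<in>?X. c xs * mcoeff (?f xs) m) = 0"
    then have "(\<Sum>xs\<in>?X. mconst (c xs) * ?f xs) = 0"
      by (intro homog_eqI[OF h supported_0]) (simp only: coeff lookup_zero)
    then show "\<forall>xs\<in>?X. c xs = 0"
      using assms(1) by (auto simp: nondegenerate_def)
  qed auto
  then obtain c where "\<forall>m\<in>monoms_deg v {d}. (\<Sum>xs\<in>?X. c xs * mcoeff (?f xs) m) = mcoeff p m" ..
  then have "p = (\<Sum>xs\<in>?X. mconst (c xs) * ?f xs)"
    by (intro homog_eqI[OF assms(2) h]) (simp only: coeff)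
  then show ?thesis by blast
qed

section \<open>Compressed operator determinants as coefficient matrices\<close>

lemma nth_concat_uniform:
  assumes "\<And>xs. xs \<in> set xss \<Longrightarrow> length xs = len" "t < length xss * len"
  shows "concat xss ! t = xss ! (t div len) ! (t mod len)"
  using assms
proof (induct xss arbitrary: t)
  case (Cons xs xss)
  have len: "length xs = len" "len > 0" using Cons.prems by (auto intro: gr0I)
  show ?case
  proof (cases "t < len")
    case True
    then show ?thesis using len by (simp add: nth_append)
  next
    case False
    then have "t div len = Suc ((t - len) div len)" "t mod len = (t - len) mod len"
      using len by (simp_all add: le_div_geq le_mod_geq)
    moreover have "concat xss ! (t - len) = xss ! ((t - len) div len) ! ((t - len) mod len)"
      using Cons.prems False by (intro Cons.hyps) auto
    ultimately show ?thesis using len False by (simp add: nth_append)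
  qed
qed simp

lemma multi_indices_0 [simp]: "multi_indices n 0 = [[]]"
  by (simp add: multi_indices_def)

lemma multi_indices_Suc:
  "multi_indices n (Suc k) = concat (map (\<lambda>x. map ((#) x) (multi_indices n k)) [0..<n])"
  by (simp add: multi_indices_def)

lemma set_multi_indices: "set (multi_indices n k) = index_lists n k"
proof (induct k)
  case (Suc k)
  show ?case
  proof (rule Set.set_eqI)
    fix xs
    show "xs \<in> set (multi_indices n (Suc k)) \<longleftrightarrow> xs \<in> index_lists n (Suc k)"
      using Suc by (cases xs) (auto simp: multi_indices_Suc index_lists_def)
  qed
qed (auto simp: index_lists_def)

lemma length_multi_indices [simp]: "length (multi_indices n k) = n ^ k"
proof (induct k)
  case (Suc k)
  then show ?case
    by (simp add: multi_indices_Suc length_concat comp_def sum_list_triv)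
qed simp

text \<open>A position in lexicographic order is read in base \<open>n\<close>, the same arithmetic
  by which a Kronecker product splits its indices.\<close>

lemma nth_multi_indices_Suc:
  assumes "t < n ^ Suc k"
  shows "multi_indices n (Suc k) ! t = (t div n ^ k) # (multi_indices n k ! (t mod n ^ k))"
proof -
  have "n ^ k > 0" using assms by (cases n; cases k) auto
  have d: "t div n ^ k < n" "t mod n ^ k < n ^ k"
    using assms \<open>n ^ k > 0\<close> by (simp_all add: less_mult_imp_div_less mult.commute)
  have "multi_indices n (Suc k) ! t
      = map (\<lambda>x. map ((#) x) (multi_indices n k)) [0..<n] ! (t div n ^ k) ! (t mod n ^ k)"
    unfolding multi_indices_Suc using assms by (intro nth_concat_uniform) auto
  then show ?thesis using d by simp
qed

lemma distinct_multi_indices: "distinct (multi_indices n k)"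
proof -
  have "card (set (multi_indices n k)) = n ^ k"
    using card_lists_length_eq[of "{..<n}" k]
    by (simp add: set_multi_indices index_lists_def conj_commute)
  then show ?thesis by (simp add: card_distinct)
qed

definition row_list :: "nat \<Rightarrow> nat \<Rightarrow> nat \<Rightarrow> nat list" where
  "row_list n k r = filter (sorted_wrt (<)) (multi_indices (n + k - 1) k) ! r"

definition col_list :: "nat \<Rightarrow> nat \<Rightarrow> nat \<Rightarrow> nat list" where
  "col_list n k c = filter sorted (multi_indices n k) ! c"

lemma bij_row_list:
  "bij_betw (row_list n k) {..<(n + k - 1) choose k} (strict_lists (n + k - 1) k)"
proof -
  let ?l = "filter (sorted_wrt (<)) (multi_indices (n + k - 1) k)"
  have s: "set ?l = strict_lists (n + k - 1) k"
    by (auto simp: strict_lists_def set_multi_indices)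
  have "length ?l = (n + k - 1) choose k"
    using distinct_card[OF distinct_filter[OF distinct_multi_indices]]
    unfolding s[symmetric] card_strict_lists[symmetric] by metis
  moreover have "row_list n k = (!) ?l" by (auto simp: row_list_def)
  ultimately show ?thesis
    using bij_betw_nth[OF distinct_filter[OF distinct_multi_indices] refl s[symmetric]] by simp
qed

lemma bij_col_list:
  "bij_betw (col_list n k) {..<(n + k - 1) choose k} (sorted_lists n k)"
proof -
  let ?l = "filter sorted (multi_indices n k)"
  have s: "set ?l = sorted_lists n k"
    by (auto simp: sorted_lists_def set_multi_indices)
  have "length ?l = (n + k - 1) choose k"
    using distinct_card[OF distinct_filter[OF distinct_multi_indices]]
    unfolding s[symmetric] card_sorted_lists[symmetric] by metis
  moreover have "col_list n k = (!) ?l" by (auto simp: col_list_def)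
  ultimately show ?thesis
    using bij_betw_nth[OF distinct_filter[OF distinct_multi_indices] refl s[symmetric]] by simp
qed

lemma row_list_in: "r < (n + k - 1) choose k \<Longrightarrow> row_list n k r \<in> strict_lists (n + k - 1) k"
  using bij_betwE[OF bij_row_list] by blast

lemma col_list_in: "c < (n + k - 1) choose k \<Longrightarrow> col_list n k c \<in> sorted_lists n k"
  using bij_betwE[OF bij_col_list] by blast

lemma kronecker_list_dim:
  assumes "set Ms \<subseteq> carrier_mat m n"
  shows "kronecker_list Ms \<in> carrier_mat (m ^ length Ms) (n ^ length Ms)"
  using assms by (induct Ms) (auto simp: kronecker_list_def kronecker_def)

lemma kronecker_list_index:
  assumes "set Ms \<subseteq> carrier_mat m n" "i < m ^ length Ms" "j < n ^ length Ms"
  shows "kronecker_list Ms $$ (i, j) = (\<Prod>l<length Ms. (Ms ! l)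
    $$ (multi_indices m (length Ms) ! i ! l, multi_indices n (length Ms) ! j ! l))"
  using assms
proof (induct Ms arbitrary: i j)
  case Nil
  then show ?case by (simp add: kronecker_list_def)
next
  case (Cons M Ms)
  let ?k = "length Ms"
  have M: "dim_row M = m" "dim_col M = n" and Ms: "set Ms \<subseteq> carrier_mat m n"
    using Cons.prems by auto
  note K = kronecker_list_dim[OF Ms]
  have pos: "m ^ ?k > 0" "n ^ ?k > 0"
    using Cons.prems by (auto intro: Nat.gr0I)
  have "kronecker_list (M # Ms) $$ (i, j)
      = M $$ (i div m ^ ?k, j div n ^ ?k) * kronecker_list Ms $$ (i mod m ^ ?k, j mod n ^ ?k)"
    using K M Cons.prems by (simp add: kronecker_list_def kronecker_def)
  also have "kronecker_list Ms $$ (i mod m ^ ?k, j mod n ^ ?k) = (\<Prod>l<?k. (Ms ! l)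
      $$ (multi_indices m ?k ! (i mod m ^ ?k) ! l, multi_indices n ?k ! (j mod n ^ ?k) ! l))"
    by (rule Cons.hyps[OF Ms]) (use pos in auto)
  finally show ?case
    using Cons.prems by (simp add: nth_multi_indices_Suc prod.lessThan_Suc_shift del: power_Suc prod.lessThan_Suc)
qed

definition compressed_det :: "nat \<Rightarrow> nat \<Rightarrow> complex mat list \<Rightarrow> complex mat" where
  "compressed_det n k Cs = compression_L n k * op_det (n + k - 1) n Cs * compression_T n k"

lemma compressed_det_carrier:
  "compressed_det n k Cs \<in> carrier_mat ((n + k - 1) choose k) ((n + k - 1) choose k)"
  by (simp add: compressed_det_def compression_L_def compression_T_def carrier_matI)

lemma compressed_Delta_0: "compressed_Delta n k A Bs 0 = compressed_det n k Bs"
  by (simp add: compressed_Delta_def op_Delta_def compressed_det_def)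

lemma compressed_Delta_pos:
  assumes "i > 0" "length Bs = k"
  shows "compressed_Delta n k A Bs i = - compressed_det n k (Bs[i - 1 := A])"
proof -
  let ?X = "op_det (n + k - 1) n (Bs[i - 1 := A])"
  have X: "?X \<in> carrier_mat ((n + k - 1) ^ k) (n ^ k)"
    using assms by (simp add: op_det_def)
  have L: "compression_L n k \<in> carrier_mat ((n + k - 1) choose k) ((n + k - 1) ^ k)"
    and T: "compression_T n k \<in> carrier_mat (n ^ k) ((n + k - 1) choose k)"
    by (simp_all add: compression_L_def compression_T_def)
  show ?thesis
    using assms X L T
    by (simp add: compressed_Delta_def op_Delta_def compressed_det_def)
qed

definition tuple_coeff :: "complex mat list \<Rightarrow> nat \<Rightarrow> nat \<Rightarrow> nat \<Rightarrow> complex" where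
  "tuple_coeff Cs r q l = (Cs ! q) $$ (r, l)"

lemma op_det_index:
  assumes "length Cs = k" "set Cs \<subseteq> carrier_mat m n" "i < m ^ k" "j < n ^ k"
  shows "op_det m n Cs $$ (i, j) = (\<Sum>\<sigma> | \<sigma> permutes {..<k}. of_int (sign \<sigma>) *
    (\<Prod>l<k. tuple_coeff Cs (multi_indices m k ! i ! l) (\<sigma> l) (multi_indices n k ! j ! l)))"
proof -
  have "kronecker_list (map (\<lambda>l. Cs ! \<sigma> l) [0..<k]) $$ (i, j)
      = (\<Prod>l<k. tuple_coeff Cs (multi_indices m k ! i ! l) (\<sigma> l) (multi_indices n k ! j ! l))"
    if "\<sigma> permutes {..<k}" for \<sigma>
  proof -
    have "\<sigma> l < k" if "l < k" for l
      using that permutes_in_image[OF \<open>\<sigma> permutes {..<k}\<close>, of l] by simp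
    then have "set (map (\<lambda>l. Cs ! \<sigma> l) [0..<k]) \<subseteq> carrier_mat m n"
      using assms(1,2) by (auto simp del: carrier_mat_def)
    from kronecker_list_index[OF this, of i j] show ?thesis
      using assms by (simp add: tuple_coeff_def)
  qed
  then show ?thesis
    using assms by (simp add: op_det_def)
qed

text \<open>\<open>L\<close> selects a single row, and \<open>T\<close> adds up the columns whose
  multi-indices are rearrangements of one sorted multi-index.\<close>

lemma compressed_det_index:
  assumes len: "length Cs = k" and Cs: "set Cs \<subseteq> carrier_mat (n + k - 1) n"
    and r: "r < (n + k - 1) choose k" and c: "c < (n + k - 1) choose k"
  shows "compressed_det n k Cs $$ (r, c) =
    (\<Sum>js | js \<in> index_lists n k \<and> mset js = mset (col_list n k c). \<Sum>\<sigma> | \<sigma> permutes {..<k}.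
      of_int (sign \<sigma>) * (\<Prod>l<k. tuple_coeff Cs (row_list n k r ! l) (\<sigma> l) (js ! l)))"
proof -
  let ?m = "n + k - 1" and ?X = "op_det (n + k - 1) n Cs"
  define g where "g js = (\<Sum>\<sigma> | \<sigma> permutes {..<k}. of_int (sign \<sigma>) *
    (\<Prod>l<k. tuple_coeff Cs (row_list n k r ! l) (\<sigma> l) (js ! l)))" for js
  have "row_list n k r \<in> set (multi_indices ?m k)"
    using row_list_in[OF r] by (simp add: set_multi_indices strict_lists_def)
  then obtain p where p: "p < ?m ^ k" "multi_indices ?m k ! p = row_list n k r"
    by (metis in_set_conv_nth length_multi_indices)
  have dX: "dim_row ?X = ?m ^ k" "dim_col ?X = n ^ k"
    using len by (simp_all add: op_det_def)
  have LX: "(compression_L n k * ?X) $$ (r, t) = g (multi_indices n k ! t)" if t: "t < n ^ k" for t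
  proof -
    have "(compression_L n k * ?X) $$ (r, t)
        = (\<Sum>s = 0..<?m ^ k. (if row_list n k r = multi_indices ?m k ! s then 1 else 0) * ?X $$ (s, t))"
      using r t dX by (simp add: compression_L_def scalar_prod_def row_list_def)
    also have "\<dots> = (\<Sum>s = 0..<?m ^ k. if s = p then ?X $$ (s, t) else 0)"
      using p distinct_multi_indices[of ?m k]
      by (intro sum.cong) (auto simp: nth_eq_iff_index_eq simp flip: p(2))
    also have "\<dots> = ?X $$ (p, t)" using p by simp
    finally show ?thesis
      using op_det_index[OF len Cs p(1) t] p by (simp add: g_def)
  qed
  have "compressed_det n k Cs $$ (r, c)
      = (\<Sum>t = 0..<n ^ k. g (multi_indices n k ! t) *
          (if mset (multi_indices n k ! t) = mset (col_list n k c) then 1 else 0))"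
    using r c dX LX unfolding compressed_det_def
    by (subst index_mult_mat) (auto simp: compression_L_def compression_T_def scalar_prod_def col_list_def
        intro!: sum.cong)
  also have "\<dots> = (\<Sum>js\<in>index_lists n k. g js * (if mset js = mset (col_list n k c) then 1 else 0))"
  proof (rule sum.reindex_bij_betw)
    show "bij_betw ((!) (multi_indices n k)) {0..<n ^ k} (index_lists n k)"
      using bij_betw_nth[OF distinct_multi_indices[of n k], of "{0..<n ^ k}"]
      by (simp add: set_multi_indices atLeast0LessThan)
  qed
  also have "\<dots> = (\<Sum>js | js \<in> index_lists n k \<and> mset js = mset (col_list n k c). g js)"
    by (rule sum.mono_neutral_cong_right) auto
  finally show ?thesis by (simp add: g_def)
qed

lemma prod_sum_index_lists:
  fixes f :: "nat \<Rightarrow> nat \<Rightarrow> 'a::comm_semiring_1"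
  shows "(\<Prod>l<k. \<Sum>j<n. f l j) = (\<Sum>js\<in>index_lists n k. \<Prod>l<k. f l (js ! l))"
proof (induct k arbitrary: f)
  case 0
  have "index_lists n 0 = {[]}" by (auto simp: index_lists_def)
  then show ?case by simp
next
  case (Suc k)
  let ?h = "\<lambda>(j, js). j # js"
  have inj: "inj_on ?h ({..<n} \<times> index_lists n k)" by (auto simp: inj_on_def)
  have "\<exists>a b. xs = a # b \<and> a < n \<and> b \<in> index_lists n k" if "xs \<in> index_lists n (Suc k)" for xs
    using that by (cases xs) (auto simp: index_lists_def)
  then have img: "index_lists n (Suc k) = ?h ` ({..<n} \<times> index_lists n k)"
    by (force simp: index_lists_def)
  have "(\<Sum>js\<in>index_lists n (Suc k). \<Prod>l<Suc k. f l (js ! l))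
      = (\<Sum>(j, js)\<in>{..<n} \<times> index_lists n k. f 0 j * (\<Prod>l<k. f (Suc l) (js ! l)))"
    unfolding img by (subst sum.reindex[OF inj])
      (auto simp: prod.lessThan_Suc_shift case_prod_beta simp del: prod.lessThan_Suc intro!: sum.cong)
  also have "\<dots> = (\<Sum>j<n. f 0 j) * (\<Prod>l<k. \<Sum>j<n. f (Suc l) j)"
    by (simp add: Suc sum_product sum.cartesian_product)
  finally show ?case by (simp add: prod.lessThan_Suc_shift del: prod.lessThan_Suc)
qed

lemma prod_mvar_list: "(\<Prod>l<length js. mvar (js ! l)) = mmonom (list_monom js)"
proof (induct js)
  case (Cons j js)
  have "(\<Prod>l<length (j # js). mvar ((j # js) ! l)) = mvar j * (\<Prod>l<length js. mvar (js ! l))"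
    by (simp add: prod.lessThan_Suc_shift del: prod.lessThan_Suc)
  also have "\<dots> = mmonom (list_monom (j # js))"
    unfolding Cons by (simp add: mvar_def mult_single)
  finally show ?case .
qed simp

lemma mconst_prod: "mconst (prod f A) = (\<Prod>x\<in>A. mconst (f x))"
  by (induct A rule: infinite_finite_induct) (simp_all add: mconst_mult)

text \<open>Leibniz formula, then the product of linear forms is multiplied out. Multi-indices
  contribute to the same monomial exactly if they are rearrangements of each other, so the sum
  agrees term by term with \<open>compressed_det_index\<close>.\<close>

lemma mcoeff_minor:
  assumes "length xs = k"
  shows "mcoeff (minor (linform n \<beta>) xs) (list_monom ys) =
    (\<Sum>js | js \<in> index_lists n k \<and> mset js = mset ys. \<Sum>\<sigma> | \<sigma> permutes {..<k}.
      of_int (sign \<sigma>) * (\<Prod>l<k. \<beta> (xs ! l) (\<sigma> l) (js ! l)))"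
proof -
  have prod: "(\<Prod>l<k. linform n \<beta> (xs ! l) (\<sigma> l))
      = (\<Sum>js\<in>index_lists n k. mconst (\<Prod>l<k. \<beta> (xs ! l) (\<sigma> l) (js ! l)) * mmonom (list_monom js))" for \<sigma>
  proof -
    have "(\<Prod>l<k. linform n \<beta> (xs ! l) (\<sigma> l))
        = (\<Sum>js\<in>index_lists n k. \<Prod>l<k. mconst (\<beta> (xs ! l) (\<sigma> l) (js ! l)) * mvar (js ! l))"
      unfolding linform_def by (rule prod_sum_index_lists)
    also have "\<dots> = (\<Sum>js\<in>index_lists n k. mconst (\<Prod>l<k. \<beta> (xs ! l) (\<sigma> l) (js ! l)) * mmonom (list_monom js))"
    proof (rule sum.cong[OF refl])
      fix js assume "js \<in> index_lists n k"
      then have "length js = k" by (simp add: index_lists_def)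
      then show "(\<Prod>l<k. mconst (\<beta> (xs ! l) (\<sigma> l) (js ! l)) * mvar (js ! l))
          = mconst (\<Prod>l<k. \<beta> (xs ! l) (\<sigma> l) (js ! l)) * mmonom (list_monom js)"
        by (simp add: prod.distrib mconst_prod flip: prod_mvar_list)
    qed
    finally show ?thesis .
  qed
  have "minor (linform n \<beta>) xs = (\<Sum>\<sigma> | \<sigma> permutes {..<k}. mconst (of_int (sign \<sigma>)) *
      (\<Sum>js\<in>index_lists n k. mconst (\<Prod>l<k. \<beta> (xs ! l) (\<sigma> l) (js ! l)) * mmonom (list_monom js)))"
    unfolding minor_Leibniz assms prod mconst_of_int ..
  then have "mcoeff (minor (linform n \<beta>) xs) (list_monom ys)
      = (\<Sum>\<sigma> | \<sigma> permutes {..<k}. of_int (sign \<sigma>) * (\<Sum>js\<in>index_lists n k.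
          (\<Prod>l<k. \<beta> (xs ! l) (\<sigma> l) (js ! l)) * mcoeff (mmonom (list_monom js)) (list_monom ys)))"
    by (simp only: lookup_sum mcoeff_mconst_mult)
  also have "\<dots> = (\<Sum>\<sigma> | \<sigma> permutes {..<k}. of_int (sign \<sigma>) *
      (\<Sum>js | js \<in> index_lists n k \<and> mset js = mset ys. (\<Prod>l<k. \<beta> (xs ! l) (\<sigma> l) (js ! l))))"
    by (intro sum.cong refl arg_cong2[where f = "(*)"] sum.mono_neutral_cong_right)
      (auto simp: lookup_single list_monom_eq_iff when_def)
  finally show ?thesis
    by (simp add: sum_distrib_left sum.swap[of _ "{js \<in> index_lists n k. mset js = mset ys}"])
qed

lemma compressed_det_coeff:
  assumes "length Cs = k" "set Cs \<subseteq> carrier_mat (n + k - 1) n"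
    and r: "r < (n + k - 1) choose k" and "c < (n + k - 1) choose k"
  shows "compressed_det n k Cs $$ (r, c)
    = mcoeff (minor (linform n (tuple_coeff Cs)) (row_list n k r)) (list_monom (col_list n k c))"
  using compressed_det_index[OF assms] mcoeff_minor[OF strict_length[OF row_list_in[OF r]]] by simp

text \<open>A linear combination of the minors is one of the rows of the matrix, so a dependency is
  a kernel vector of the transpose. This makes nondegeneracy a polynomial condition on the
  tuple.\<close>

lemma nondegenerate_iff_det:
  assumes len: "length Cs = k" and Cs: "set Cs \<subseteq> carrier_mat (n + k - 1) n"
  shows "nondegenerate n k (tuple_coeff Cs) \<longleftrightarrow> det (compressed_det n k Cs) \<noteq> 0"
proof -
  let ?N = "(n + k - 1) choose k" and ?D = "compressed_det n k Cs" and ?S = "strict_lists (n + k - 1) k"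
  let ?f = "minor (linform n (tuple_coeff Cs))"
  have D: "?D \<in> carrier_mat ?N ?N" by (rule compressed_det_carrier)
  have DT: "transpose_mat ?D \<in> carrier_mat ?N ?N" using D by simp
  have f: "?f xs \<in> homog n k" if "xs \<in> ?S" for xs
    using minor_homog[of xs "linform n (tuple_coeff Cs)" n] strict_length[OF that] by simp
  have eq: "(\<Sum>xs\<in>?S. mconst (c xs) * ?f xs) = 0 \<longleftrightarrow>
      transpose_mat ?D *\<^sub>v vec ?N (\<lambda>r. c (row_list n k r)) = 0\<^sub>v ?N" for c
  proof -
    have "(\<Sum>xs\<in>?S. mconst (c xs) * ?f xs) = 0 \<longleftrightarrow>
        (\<forall>m\<in>monoms_deg n {k}. mcoeff (\<Sum>xs\<in>?S. mconst (c xs) * ?f xs) m = 0)"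
      using homog_eqI[of "\<Sum>xs\<in>?S. mconst (c xs) * ?f xs" n k 0] f
      by (auto intro!: supported_sum supported_scale)
    also have "\<dots> \<longleftrightarrow> (\<forall>j<?N. mcoeff (\<Sum>xs\<in>?S. mconst (c xs) * ?f xs) (list_monom (col_list n k j)) = 0)"
    proof -
      have img: "monoms_deg n {k} = (\<lambda>j. list_monom (col_list n k j)) ` {..<?N}"
        using bij_betw_trans[OF bij_col_list bij_list_monom, of n k]
        by (simp add: bij_betw_def comp_def)
      show ?thesis unfolding img by blast
    qed
    also have "\<dots> \<longleftrightarrow> (\<forall>j<?N. (\<Sum>r<?N. c (row_list n k r) * ?D $$ (r, j)) = 0)"
    proof -
      have "mcoeff (\<Sum>xs\<in>?S. mconst (c xs) * ?f xs) (list_monom (col_list n k j))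
          = (\<Sum>r<?N. c (row_list n k r) * ?D $$ (r, j))" if "j < ?N" for j
        unfolding lookup_sum mcoeff_mconst_mult
        by (subst sum.reindex_bij_betw[OF bij_row_list, symmetric])
          (use that in \<open>simp add: compressed_det_coeff[OF len Cs]\<close>)
      then show ?thesis by auto
    qed
    also have "\<dots> \<longleftrightarrow> transpose_mat ?D *\<^sub>v vec ?N (\<lambda>r. c (row_list n k r)) = 0\<^sub>v ?N"
      using D by (auto simp: vec_eq_iff scalar_prod_def mult.commute atLeast0LessThan)
    finally show ?thesis .
  qed
  have "det ?D = 0 \<longleftrightarrow> (\<exists>v. v \<in> carrier_vec ?N \<and> v \<noteq> 0\<^sub>v ?N \<and> transpose_mat ?D *\<^sub>v v = 0\<^sub>v ?N)"
    using det_0_iff_vec_prod_zero[OF DT] det_transpose[OF D] by simp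
  also have "\<dots> \<longleftrightarrow> \<not> nondegenerate n k (tuple_coeff Cs)"
  proof
    assume "\<exists>v. v \<in> carrier_vec ?N \<and> v \<noteq> 0\<^sub>v ?N \<and> transpose_mat ?D *\<^sub>v v = 0\<^sub>v ?N"
    then obtain v where v: "v \<in> carrier_vec ?N" "v \<noteq> 0\<^sub>v ?N" "transpose_mat ?D *\<^sub>v v = 0\<^sub>v ?N" by blast
    define c where "c xs = v $ (the_inv_into {..<?N} (row_list n k) xs)" for xs
    have c: "c (row_list n k r) = v $ r" if "r < ?N" for r
      using bij_row_list[of n k] that by (simp add: c_def the_inv_into_f_f bij_betw_def)
    then have "vec ?N (\<lambda>r. c (row_list n k r)) = v"
      using v(1) by (intro eq_vecI) auto
    with eq[of c] v(3) have "(\<Sum>xs\<in>?S. mconst (c xs) * ?f xs) = 0" by simp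
    moreover obtain r where "r < ?N" "v $ r \<noteq> 0"
      using v(1,2) by (auto simp: vec_eq_iff)
    then have "\<exists>xs\<in>?S. c xs \<noteq> 0" using c row_list_in by metis
    ultimately show "\<not> nondegenerate n k (tuple_coeff Cs)"
      unfolding nondegenerate_def by blast
  next
    assume "\<not> nondegenerate n k (tuple_coeff Cs)"
    then obtain c xs where c: "(\<Sum>xs\<in>?S. mconst (c xs) * ?f xs) = 0" "xs \<in> ?S" "c xs \<noteq> 0"
      unfolding nondegenerate_def by blast
    have "xs \<in> row_list n k ` {..<?N}"
      using c(2) bij_betw_imp_surj_on[OF bij_row_list[of n k]] by simp
    then obtain r where r: "r < ?N" "row_list n k r = xs" by auto
    have "vec ?N (\<lambda>r. c (row_list n k r)) $ r \<noteq> 0" using r c(3) by simp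
    then have "vec ?N (\<lambda>r. c (row_list n k r)) \<noteq> 0\<^sub>v ?N" using r(1) by (metis index_zero_vec(1))
    then show "\<exists>v. v \<in> carrier_vec ?N \<and> v \<noteq> 0\<^sub>v ?N \<and> transpose_mat ?D *\<^sub>v v = 0\<^sub>v ?N"
      using eq[of c] c(1) by (intro exI[of _ "vec ?N (\<lambda>r. c (row_list n k r))"]) simp
  qed
  finally show ?thesis by blast
qed

lemma minor_cofactor_eq:
  assumes "p < length xs" "q < length xs"
  shows "minor_cofactor F xs p q
    = (-1) ^ (p + q) * minor (\<lambda>r q'. F r (if q' < q then q' else Suc q')) (drop_nth p xs)"
proof -
  have "mat_delete (mat (length xs) (length xs) (\<lambda>(p, q). F (xs ! p) q)) p q
      = mat (length (drop_nth p xs)) (length (drop_nth p xs))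
          (\<lambda>(i, q'). F (drop_nth p xs ! i) (if q' < q then q' else Suc q'))"
    using assms unfolding mat_delete_def by (intro eq_matI) (auto simp: nth_drop_nth)
  then show ?thesis by (simp add: minor_cofactor_def cofactor_def minor_def)
qed

lemma minor_cofactor_homog:
  assumes "p < length xs" "q < length xs" "\<And>r q. r \<in> set xs \<Longrightarrow> q < length xs \<Longrightarrow> F r q \<in> homog v (Suc 0)"
  shows "minor_cofactor F xs p q \<in> homog v (length xs - 1)"
proof -
  have "set (drop_nth p xs) \<subseteq> set xs"
    using set_take_subset[of p xs] set_drop_subset[of "Suc p" xs] by (auto simp: drop_nth_def)
  then have "minor (\<lambda>r q'. F r (if q' < q then q' else Suc q')) (drop_nth p xs)
      \<in> homog v (length (drop_nth p xs))"
    using assms by (intro minor_homog assms(3)) auto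
  then show ?thesis
    using assms supported_of_int[of _ _ "(-1) ^ (p + q)"] by (simp add: minor_cofactor_eq)
qed

text \<open>The cofactors of column \<open>i\<close>, spread over all row numbers and zero outside
  \<open>xs\<close>. Pairing this vector with a column puts that column in place of column
  \<open>i\<close>, as in Cramer's rule.\<close>

definition cofactor_row :: "(nat \<Rightarrow> nat \<Rightarrow> 'a::comm_ring_1) \<Rightarrow> nat list \<Rightarrow> nat \<Rightarrow> nat \<Rightarrow> 'a" where
  "cofactor_row F xs i r = (\<Sum>p | p < length xs \<and> xs ! p = r. minor_cofactor F xs p i)"

lemma sum_cofactor_row:
  assumes "i < length xs" "set xs \<subseteq> {..<m}"
  shows "(\<Sum>r<m. cofactor_row F xs i r * y r) = minor (replace_col F i y) xs"
proof -
  have "(\<Sum>r<m. cofactor_row F xs i r * y r)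
      = (\<Sum>r<m. \<Sum>p | p \<in> {..<length xs} \<and> xs ! p = r. y (xs ! p) * minor_cofactor F xs p i)"
    by (intro sum.cong) (auto simp: cofactor_row_def sum_distrib_right intro!: sum.cong)
  also have "\<dots> = (\<Sum>p<length xs. y (xs ! p) * minor_cofactor F xs p i)"
    by (rule sum.group) (use assms(2) nth_mem in blast)+
  finally show ?thesis using minor_replace_col[OF assms(1)] by metis
qed

lemma cofactor_row_homog:
  assumes "i < length xs" "\<And>r q. r \<in> set xs \<Longrightarrow> q < length xs \<Longrightarrow> F r q \<in> homog v (Suc 0)"
  shows "cofactor_row F xs i r \<in> homog v (length xs - 1)"
  unfolding cofactor_row_def by (intro supported_sum minor_cofactor_homog assms) auto

lemma replace_col_same: "replace_col F i (\<lambda>r. F r i) = F"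
  by (intro ext) (simp add: replace_col_def)

lemma minor_replace_other:
  assumes "i < length xs" "j < length xs" "i \<noteq> j"
  shows "minor (replace_col F i (\<lambda>r. F r j)) xs = 0"
  by (rule minor_equal_cols[OF assms]) (use assms in \<open>simp add: replace_col_def\<close>)

section \<open>Multiplication by the parameters on forms in \<open>x\<close>\<close>

locale rmep =
  fixes n k :: nat and A :: "complex mat" and Bs :: "complex mat list"
  assumes n: "n \<ge> 1" and k: "k \<ge> 1"
    and A: "A \<in> carrier_mat (n + k - 1) n"
    and len: "length Bs = k" and Bs: "set Bs \<subseteq> carrier_mat (n + k - 1) n"
begin

abbreviation "m \<equiv> n + k - 1"
abbreviation "N \<equiv> (n + k - 1) choose k"

definition lA :: "nat \<Rightarrow> mpoly" where
  "lA r = (\<Sum>j<n. mconst (A $$ (r, j)) * mvar j)"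

definition lB :: "nat \<Rightarrow> nat \<Rightarrow> mpoly" where
  "lB = linform n (tuple_coeff Bs)"

lemma lB_eq: "lB r q = (\<Sum>j<n. mconst (Bs ! q $$ (r, j)) * mvar j)"
  by (simp add: lB_def linform_def tuple_coeff_def)

lemma lA_homog [simp]: "lA r \<in> homog n (Suc 0)"
  unfolding lA_def by (intro supported_sum supported_scale mvar_homog) auto

lemma lB_homog [simp]: "lB r q \<in> homog n (Suc 0)"
  by (simp add: lB_def)

definition col_monom :: "nat \<Rightarrow> (nat \<Rightarrow>\<^sub>0 nat)" where
  "col_monom c = list_monom (col_list n k c)"

lemma bij_col_monom: "bij_betw col_monom {..<N} (monoms_deg n {k})"
  using bij_betw_trans[OF bij_col_list bij_list_monom, of n k]
  by (simp add: comp_def col_monom_def[abs_def])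

definition D :: "nat \<Rightarrow> complex mat" where
  "D i = compressed_Delta n k A Bs i"

lemma D_carrier [simp]: "D i \<in> carrier_mat N N"
  using compressed_det_carrier compressed_Delta_0[of n k A Bs] compressed_Delta_pos[OF _ len, of i n A]
  by (cases "i = 0") (auto simp: D_def)

lemma D_0_index: "r < N \<Longrightarrow> c < N \<Longrightarrow> D 0 $$ (r, c) = mcoeff (minor lB (row_list n k r)) (col_monom c)"
  using compressed_det_coeff[OF len Bs]
  by (simp add: D_def compressed_Delta_0 lB_def col_monom_def)

lemma set_update_carrier: "set (Bs[q := A]) \<subseteq> carrier_mat m n"
  using Bs A set_update_subset_insert[of Bs q A] by blast

lemma D_Suc_index:
  assumes "q < k" "r < N" "c < N"
  shows "D (Suc q) $$ (r, c) = - mcoeff (minor (replace_col lB q lA) (row_list n k r)) (col_monom c)"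
proof -
  have "minor (linform n (tuple_coeff (Bs[q := A]))) (row_list n k r)
      = minor (replace_col lB q lA) (row_list n k r)"
    by (rule minor_cong) (use assms len strict_length[OF row_list_in[OF assms(2)]] in
        \<open>auto simp: replace_col_def linform_def tuple_coeff_def lB_def lA_def\<close>)
  moreover have "dim_row (compressed_det n k (Bs[q := A])) = N" "dim_col (compressed_det n k (Bs[q := A])) = N"
    using compressed_det_carrier by blast+
  ultimately show ?thesis
    using assms compressed_det_coeff[OF _ set_update_carrier, of q r c] len
    by (simp add: D_def compressed_Delta_pos col_monom_def)
qed

end

locale rmep_nondegenerate = rmep +
  assumes nondeg: "nondegenerate n k (tuple_coeff Bs)"
begin

definition P :: "complex mat" where
  "P = the (mat_inverse (D 0))"

lemma det_D_0: "det (D 0) \<noteq> 0"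
  using nondeg nondegenerate_iff_det[OF len Bs] by (simp add: D_def compressed_Delta_0)

lemma P: "P \<in> carrier_mat N N" "D 0 * P = 1\<^sub>m N" "P * D 0 = 1\<^sub>m N"
proof -
  have "mat_inverse (D 0) \<noteq> None"
    using notE[OF mat_inverse(1)[OF D_carrier] det_non_zero_imp_unit[OF D_carrier det_D_0]] by blast
  then obtain B where B: "mat_inverse (D 0) = Some B" by blast
  from mat_inverse(2)[OF D_carrier B]
  show "P \<in> carrier_mat N N" "D 0 * P = 1\<^sub>m N" "P * D 0 = 1\<^sub>m N"
    by (simp_all only: P_def B option.sel)
qed

definition G :: "nat \<Rightarrow> complex mat" where
  "G q = P * D (Suc q)"

lemma G_carrier [simp]: "G q \<in> carrier_mat N N"
  unfolding G_def by (rule mult_carrier_mat[OF P(1) D_carrier])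

lemma D_0_G: "D 0 * G q = D (Suc q)"
proof -
  have "D 0 * G q = (D 0 * P) * D (Suc q)"
    unfolding G_def by (rule assoc_mult_mat[OF D_carrier P(1) D_carrier, symmetric])
  then show ?thesis
    by (simp only: P(2) left_mult_one_mat[OF D_carrier])
qed

text \<open>\<open>G q\<close> acts from the right on coefficient vectors, because forms are the
  rows of \<open>D 0\<close>; \<open>c\<close> numbers the monomial whose coefficient is
  taken.\<close>

definition act :: "nat \<Rightarrow> mpoly \<Rightarrow> nat \<Rightarrow> complex" where
  "act q p c = (\<Sum>d<N. mcoeff p (col_monom d) * G q $$ (d, c))"

lemma act_add: "act q (p + p') c = act q p c + act q p' c"
  and act_scale: "act q (mconst a * p) c = a * act q p c"
  and act_0: "act q 0 c = 0"
  and act_uminus: "act q (- p) c = - act q p c"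
  by (simp_all add: act_def lookup_add distrib_right mult.assoc sum.distrib sum_distrib_left sum_negf)

lemma act_sum: "act q (sum f S) c = (\<Sum>x\<in>S. act q (f x) c)"
  by (induct S rule: infinite_finite_induct) (simp_all add: act_add act_0)

text \<open>This is \<open>D_0_G\<close> row by row, i.e.
  \<open>\<lambda>\<^sub>q d\<^sub>0 = d\<^sub>q\<close>, where the sign belongs to
  \<open>- A x\<close>.\<close>

lemma act_minor:
  assumes I: "I \<in> strict_lists m k" and "q < k" "c < N"
  shows "act q (minor lB I) c = - mcoeff (minor (replace_col lB q lA) I) (col_monom c)"
proof -
  obtain r where r: "r < N" "I = row_list n k r"
    using I bij_betw_imp_surj_on[OF bij_row_list[of n k]] by auto
  have "act q (minor lB I) c = (\<Sum>d<N. D 0 $$ (r, d) * G q $$ (d, c))"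
    using r assms by (simp add: act_def D_0_index)
  also have "\<dots> = (D 0 * G q) $$ (r, c)"
    using r assms G_carrier[of q] D_carrier[of 0]
    by (auto simp del: G_carrier D_carrier simp: scalar_prod_def atLeast0LessThan)
  finally show ?thesis
    using r assms by (simp add: D_0_G D_Suc_index)
qed

text \<open>The combination with coefficients \<open>g r\<close> of the rows of
  \<open>(A + \<Sum> \<lambda>\<^sub>q B\<^sub>q) x\<close>, where \<open>\<lambda>\<^sub>q\<close>
  has been replaced by the action of \<open>G q\<close>. It measures how far \<open>G\<close> is
  from multiplication by \<lambda> modulo these rows.\<close>

definition defect :: "(nat \<Rightarrow> mpoly) \<Rightarrow> nat \<Rightarrow> complex" where
  "defect g c = (\<Sum>q<k. act q (\<Sum>r<m. g r * lB r q) c) + mcoeff (\<Sum>r<m. g r * lA r) (col_monom c)"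

lemma defect_lincomb:
  "defect (\<lambda>r. \<Sum>x\<in>S. mconst (a x) * f x r) c = (\<Sum>x\<in>S. a x * defect (f x) c)"
proof -
  have s: "(\<Sum>r<m. (\<Sum>x\<in>S. mconst (a x) * f x r) * h r) = (\<Sum>x\<in>S. mconst (a x) * (\<Sum>r<m. f x r * h r))" for h
    unfolding sum_distrib_right sum_distrib_left
    by (subst sum.swap) (simp add: mult.assoc)
  show ?thesis
    unfolding defect_def s act_sum act_scale lookup_sum mcoeff_mconst_mult
    by (simp add: sum.distrib distrib_left sum_distrib_left sum.swap[of _ S])
qed

text \<open>Pairing with a column of \<open>lB\<close> other than \<open>i\<close> repeats a column;
  what is left is the relation of \<open>act_minor\<close>.\<close>

lemma defect_cofactor_row:
  assumes I: "I \<in> strict_lists m k" and i: "i < k" and c: "c < N"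
  shows "defect (cofactor_row lB I i) c = 0"
proof -
  have len: "length I = k" and sub: "set I \<subseteq> {..<m}"
    using I by (auto simp: strict_lists_def index_lists_def)
  have "act q (minor (replace_col lB i (\<lambda>r. lB r q)) I) c = (if q = i then act i (minor lB I) c else 0)"
    if "q < k" for q
    using that i len by (auto simp: replace_col_same minor_replace_other act_0)
  then have "defect (cofactor_row lB I i) c
      = act i (minor lB I) c + mcoeff (minor (replace_col lB i lA) I) (col_monom c)"
    using i len sub by (simp add: defect_def sum_cofactor_row)
  then show ?thesis using act_minor[OF I i c] by simp
qed

text \<open>There are \<open>(m choose k) * k\<close> cofactor vectors, and tuples of forms of
  degree \<open>k - 1\<close> have \<open>m * ((m - 1) choose (k - 1))\<close> coefficients. These
  numbers agree by absorption, so independence suffices. Consequently the vanishing of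
  \<open>defect\<close> has to be checked on cofactor vectors only.\<close>

lemma cofactor_rows_span:
  assumes g: "\<And>r. g r \<in> homog n (k - 1)"
  shows "\<exists>a. \<forall>r<m. g r = (\<Sum>(I, i)\<in>strict_lists m k \<times> {..<k}. mconst (a (I, i)) * cofactor_row lB I i r)"
proof -
  let ?X = "strict_lists m k \<times> {..<k}" and ?Y = "{..<m} \<times> monoms_deg n {k - 1}"
  let ?M = "\<lambda>(I, i) (r, \<mu>). mcoeff (cofactor_row lB I i r) \<mu>"
  have h: "cofactor_row lB I i r \<in> homog n (k - 1)" if "(I, i) \<in> ?X" for I i r
    using cofactor_row_homog[of i I lB n r] that strict_length[of I m k] by auto
  have hs: "(\<Sum>(I, i)\<in>?X. mconst (a (I, i)) * cofactor_row lB I i r) \<in> homog n (k - 1)" for a r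
    by (rule supported_sum) (use h in \<open>auto intro!: supported_scale\<close>)
  have coeff: "mcoeff (\<Sum>(I, i)\<in>?X. mconst (a (I, i)) * cofactor_row lB I i r) \<mu>
      = (\<Sum>x\<in>?X. a x * ?M x (r, \<mu>))" for a r \<mu>
    by (simp add: lookup_sum case_prod_beta)
  have card: "card ?X = card ?Y"
  proof -
    have "card ?X = (m choose k) * k" by (simp add: card_strict_lists)
    also have "\<dots> = m * ((m - 1) choose (k - 1))"
      using binomial_absorption[of "k - 1" m] k by (simp add: mult.commute)
    also have "\<dots> = card ?Y" using k by (simp add: card_monoms_homog)
    finally show ?thesis .
  qed
  have indep: "\<forall>x\<in>?X. a x = 0" if a: "\<And>y. y \<in> ?Y \<Longrightarrow> (\<Sum>x\<in>?X. a x * ?M x y) = 0" for a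
  proof -
    have z: "(\<Sum>(I, i)\<in>?X. mconst (a (I, i)) * cofactor_row lB I i r) = 0" if "r < m" for r
      by (rule homog_eqI[OF hs supported_0]) (use a that in \<open>simp only: coeff lookup_zero mem_Times_iff fst_conv snd_conv lessThan_iff\<close>)
    show "\<forall>x\<in>?X. a x = 0"
    proof (clarify)
      fix I i assume I: "I \<in> strict_lists m k" and i: "i < k"
      \<comment> \<open>Pairing with column \<open>i\<close> kills the cofactor vectors of all other
        columns and leaves a relation between minors.\<close>
      have "0 = (\<Sum>r<m. (\<Sum>(I, i)\<in>?X. mconst (a (I, i)) * cofactor_row lB I i r) * lB r i)"
        using z by simp
      also have "\<dots> = (\<Sum>(J, j)\<in>?X. mconst (a (J, j)) * (\<Sum>r<m. cofactor_row lB J j r * lB r i))"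
        unfolding sum_distrib_right sum_distrib_left case_prod_beta
        by (subst sum.swap) (simp add: mult.assoc)
      also have "\<dots> = (\<Sum>(J, j)\<in>?X. if j = i then mconst (a (J, i)) * minor lB J else 0)"
      proof (rule sum.cong[OF refl], clarify)
        fix J j assume J: "J \<in> strict_lists m k" and j: "j < k"
        have "length J = k" "set J \<subseteq> {..<m}"
          using J by (auto simp: strict_lists_def index_lists_def)
        then show "mconst (a (J, j)) * (\<Sum>r<m. cofactor_row lB J j r * lB r i)
            = (if j = i then mconst (a (J, i)) * minor lB J else 0)"
          using i j by (auto simp: sum_cofactor_row replace_col_same minor_replace_other)
      qed
      also have "\<dots> = (\<Sum>J\<in>strict_lists m k. mconst (a (J, i)) * minor lB J)"
        using i by (simp flip: sum.cartesian_product)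
      finally show "a (I, i) = 0"
        using nondeg I unfolding nondegenerate_def lB_def by metis
    qed
  qed
  obtain a where a: "\<forall>y\<in>?Y. (\<Sum>x\<in>?X. a x * ?M x y) = (\<lambda>(r, \<mu>). mcoeff (g r) \<mu>) y"
    using square_span[where M = ?M and t = "\<lambda>(r, \<mu>). mcoeff (g r) \<mu>", OF _ _ card indep] by auto
  have "g r = (\<Sum>(I, i)\<in>?X. mconst (a (I, i)) * cofactor_row lB I i r)" if "r < m" for r
  proof (rule homog_eqI[OF g hs])
    fix \<mu> assume "\<mu> \<in> monoms_deg n {k - 1}"
    then have "(r, \<mu>) \<in> ?Y" using that by simp
    from bspec[OF a this] show "mcoeff (g r) \<mu> = mcoeff (\<Sum>(I, i)\<in>?X. mconst (a (I, i)) * cofactor_row lB I i r) \<mu>"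
      unfolding coeff by simp
  qed
  then show ?thesis by blast
qed

text \<open>
  On forms of degree \<open>k\<close> in \<open>x\<close>, the matrices \<open>G q\<close> act as multiplication by \<open>\<lambda>\<^sub>q\<close> modulo the rows of
  \<open>(A + \<Sum> \<lambda>\<^sub>q B\<^sub>q) x\<close>.
\<close>

lemma defect_0:
  assumes g: "\<And>r. g r \<in> homog n (k - 1)" and c: "c < N"
  shows "defect g c = 0"
proof -
  obtain a where a: "\<forall>r<m. g r = (\<Sum>(I, i)\<in>strict_lists m k \<times> {..<k}. mconst (a (I, i)) * cofactor_row lB I i r)"
    using cofactor_rows_span[of g, OF g] by blast
  have "defect g c = defect (\<lambda>r. \<Sum>x\<in>strict_lists m k \<times> {..<k}. mconst (a x) * cofactor_row lB (fst x) (snd x) r) c"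
    unfolding defect_def using a by (simp add: case_prod_beta)
  also have "\<dots> = (\<Sum>x\<in>strict_lists m k \<times> {..<k}. a x * defect (cofactor_row lB (fst x) (snd x)) c)"
    by (rule defect_lincomb)
  also have "\<dots> = 0"
    by (rule sum.neutral) (use c in \<open>auto simp: defect_cofactor_row\<close>)
  finally show ?thesis .
qed

text \<open>Up to sign both sides represent
  \<open>\<lambda>\<^sub>i \<lambda>\<^sub>j d\<^sub>0\<close>. \<open>defect_0\<close> is applied
  to the cofactors of column \<open>i\<close> after column \<open>j\<close> has become
  \<open>A x\<close>. Pairing them with \<open>A x\<close>, or with \<open>B\<^sub>q x\<close> for
  \<open>q\<close> different from \<open>i\<close> and \<open>j\<close>, repeats a column. The two
  remaining terms are the two sides, with opposite signs because two columns have been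
  exchanged.\<close>

lemma act_commute:
  assumes I: "I \<in> strict_lists m k" and i: "i < k" and j: "j < k" and c: "c < N"
  shows "act j (minor (replace_col lB i lA) I) c = act i (minor (replace_col lB j lA) I) c"
proof (cases "i = j")
  case False
  have len: "length I = k" and sub: "set I \<subseteq> {..<m}"
    using I by (auto simp: strict_lists_def index_lists_def)
  let ?F = "replace_col lB j lA"
  have "defect (cofactor_row ?F I i) c = 0"
    by (rule defect_0[OF _ c]) (use cofactor_row_homog[of i I ?F n] i len in \<open>auto simp: replace_col_def\<close>)
  moreover have "minor (replace_col ?F i lA) I = 0"
    by (rule minor_equal_cols[of i _ j]) (use i j len False in \<open>auto simp: replace_col_def\<close>)
  moreover have "act q (minor (replace_col ?F i (\<lambda>r. lB r q)) I) c
      = (if q = i then act i (minor ?F I) c else 0) - (if q = j then act j (minor (replace_col lB i lA) I) c else 0)"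
    if q: "q < k" for q
  proof -
    consider "q = i" | "q = j" | "q \<noteq> i" "q \<noteq> j" by blast
    then show ?thesis
    proof cases
      case 1
      then have "replace_col ?F i (\<lambda>r. lB r q) = ?F" using False by (intro ext) (simp add: replace_col_def)
      with 1 False show ?thesis by simp
    next
      case 2
      have "minor (replace_col ?F i (\<lambda>r. lB r j)) I
          = - minor (replace_col (replace_col lB j (\<lambda>r. lB r j)) i lA) I"
        by (rule minor_swap_cols) (use i j len False in auto)
      with 2 False show ?thesis by (simp add: replace_col_same act_uminus)
    next
      case 3
      have "minor (replace_col ?F i (\<lambda>r. lB r q)) I = 0"
        by (rule minor_equal_cols[of i _ q]) (use i q len 3 in \<open>auto simp: replace_col_def\<close>)
      with 3 show ?thesis by (simp add: act_0)
    qed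
  qed
  ultimately show ?thesis
    using i j len sub by (simp add: defect_def sum_cofactor_row sum_subtractf)
qed simp

lemma D_Suc_G_index:
  assumes "i < k" "r < N" "c < N"
  shows "(D (Suc i) * G j) $$ (r, c) = - act j (minor (replace_col lB i lA) (row_list n k r)) c"
proof -
  have "(D (Suc i) * G j) $$ (r, c) = (\<Sum>d<N. D (Suc i) $$ (r, d) * G j $$ (d, c))"
    using assms G_carrier[of j] D_carrier[of "Suc i"]
    by (auto simp del: G_carrier D_carrier simp: scalar_prod_def atLeast0LessThan)
  then show ?thesis
    using assms by (simp add: act_def D_Suc_index sum_negf)
qed

text \<open>Multiplying by \<open>D 0\<close> on the left turns this into
  \<open>D (Suc i) * G j = D (Suc j) * G i\<close>, whose rows are compared by
  \<open>act_commute\<close>.\<close>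

lemma G_commute:
  assumes "i < k" "j < k"
  shows "G i * G j = G j * G i"
proof -
  have DG: "D (Suc i) * G j = D (Suc j) * G i"
  proof (rule eq_matI)
    fix r c assume "r < dim_row (D (Suc j) * G i)" "c < dim_col (D (Suc j) * G i)"
    then have "r < N" "c < N" using D_carrier[of "Suc j"] G_carrier[of i] by auto
    then show "(D (Suc i) * G j) $$ (r, c) = (D (Suc j) * G i) $$ (r, c)"
      using assms act_commute[OF row_list_in] by (simp add: D_Suc_G_index)
  qed (use D_carrier[of "Suc i"] D_carrier[of "Suc j"] G_carrier[of i] G_carrier[of j] in auto)
  have "G i * G j = P * (D (Suc i) * G j)"
    unfolding G_def[of i] by (rule assoc_mult_mat[OF P(1) D_carrier G_carrier])
  also have "\<dots> = P * (D (Suc j) * G i)" by (simp only: DG)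
  also have "\<dots> = (P * D (Suc j)) * G i"
    by (rule assoc_mult_mat[OF P(1) D_carrier G_carrier, symmetric])
  also have "\<dots> = G j * G i" by (simp only: G_def[of j])
  finally show ?thesis .
qed

lemma pencil_mult_vec:
  assumes "y \<in> carrier_vec n" "r < m"
  shows "(pencil A Bs v *\<^sub>v y) $ r = (\<Sum>j<n. A $$ (r, j) * y $ j) + (\<Sum>q<k. v $ q * (\<Sum>j<n. Bs ! q $$ (r, j) * y $ j))"
proof -
  have "(pencil A Bs v *\<^sub>v y) $ r = (\<Sum>j<n. (A $$ (r, j) + (\<Sum>q<k. v $ q * Bs ! q $$ (r, j))) * y $ j)"
    using assms A len by (simp add: pencil_def scalar_prod_def atLeast0LessThan)
  also have "\<dots> = (\<Sum>j<n. A $$ (r, j) * y $ j) + (\<Sum>j<n. \<Sum>q<k. v $ q * (Bs ! q $$ (r, j) * y $ j))"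
    by (simp add: distrib_right sum.distrib sum_distrib_right mult.assoc)
  finally show ?thesis
    by (simp add: sum_distrib_left sum.swap[of _ "{..<k}"])
qed

lemma meval_homog:
  assumes "p \<in> homog n k"
  shows "meval p x = (\<Sum>c<N. mcoeff p (col_monom c) * monom_eval (col_monom c) x)"
proof -
  have "meval p x = (\<Sum>m\<in>monoms_deg n {k}. mcoeff p m * monom_eval m x)"
    using assms by (intro meval_superset) (auto simp: supported_def)
  also have "\<dots> = (\<Sum>c<N. mcoeff p (col_monom c) * monom_eval (col_monom c) x)"
    by (rule sum.reindex_bij_betw[OF bij_col_monom, symmetric])
  finally show ?thesis .
qed

text \<open>The common eigenvector \<open>w\<close> consists of all monomials of degree
  \<open>k\<close> at the null vector \<open>x\<close>, its Veronese image. Multiplying a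
  coefficient matrix by \<open>w\<close> evaluates the forms at \<open>x\<close>, and there
  \<open>A x\<close> is minus the combination of the \<open>B\<^sub>q x\<close> with coefficients
  \<open>v $ q\<close>, so Cramer's rule gives the eigenvalue.\<close>

lemma common_eigenvalue_if:
  assumes ev: "rmep_eigenvalue A Bs v"
  shows "\<exists>w. \<forall>q<k. eigenvector (G q) w (v $ q)"
proof -
  obtain x where x: "x \<in> carrier_vec n" "x \<noteq> 0\<^sub>v n" "pencil A Bs v *\<^sub>v x = 0\<^sub>v m"
    using ev A by (auto simp: rmep_eigenvalue_def)
  define b where "b r q = (\<Sum>j<n. Bs ! q $$ (r, j) * x $ j)" for r q
  define a where "a r = (\<Sum>j<n. A $$ (r, j) * x $ j)" for r
  have ab: "a r = - (\<Sum>q<k. v $ q * b r q)" if "r < m" for r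
    using pencil_mult_vec[OF x(1) that, of v] x(3) that
    by (simp add: a_def b_def add_eq_0_iff2)
  have ev_lB: "meval (lB r q) x = b r q" and ev_lA: "meval (lA r) x = a r" for r q
    by (simp_all add: lB_eq lA_def meval.hom_sum meval_mult a_def b_def)
  define w where "w = vec N (\<lambda>c. monom_eval (col_monom c) x)"
  have w: "w \<in> carrier_vec N" by (simp add: w_def)
  have "w \<noteq> 0\<^sub>v N"
  proof -
    \<comment> \<open>The \<open>k\<close>-th power of a nonzero coordinate of \<open>x\<close> is a
      nonzero entry of \<open>w\<close>.\<close>
    obtain i where i: "i < n" "x $ i \<noteq> 0" using x(1,2) by (auto simp: vec_eq_iff)
    then have "list_monom (replicate k i) \<in> monoms_deg n {k}"
      by (auto simp: monoms_deg_def monoms_def keys_list_monom)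
    then obtain c where c: "c < N" "col_monom c = list_monom (replicate k i)"
      using bij_betw_imp_surj_on[OF bij_col_monom] by (metis imageE lessThan_iff)
    have "monom_eval (col_monom c) x \<noteq> 0"
      using i k by (simp add: c monom_eval_def keys_list_monom)
    then have "w $ c \<noteq> 0" using c(1) by (simp add: w_def)
    then show ?thesis using c(1) by auto
  qed
  have D0w: "(D 0 *\<^sub>v w) $ r = minor b (row_list n k r)" if "r < N" for r
  proof -
    have "minor lB (row_list n k r) \<in> homog n k"
      using minor_homog[of "row_list n k r" lB n] strict_length[OF row_list_in[OF that]] by simp
    then have "meval (minor lB (row_list n k r)) x = (D 0 *\<^sub>v w) $ r"
      using that D_carrier[of 0]
      by (auto simp: meval_homog scalar_prod_def w_def D_0_index atLeast0LessThan simp del: D_carrier)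
    then show ?thesis by (simp add: meval.hom_minor ev_lB)
  qed
  have Dw: "(D (Suc q) *\<^sub>v w) $ r = v $ q * minor b (row_list n k r)" if r: "r < N" and q: "q < k" for r q
  proof -
    let ?I = "row_list n k r"
    have I: "length ?I = k" "set ?I \<subseteq> {..<m}"
      using row_list_in[OF r] by (auto simp: strict_lists_def index_lists_def)
    have "minor (replace_col lB q lA) ?I \<in> homog n k"
      using minor_homog[of ?I "replace_col lB q lA" n] I by (simp add: replace_col_def)
    then have "- meval (minor (replace_col lB q lA) ?I) x = (D (Suc q) *\<^sub>v w) $ r"
      using r q D_carrier[of "Suc q"]
      by (auto simp: meval_homog scalar_prod_def w_def D_Suc_index atLeast0LessThan sum_negf simp del: D_carrier)
    moreover have "meval (minor (replace_col lB q lA) ?I) x = minor (replace_col b q a) ?I"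
      unfolding meval.hom_minor by (rule minor_cong) (simp add: replace_col_def ev_lB ev_lA)
    moreover have "minor (replace_col b q a) ?I = - (v $ q * minor b ?I)"
    proof -
      have "minor (replace_col b q a) ?I = minor (replace_col b q (\<lambda>r. - (\<Sum>q<k. v $ q * b r q))) ?I"
        by (rule minor_cong) (use I ab in \<open>auto simp: replace_col_def\<close>)
      also have "\<dots> = - (\<Sum>q'<k. v $ q' * minor (replace_col b q (\<lambda>r. b r q')) ?I)"
      proof -
        have "(\<Sum>p<length ?I. (\<Sum>q'<k. v $ q' * b (?I ! p) q') * minor_cofactor b ?I p q)
            = (\<Sum>q'<k. v $ q' * (\<Sum>p<length ?I. b (?I ! p) q' * minor_cofactor b ?I p q))"
          unfolding sum_distrib_left sum_distrib_right by (subst sum.swap) (simp add: mult.assoc)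
        then show ?thesis using q I by (simp add: minor_replace_col sum_negf)
      qed
      also have "(\<Sum>q'<k. v $ q' * minor (replace_col b q (\<lambda>r. b r q')) ?I) = (\<Sum>q'<k. if q' = q then v $ q * minor b ?I else 0)"
        by (rule sum.cong) (use q I in \<open>auto simp: replace_col_same minor_replace_other\<close>)
      finally show ?thesis using q by simp
    qed
    ultimately show ?thesis by simp
  qed
  have "eigenvector (G q) w (v $ q)" if q: "q < k" for q
  proof -
    have "D (Suc q) *\<^sub>v w = v $ q \<cdot>\<^sub>v (D 0 *\<^sub>v w)"
      using D_carrier[of "Suc q"] D_carrier[of 0] w
      by (intro eq_vecI) (auto simp: Dw[OF _ q] D0w simp del: D_carrier index_mult_mat_vec)
    then have "G q *\<^sub>v w = P *\<^sub>v (v $ q \<cdot>\<^sub>v (D 0 *\<^sub>v w))"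
      unfolding G_def by (simp only: assoc_mult_mat_vec[OF P(1) D_carrier w])
    also have "\<dots> = v $ q \<cdot>\<^sub>v (P *\<^sub>v (D 0 *\<^sub>v w))"
      by (rule mult_mat_vec[OF P(1) mult_mat_vec_carrier[OF D_carrier w]])
    also have "P *\<^sub>v (D 0 *\<^sub>v w) = w"
      using w by (simp only: P(3) one_mult_mat_vec assoc_mult_mat_vec[OF P(1) D_carrier w, symmetric])
    finally show ?thesis
      using w \<open>w \<noteq> 0\<^sub>v N\<close> G_carrier[of q] by (auto simp: eigenvector_def)
  qed
  then show ?thesis by blast
qed

text \<open>The eigenvector need not be a Veronese image. It is read as a linear functional
  \<open>W\<close> on forms of degree \<open>k\<close>, under which \<open>G q\<close> becomes the
  scalar \<open>v $ q\<close>. Then \<open>defect_0\<close> says that \<open>W\<close> annihilates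
  every row of the pencil applied to \<open>x\<close> and multiplied by a form of degree
  \<open>k - 1\<close>. Fixing a monomial as this form contracts \<open>w\<close> to a null vector
  with \<open>n\<close> entries.\<close>

lemma rmep_eigenvalue_if:
  assumes w: "\<And>q. q < k \<Longrightarrow> eigenvector (G q) w (v $ q)" and v: "v \<in> carrier_vec k"
  shows "rmep_eigenvalue A Bs v"
proof -
  have wc: "w \<in> carrier_vec N" and w0: "w \<noteq> 0\<^sub>v N"
    using w[of 0] k G_carrier[of 0] by (auto simp: eigenvector_def)
  have Gw: "(\<Sum>c<N. G q $$ (d, c) * w $ c) = v $ q * w $ d" if "q < k" "d < N" for q d
  proof -
    have "(G q *\<^sub>v w) $ d = (v $ q \<cdot>\<^sub>v w) $ d"
      using w[OF that(1)] by (simp add: eigenvector_def)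
    then show ?thesis
      using that wc G_carrier[of q] by (auto simp: scalar_prod_def atLeast0LessThan simp del: G_carrier)
  qed
  define W where "W p = (\<Sum>c<N. mcoeff p (col_monom c) * w $ c)" for p
  have W_add: "W (p + p') = W p + W p'" and W_scale: "W (mconst a * p) = a * W p" for p p' a
    by (simp_all add: W_def lookup_add distrib_right mult.assoc sum.distrib sum_distrib_left)
  have W_sum: "W (sum f S) = (\<Sum>x\<in>S. W (f x))" for f :: "nat \<Rightarrow> mpoly" and S
    by (induct S rule: infinite_finite_induct) (simp_all add: W_add, simp_all add: W_def)
  have W_act: "(\<Sum>c<N. act q p c * w $ c) = v $ q * W p" if "q < k" for q p
  proof -
    have "(\<Sum>c<N. act q p c * w $ c) = (\<Sum>d<N. mcoeff p (col_monom d) * (\<Sum>c<N. G q $$ (d, c) * w $ c))"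
      unfolding act_def sum_distrib_right sum_distrib_left by (subst sum.swap) (simp add: mult.assoc)
    also have "\<dots> = (\<Sum>d<N. mcoeff p (col_monom d) * (v $ q * w $ d))"
      by (intro sum.cong refl arg_cong2[where f = "(*)"] Gw that) simp
    finally show ?thesis by (simp add: W_def sum_distrib_left mult.left_commute)
  qed
  have W0: "W (p * lA r) + (\<Sum>q<k. v $ q * W (p * lB r q)) = 0" if p: "p \<in> homog n (k - 1)" and r: "r < m" for p r
  proof -
    let ?g = "\<lambda>r'. if r' = r then p else 0"
    have g: "(\<Sum>r'<m. ?g r' * h r') = p * h r" for h :: "nat \<Rightarrow> mpoly"
    proof -
      have "(\<Sum>r'<m. ?g r' * h r') = (\<Sum>r'<m. if r' = r then p * h r' else 0)" by (rule sum.cong) auto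
      then show ?thesis using r by simp
    qed
    have "0 = (\<Sum>c<N. defect ?g c * w $ c)"
      using defect_0[of ?g] p by (simp add: sum.neutral)
    also have "\<dots> = (\<Sum>q<k. \<Sum>c<N. act q (p * lB r q) c * w $ c) + W (p * lA r)"
      unfolding defect_def g W_def distrib_right sum.distrib sum_distrib_right
      by (subst sum.swap) simp
    also have "\<dots> = (\<Sum>q<k. v $ q * W (p * lB r q)) + W (p * lA r)"
      by (intro arg_cong2[where f = "(+)"] sum.cong refl W_act) simp
    finally show ?thesis by (simp only: add.commute)
  qed
  obtain c0 where c0: "c0 < N" "w $ c0 \<noteq> 0" using wc w0 by (auto simp: vec_eq_iff)
  \<comment> \<open>Splitting one variable off a monomial on which \<open>W\<close> is nonzero makes
    entry \<open>j0\<close> of the contraction nonzero.\<close>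
  obtain j0 js where j0: "col_list n k c0 = j0 # js"
    using col_list_in[OF c0(1)] k by (cases "col_list n k c0") (auto simp: sorted_lists_def index_lists_def)
  have j0n: "j0 < n" and js: "mmonom (list_monom js) \<in> homog n (k - 1)"
    using col_list_in[OF c0(1)]
    by (auto simp: j0 sorted_lists_def index_lists_def monoms_deg_def monoms_def keys_list_monom intro!: supported_single)
  let ?p = "mmonom (list_monom js)"
  define y where "y = vec n (\<lambda>j. W (?p * mvar j))"
  have "W (?p * mvar j0) = (\<Sum>c<N. if c = c0 then w $ c else 0)"
  proof -
    have "?p * mvar j0 = mmonom (col_monom c0)"
      by (simp add: mvar_def mult_single col_monom_def j0 add.commute)
    moreover have "mcoeff (mmonom (col_monom c0)) (col_monom c) * w $ c = (if c = c0 then w $ c else 0)" if "c < N" for c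
      using that c0(1) bij_col_monom by (auto simp: lookup_single when_def bij_betw_def dest: inj_onD)
    ultimately show ?thesis by (simp add: W_def)
  qed
  then have "y $ j0 \<noteq> 0" using c0 j0n by (simp add: y_def)
  then have y0: "y \<noteq> 0\<^sub>v n" using j0n by auto
  have yc: "y \<in> carrier_vec n" by (simp add: y_def)
  have "pencil A Bs v *\<^sub>v y = 0\<^sub>v m"
  proof (rule eq_vecI)
    fix r assume "r < dim_vec (0\<^sub>v m)"
    then have r: "r < m" by simp
    have lin: "W (?p * (\<Sum>j<n. mconst (f j) * mvar j)) = (\<Sum>j<n. f j * y $ j)" for f
      unfolding sum_distrib_left W_sum
      by (rule sum.cong) (simp_all add: y_def mult.left_commute[of ?p] W_scale)
    show "(pencil A Bs v *\<^sub>v y) $ r = 0\<^sub>v m $ r"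
      using W0[OF js r] r by (simp add: pencil_mult_vec[OF yc r] lA_def lB_eq lin)
  qed (use A in \<open>simp add: pencil_def\<close>)
  then show ?thesis
    using y0 yc v len A by (auto simp: rmep_eigenvalue_def)
qed

end

section \<open>Normal forms modulo the maximal minors\<close>

lemma monom_induct [case_names zero add]:
  fixes \<mu> :: "nat \<Rightarrow>\<^sub>0 nat"
  assumes "P 0" "\<And>i \<mu>. P \<mu> \<Longrightarrow> P (Poly_Mapping.single i 1 + \<mu>)"
  shows "P \<mu>"
proof -
  obtain xs where "list_monom xs = \<mu>" using list_monom_surj by blast
  moreover have "P (list_monom xs)" by (induct xs) (use assms in auto)
  ultimately show ?thesis by simp
qed

lemma monoms_split:
  assumes "\<mu> \<in> monoms_deg v {Suc d}"
  obtains i \<mu>' where "i < v" "\<mu>' \<in> monoms_deg v {d}" "\<mu> = Poly_Mapping.single i 1 + \<mu>'"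
proof -
  obtain xs where xs: "list_monom xs = \<mu>" using list_monom_surj by blast
  then have "length xs = Suc d" "set xs \<subseteq> {..<v}"
    using assms by (auto simp: monoms_deg_def monoms_def keys_list_monom)
  then obtain i ys where "xs = i # ys" "i < v" "set ys \<subseteq> {..<v}" "length ys = d"
    by (cases xs) auto
  then show ?thesis
    using that[of i "list_monom ys"] xs by (auto simp: monoms_deg_def monoms_def keys_list_monom)
qed

lemma mvar_mmonom: "mvar i * mmonom \<mu> = mmonom (Poly_Mapping.single i 1 + \<mu>)"
  by (simp add: mvar_def mult_single)

lemma mvar_mult_deglt: "i < v \<Longrightarrow> p \<in> deglt v d \<Longrightarrow> mvar i * p \<in> degle v d"
  using deglt_mult[of p v d "mvar i" 1] homog_degle[OF mvar_homog[of i v]] deglt_Suc[of v d]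
  by (simp add: mult.commute)

lemma lincomb_swap:
  "(\<Sum>y\<in>Y. mconst (\<Sum>x\<in>X. c x * M x y) * w y) = (\<Sum>x\<in>X. mconst (c x) * (\<Sum>y\<in>Y. mconst (M x y) * w y))"
proof -
  have "(\<Sum>y\<in>Y. mconst (\<Sum>x\<in>X. c x * M x y) * w y) = (\<Sum>y\<in>Y. \<Sum>x\<in>X. mconst (c x) * (mconst (M x y) * w y))"
    by (simp only: mconst_sum mconst_mult sum_distrib_right mult.assoc)
  also have "\<dots> = (\<Sum>x\<in>X. \<Sum>y\<in>Y. mconst (c x) * (mconst (M x y) * w y))"
    by (rule sum.swap)
  finally show ?thesis by (simp only: sum_distrib_left)
qed

locale rmep_regular = rmep +
  assumes regular: "nondegenerate k n (\<lambda>r a l. Bs ! l $$ (r, a))"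
begin

definition F :: "nat \<Rightarrow> nat \<Rightarrow> mpoly" where
  "F r a = mconst (A $$ (r, a)) + (\<Sum>l<k. mvar l * mconst (Bs ! l $$ (r, a)))"

definition F0 :: "nat \<Rightarrow> nat \<Rightarrow> mpoly" where
  "F0 = linform k (\<lambda>r a l. Bs ! l $$ (r, a))"

abbreviation "S \<equiv> strict_lists m n"
abbreviation "f \<equiv> minor F"
abbreviation "f0 \<equiv> minor F0"

lemma F_eq: "F r a = mconst (A $$ (r, a)) + F0 r a"
  by (simp add: F_def F0_def linform_def mult.commute)

lemma F0_homog [simp]: "F0 r a \<in> homog k (Suc 0)"
  by (simp add: F0_def)

lemma f0_homog: "J \<in> S \<Longrightarrow> f0 J \<in> homog k n"
  using minor_homog[of J F0 k] by (simp add: strict_length)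

lemma f_lead: "J \<in> S \<Longrightarrow> f J - f0 J \<in> deglt k n"
proof -
  assume J: "J \<in> S"
  have "mconst c \<in> deglt k (Suc 0)" for c
    using homog_degle[OF mconst_homog] deglt_Suc by blast
  then show ?thesis
    using minor_leading[of J F0 k F] by (simp add: F_eq strict_length[OF J])
qed

lemma f_degle: "J \<in> S \<Longrightarrow> f J \<in> degle k n"
  using supported_add[OF deglt_degle[OF f_lead[of J]] homog_degle[OF f0_homog[of J]]] by simp

lemma regular_indep:
  assumes "(\<Sum>J\<in>S. mconst (c J) * f0 J) = 0" "J \<in> S"
  shows "c J = 0"
  using regular assms unfolding nondegenerate_def F0_def by (simp add: add.commute)

lemma regular_span: "p \<in> homog k n \<Longrightarrow> \<exists>c. p = (\<Sum>J\<in>S. mconst (c J) * f0 J)"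
  using nondegenerate_span[OF regular] unfolding F0_def by (simp add: add.commute)

text \<open>Constant coefficients only. Within the polynomials of degree at most \<open>n\<close>
  this space is a complement of those of degree less than \<open>n\<close>, so the reduction
  \<open>red\<close> is unambiguous there before anything is known about the whole ideal.\<close>

definition LS :: "mpoly set" where
  "LS = range (\<lambda>c. \<Sum>J\<in>S. mconst (c J) * f J)"

lemma LS_I: "(\<Sum>J\<in>S. mconst (c J) * f J) \<in> LS"
  by (auto simp: LS_def)

lemma subspace_LS: "mp.subspace LS"
proof (rule mp.subspaceI)
  show "0 \<in> LS" using LS_I[of "\<lambda>_. 0"] by simp
  fix x y c assume "x \<in> LS" "y \<in> LS"
  then obtain a b where ab: "x = (\<Sum>J\<in>S. mconst (a J) * f J)" "y = (\<Sum>J\<in>S. mconst (b J) * f J)"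
    by (auto simp: LS_def)
  show "x + y \<in> LS"
    using LS_I[of "\<lambda>J. a J + b J"] by (simp add: ab mconst_add distrib_right sum.distrib)
  show "mconst c * x \<in> LS"
    using LS_I[of "\<lambda>J. c * a J"] unfolding ab(1) by (simp only: mconst_mult sum_distrib_left mult.assoc)
qed

lemmas LS_closed = mp.subspace_0[OF subspace_LS] mp.subspace_add[OF subspace_LS]
  mp.subspace_diff[OF subspace_LS] mp.subspace_scale[OF subspace_LS] mp.subspace_sum[OF subspace_LS]
  mp.subspace_neg[OF subspace_LS]

lemma f_LS: "J \<in> S \<Longrightarrow> f J \<in> LS"
proof -
  assume J: "J \<in> S"
  have "(\<Sum>K\<in>S. mconst (if K = J then 1 else 0) * f K) = (\<Sum>K\<in>S. if K = J then f K else 0)"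
    by (rule sum.cong) auto
  then show ?thesis using LS_I[of "\<lambda>K. if K = J then 1 else 0"] J by simp
qed

lemma LS_lead: "(\<Sum>J\<in>S. mconst (c J) * f J) - (\<Sum>J\<in>S. mconst (c J) * f0 J) \<in> deglt k n"
  unfolding sum_subtractf[symmetric] right_diff_distrib[symmetric]
  by (intro supported_sum supported_scale f_lead)

text \<open>A drop in degree would be a linear dependency between the leading forms.\<close>

lemma LS_deglt:
  assumes "p \<in> LS" "p \<in> deglt k n"
  shows "p = 0"
proof -
  obtain c where c: "p = (\<Sum>J\<in>S. mconst (c J) * f J)" using assms(1) by (auto simp: LS_def)
  have "(\<Sum>J\<in>S. mconst (c J) * f0 J) \<in> deglt k n"
    using supported_diff[OF assms(2) LS_lead[of c]] by (simp add: c)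
  moreover have "(\<Sum>J\<in>S. mconst (c J) * f0 J) \<in> homog k n"
    by (intro supported_sum supported_scale f0_homog)
  ultimately have "(\<Sum>J\<in>S. mconst (c J) * f0 J) = 0" by (metis homog_deglt_0)
  then have "c J = 0" if "J \<in> S" for J using regular_indep that by blast
  then show ?thesis by (simp add: c)
qed

text \<open>The part of degree \<open>n\<close> is a combination of leading forms; subtracting the
  same combination of the minors themselves removes it.\<close>

lemma degle_decomp:
  assumes p: "p \<in> degle k n"
  shows "\<exists>r\<in>deglt k n. p - r \<in> LS"
proof -
  define h where "h = (\<Sum>\<mu>\<in>monoms_deg k {n}. mconst (mcoeff p \<mu>) * mmonom \<mu>)"
  have hc: "mcoeff h \<mu> = (if \<mu> \<in> monoms_deg k {n} then mcoeff p \<mu> else 0)" for \<mu>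
    unfolding h_def lookup_sum mcoeff_mconst_mult lookup_single when_def
    by (simp add: if_distrib[of "\<lambda>x. _ * x"] sum.delta cong: if_cong)
  have h: "h \<in> homog k n" by (rule supportedI) (use hc in \<open>auto split: if_splits\<close>)
  have ph: "p - h \<in> deglt k n"
  proof (rule supportedI)
    fix \<mu> assume "mcoeff (p - h) \<mu> \<noteq> 0"
    then have "\<mu> \<notin> monoms_deg k {n}" "mcoeff p \<mu> \<noteq> 0" by (auto simp: lookup_minus hc split: if_splits)
    moreover from this have "\<mu> \<in> monoms_deg k {..n}" using p supportedD by blast
    ultimately show "\<mu> \<in> monoms_deg k {..<n}" by (auto simp: monoms_deg_def)
  qed
  obtain c where c: "h = (\<Sum>J\<in>S. mconst (c J) * f0 J)" using regular_span[OF h] by blast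
  let ?q = "\<Sum>J\<in>S. mconst (c J) * f J"
  have "p - ?q = (p - h) - (?q - h)" by simp
  then have "p - ?q \<in> deglt k n" using supported_diff[OF ph LS_lead[of c]] by (simp add: c)
  then show ?thesis using LS_I[of c] by (intro bexI[of _ "p - ?q"]) auto
qed

definition red :: "mpoly \<Rightarrow> mpoly" where
  "red p = (THE r. r \<in> deglt k n \<and> p - r \<in> LS)"

lemma red_unique: "r \<in> deglt k n \<Longrightarrow> p - r \<in> LS \<Longrightarrow> red p = r"
proof -
  assume r: "r \<in> deglt k n" "p - r \<in> LS"
  have "r' = r" if "r' \<in> deglt k n" "p - r' \<in> LS" for r'
    using LS_deglt[of "r' - r"] LS_closed(3)[OF r(2) that(2)] supported_diff[OF that(1) r(1)] by simp
  then show ?thesis unfolding red_def using r by blast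
qed

lemma
  assumes "p \<in> degle k n"
  shows red_deglt: "red p \<in> deglt k n" and red_diff: "p - red p \<in> LS"
proof -
  obtain r where r: "r \<in> deglt k n" "p - r \<in> LS" using degle_decomp[OF assms] by blast
  with red_unique[OF this] show "red p \<in> deglt k n" "p - red p \<in> LS" by simp_all
qed

lemma red_id: "p \<in> deglt k n \<Longrightarrow> red p = p"
  using LS_closed(1) by (intro red_unique) auto

lemma red_LS: "p \<in> LS \<Longrightarrow> red p = 0"
  by (intro red_unique) auto

lemma red_add: "p \<in> degle k n \<Longrightarrow> q \<in> degle k n \<Longrightarrow> red (p + q) = red p + red q"
  using LS_closed(2)[OF red_diff red_diff, of p q]
  by (intro red_unique supported_add red_deglt) (auto simp: algebra_simps)

lemma red_scale: "p \<in> degle k n \<Longrightarrow> red (mconst c * p) = mconst c * red p"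
  using LS_closed(4)[OF red_diff, of p c]
  by (intro red_unique supported_scale red_deglt) (auto simp: algebra_simps)

lemma red_sum: "(\<And>x. x \<in> T \<Longrightarrow> g x \<in> degle k n) \<Longrightarrow> red (sum g T) = (\<Sum>x\<in>T. red (g x))"
  by (induct T rule: infinite_finite_induct) (simp_all add: red_add supported_sum red_id)

section \<open>Linear syzygies of the minors\<close>

text \<open>
  The relation obtained by repeating column \<open>a\<close> in an \<open>(n + 1)\<close>-rowed submatrix and expanding along
  the extra column.
\<close>

definition syz :: "nat list \<times> nat \<Rightarrow> nat list \<times> nat \<Rightarrow> complex" where
  "syz = (\<lambda>(H, a) (J, l). \<Sum>p | p \<le> n \<and> drop_nth p H = J. (-1) ^ p * Bs ! l $$ (H ! p, a))"

lemma mconst_sign: "mconst ((-1) ^ p) = (-1) ^ p"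
  by (simp add: mconst_power mconst_uminus)

lemma sum_syz:
  assumes H: "H \<in> strict_lists m (Suc n)"
  shows "(\<Sum>(J, l)\<in>S \<times> {..<k}. mconst (syz (H, a) (J, l)) * (mvar l * \<phi> J))
    = (\<Sum>p\<le>n. (-1) ^ p * F0 (H ! p) a * \<phi> (drop_nth p H))"
proof -
  have "(\<Sum>(J, l)\<in>S \<times> {..<k}. mconst (syz (H, a) (J, l)) * (mvar l * \<phi> J))
      = (\<Sum>J\<in>S. \<Sum>l<k. \<Sum>p | p \<le> n \<and> drop_nth p H = J.
          (-1) ^ p * mconst (Bs ! l $$ (H ! p, a)) * mvar l * \<phi> J)"
    unfolding sum.cartesian_product[symmetric] syz_def
    by (simp add: mconst_sum mconst_mult mconst_sign sum_distrib_right mult.assoc)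
  also have "\<dots> = (\<Sum>J\<in>S. \<Sum>p | p \<le> n \<and> drop_nth p H = J. \<Sum>l<k.
          (-1) ^ p * mconst (Bs ! l $$ (H ! p, a)) * mvar l * \<phi> J)"
    by (intro sum.cong refl sum.swap)
  also have "\<dots> = (\<Sum>J\<in>S. \<Sum>p | p \<in> {..n} \<and> drop_nth p H = J. (-1) ^ p * F0 (H ! p) a * \<phi> (drop_nth p H))"
    by (intro sum.cong refl)
      (auto simp: F0_def linform_def sum_distrib_left sum_distrib_right mult.assoc intro!: sum.cong)
  also have "\<dots> = (\<Sum>p\<le>n. (-1) ^ p * F0 (H ! p) a * \<phi> (drop_nth p H))"
    by (rule sum.group) (use drop_nth_strict[OF H] in auto)
  finally show ?thesis .
qed

lemma sum_syz_pair:
  assumes "H \<in> strict_lists m (Suc n)"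
  shows "(\<Sum>y\<in>S \<times> {..<k}. mconst (syz (H, a) y) * (mvar (snd y) * \<phi> (fst y)))
    = (\<Sum>p\<le>n. (-1) ^ p * F0 (H ! p) a * \<phi> (drop_nth p H))"
  using sum_syz[OF assms, of a \<phi>] by (simp add: case_prod_beta)

text \<open>\<open>s\<close> lists the coefficients of linear forms by which the leading forms are
  multiplied; the linear syzygies are the families of value 0.\<close>

definition syz_value :: "(nat list \<times> nat \<Rightarrow> complex) \<Rightarrow> mpoly" where
  "syz_value s = (\<Sum>(J, l)\<in>S \<times> {..<k}. mconst (s (J, l)) * (mvar l * f0 J))"

lemma syz_value_lincomb:
  assumes "\<And>y. y \<in> S \<times> {..<k} \<Longrightarrow> s y = (\<Sum>x\<in>X. c x * M x y)"
  shows "syz_value s = (\<Sum>x\<in>X. mconst (c x) * syz_value (M x))"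
proof -
  let ?w = "\<lambda>y. mvar (snd y) * f0 (fst y)"
  have "syz_value s = (\<Sum>y\<in>S \<times> {..<k}. mconst (s y) * ?w y)"
    by (simp add: syz_value_def case_prod_beta)
  also have "\<dots> = (\<Sum>y\<in>S \<times> {..<k}. mconst (\<Sum>x\<in>X. c x * M x y) * ?w y)"
    by (rule sum.cong[OF refl]) (simp only: assms)
  also note lincomb_swap
  finally show ?thesis
    by (simp add: syz_value_def case_prod_beta)
qed

lemma repeated_col:
  assumes H: "H \<in> strict_lists m (Suc n)" and a: "a < n" and E: "\<And>r. E r a = F' r"
  shows "(\<Sum>p\<le>n. (-1) ^ p * F' (H ! p) * minor E (drop_nth p H)) = (0 :: mpoly)"
proof -
  have len: "length H = Suc n" by (rule strict_length[OF H])
  have "minor (\<lambda>r q. if q = 0 then F' r else E r (q - 1)) H = 0"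
    by (rule minor_equal_cols[of 0 _ "Suc a"]) (use a len E in auto)
  then show ?thesis by (simp only: minor_first_col[OF len])
qed

lemma syz_value_syz:
  assumes "H \<in> strict_lists m (Suc n)" "a < n"
  shows "syz_value (syz (H, a)) = 0"
  unfolding syz_value_def sum_syz[OF assms(1)] by (rule repeated_col[OF assms refl])

text \<open>The same column is repeated in the full matrix \<open>F\<close>. Compared with
  \<open>F0\<close>, its entries add constants, which contribute only constant multiples of
  minors.\<close>

lemma syz_lift:
  assumes H: "H \<in> strict_lists m (Suc n)" and a: "a < n"
  shows "(\<Sum>(J, l)\<in>S \<times> {..<k}. mconst (syz (H, a) (J, l)) * (mvar l * f J)) \<in> LS"
proof -
  have "0 = (\<Sum>p\<le>n. (-1) ^ p * F (H ! p) a * f (drop_nth p H))"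
    using repeated_col[of H a F "\<lambda>r. F r a"] H a by simp
  also have "\<dots> = (\<Sum>p\<le>n. mconst ((-1) ^ p * A $$ (H ! p, a)) * f (drop_nth p H))
      + (\<Sum>p\<le>n. (-1) ^ p * F0 (H ! p) a * f (drop_nth p H))"
    by (simp add: F_eq algebra_simps sum.distrib mconst_mult mconst_sign)
  finally have "(\<Sum>p\<le>n. (-1) ^ p * F0 (H ! p) a * f (drop_nth p H))
      = - (\<Sum>p\<le>n. mconst ((-1) ^ p * A $$ (H ! p, a)) * f (drop_nth p H))"
    by (simp add: eq_neg_iff_add_eq_0 add.commute)
  also have "\<dots> \<in> LS"
    by (intro LS_closed f_LS drop_nth_strict[OF H]) auto
  finally show ?thesis by (simp only: sum_syz[OF H])
qed

text \<open>
  Independence of the relations: pair them with the minors of the matrix in which column \<open>a0\<close> is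
  replaced by a unit vector; by alternation only the relations belonging to \<open>a0\<close> survive.
\<close>

lemma syz_independent:
  assumes c: "\<And>y. y \<in> S \<times> {..<k} \<Longrightarrow> (\<Sum>x\<in>strict_lists m (Suc n) \<times> {..<n}. c x * syz x y) = 0"
    and H0: "H0 \<in> strict_lists m (Suc n)" and a0: "a0 < n"
  shows "c (H0, a0) = 0"
proof -
  let ?X = "strict_lists m (Suc n) \<times> {..<n}"
  \<comment> \<open>The unit vector sits in the first row of \<open>H0\<close>, so the minor on the
    remaining rows of \<open>H0\<close> singles out the coefficient sought.\<close>
  define t where "t = H0 ! 0"
  define e where "e r = (if r = t then 1 else 0 :: mpoly)" for r
  define \<eta> where "\<eta> J = minor (replace_col F0 a0 e) J" for J
  have val: "(\<Sum>p\<le>n. (-1) ^ p * F0 (H ! p) a * \<eta> (drop_nth p H))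
      = (if a = a0 then - (\<Sum>p\<le>n. (-1) ^ p * e (H ! p) * f0 (drop_nth p H)) else 0)"
    if H: "H \<in> strict_lists m (Suc n)" and a: "a < n" for H a
  proof (cases "a = a0")
    case False
    then show ?thesis
      using repeated_col[OF H a, of "replace_col F0 a0 e" "\<lambda>r. F0 r a"] by (simp add: \<eta>_def replace_col_def)
  next
    case True
    let ?F' = "\<lambda>r q. F0 r (q - 1)"
    have len: "length H = Suc n" by (rule strict_length[OF H])
    have 1: "(\<lambda>r q. if q = 0 then F0 r a0 else replace_col F0 a0 e r (q - 1))
        = replace_col (replace_col ?F' 0 (\<lambda>r. F0 r a0)) (Suc a0) e"
      by (intro ext) (auto simp: replace_col_def)
    have 2: "replace_col (replace_col ?F' 0 e) (Suc a0) (\<lambda>r. F0 r a0)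
        = (\<lambda>r q. if q = 0 then e r else F0 r (q - 1))"
      by (intro ext) (auto simp: replace_col_def)
    have sw: "minor (replace_col (replace_col ?F' 0 (\<lambda>r. F0 r a0)) (Suc a0) e) H
        = - minor (replace_col (replace_col ?F' 0 e) (Suc a0) (\<lambda>r. F0 r a0)) H"
      by (rule minor_swap_cols) (use a0 len in auto)
    have 3: "(\<Sum>p\<le>n. (-1) ^ p * F0 (H ! p) a0 * \<eta> (drop_nth p H))
        = minor (\<lambda>r q. if q = 0 then F0 r a0 else replace_col F0 a0 e r (q - 1)) H"
      unfolding \<eta>_def by (rule minor_first_col[OF len, symmetric])
    have 4: "(\<Sum>p\<le>n. (-1) ^ p * e (H ! p) * f0 (drop_nth p H))
        = minor (\<lambda>r q. if q = 0 then e r else F0 r (q - 1)) H"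
      by (rule minor_first_col[OF len, symmetric])
    show ?thesis
      unfolding True 3 4 1 2[symmetric] sw by simp
  qed
  have "(\<Sum>y\<in>S \<times> {..<k}. mconst (\<Sum>x\<in>?X. c x * syz x y) * (mvar (snd y) * \<eta> (fst y))) = 0"
    by (rule sum.neutral, rule ballI) (simp only: c mconst_0 mult_zero_left)
  then have "0 = (\<Sum>y\<in>S \<times> {..<k}. mconst (\<Sum>x\<in>?X. c x * syz x y) * (mvar (snd y) * \<eta> (fst y)))"
    by simp
  also have "\<dots> = (\<Sum>x\<in>?X. mconst (c x) * (\<Sum>y\<in>S \<times> {..<k}. mconst (syz x y) * (mvar (snd y) * \<eta> (fst y))))"
    by (rule lincomb_swap)
  also have "\<dots> = (\<Sum>(H, a)\<in>?X. if a = a0 then - (mconst (c (H, a0)) * (\<Sum>p\<le>n. (-1) ^ p * e (H ! p) * f0 (drop_nth p H))) else 0)"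
  proof (rule sum.cong[OF refl], clarify)
    fix H a assume H: "H \<in> strict_lists m (Suc n)" and a: "a < n"
    show "mconst (c (H, a)) * (\<Sum>y\<in>S \<times> {..<k}. mconst (syz (H, a) y) * (mvar (snd y) * \<eta> (fst y)))
        = (if a = a0 then - (mconst (c (H, a0)) * (\<Sum>p\<le>n. (-1) ^ p * e (H ! p) * f0 (drop_nth p H))) else 0)"
      unfolding sum_syz_pair[OF H] val[OF H a] by simp
  qed
  also have "\<dots> = - (\<Sum>H\<in>strict_lists m (Suc n). mconst (c (H, a0)) * (\<Sum>p\<le>n. (-1) ^ p * e (H ! p) * f0 (drop_nth p H)))"
    using a0 by (simp add: sum_negf flip: sum.cartesian_product)
  finally have z: "(\<Sum>H\<in>strict_lists m (Suc n). mconst (c (H, a0)) * (\<Sum>p\<le>n. (-1) ^ p * e (H ! p) * f0 (drop_nth p H))) = 0"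
    by simp
  let ?Z = "strict_lists m (Suc n) \<times> {..n}"
  \<comment> \<open>Collects the terms in which row \<open>t\<close> has been deleted and the rows
    \<open>J\<close> remain, which turns the relation into one between the leading forms.\<close>
  define d where "d J = (\<Sum>x | x \<in> ?Z \<and> drop_nth (snd x) (fst x) = J.
    if fst x ! snd x = t then (-1) ^ snd x * c (fst x, a0) else 0)" for J
  have "(\<Sum>J\<in>S. mconst (d J) * f0 J) = (\<Sum>J\<in>S. \<Sum>x | x \<in> ?Z \<and> drop_nth (snd x) (fst x) = J.
      mconst (c (fst x, a0)) * ((-1) ^ snd x * e (fst x ! snd x) * f0 (drop_nth (snd x) (fst x))))"
    unfolding d_def mconst_sum sum_distrib_right
    by (intro sum.cong refl) (auto simp: e_def mconst_mult mconst_sign)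
  also have "\<dots> = (\<Sum>x\<in>?Z. mconst (c (fst x, a0)) * ((-1) ^ snd x * e (fst x ! snd x) * f0 (drop_nth (snd x) (fst x))))"
    by (rule sum.group) (auto intro: drop_nth_strict)
  also have "\<dots> = 0"
    using z by (simp add: sum_distrib_left sum.cartesian_product case_prod_beta)
  finally have "d J = 0" if "J \<in> S" for J
    using regular_indep that by blast
  then have "d (drop_nth 0 H0) = 0" using drop_nth_strict[OF H0, of 0] by simp
  moreover have "d (drop_nth 0 H0) = c (H0, a0)"
  proof -
    have cons: "H0 = t # drop_nth 0 H0"
      using strict_length[OF H0] by (cases H0) (auto simp: t_def drop_nth_def)
    \<comment> \<open>The deleted row \<open>t\<close> and the remaining rows determine the set of
      rows, hence the increasing list.\<close>
    have "fst x = H0 \<and> snd x = 0" if x: "x \<in> ?Z" "drop_nth (snd x) (fst x) = drop_nth 0 H0" "fst x ! snd x = t" for x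
    proof -
      obtain H p where Hp: "x = (H, p)" by (cases x)
      have H: "H \<in> strict_lists m (Suc n)" and p: "p < length H"
        using x(1) strict_length[of H m "Suc n"] by (auto simp: Hp)
      have "H = take p H @ H ! p # drop (Suc p) H" using p by (rule id_take_nth_drop)
      then have "set H = insert (H ! p) (set (drop_nth p H))"
        unfolding drop_nth_def by (metis Un_insert_right list.simps(15) set_append)
      also have "\<dots> = set H0" using x cons by (metis Hp fst_conv snd_conv list.simps(15))
      finally have "H = H0"
        using H H0 by (auto simp: strict_lists_def strict_sorted_equal)
      moreover from this have "p = 0"
        using x(3) p H0 strict_length[OF H0] nth_eq_iff_index_eq[of H0 p 0]
        by (auto simp: Hp t_def strict_lists_def strict_sorted_iff)
      ultimately show ?thesis by (simp add: Hp)
    qed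
    then have "d (drop_nth 0 H0) = (\<Sum>x\<in>{(H0, 0)}. if fst x ! snd x = t then (-1) ^ snd x * c (fst x, a0) else 0)"
      unfolding d_def by (intro sum.mono_neutral_right) (use H0 in auto)
    then show ?thesis by (simp add: t_def)
  qed
  ultimately show ?thesis by simp
qed

text \<open>The dimension count for degree \<open>n + 1\<close>: linear multiples of the leading
  forms on the right; on the left the relations \<open>syz\<close> and the monomials of that
  degree.\<close>

lemma card_syzygies:
  "n * (m choose Suc n) + ((k + Suc n - 1) choose Suc n) = (m choose n) * k"
proof -
  have "Suc n * (m choose Suc n) = (m - n) * (m choose n)"
    by (simp only: binomial_absorption binomial_absorb_comp)
  moreover have "k + Suc n - 1 = Suc m" "m - n = k - 1" using n k by auto
  ultimately show ?thesis using k by (cases k) (simp_all add: algebra_simps)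
qed

text \<open>One variable is split off, and the remaining monomial of degree \<open>n\<close> is a
  combination of leading forms. These preimages complement the relations in the count.\<close>

lemma section_exists:
  assumes "\<mu> \<in> monoms_deg k {Suc n}"
  shows "\<exists>s. syz_value s = mmonom \<mu>"
proof -
  obtain i \<mu>' where i: "i < k" "\<mu>' \<in> monoms_deg k {n}" "\<mu> = Poly_Mapping.single i 1 + \<mu>'"
    using monoms_split[OF assms] by blast
  obtain c where c: "mmonom \<mu>' = (\<Sum>J\<in>S. mconst (c J) * f0 J)"
    using regular_span[OF supported_single[OF i(2)]] by blast
  have "syz_value (\<lambda>(J, l). if l = i then c J else 0)
      = (\<Sum>J\<in>S. \<Sum>l<k. if l = i then mconst (c J) * (mvar i * f0 J) else 0)"
    unfolding syz_value_def sum.cartesian_product[symmetric] by (intro sum.cong refl) auto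
  also have "\<dots> = mvar i * mmonom \<mu>'"
    using i(1) by (simp add: c sum_distrib_left mult.left_commute)
  finally show ?thesis using i(3) mvar_mmonom by metis
qed

text \<open>Every linear syzygy of the leading forms comes from the relations above, by counting.\<close>

lemma linear_syzygy_lift:
  assumes s: "syz_value s = 0"
  shows "(\<Sum>(J, l)\<in>S \<times> {..<k}. mconst (s (J, l)) * (mvar l * f J)) \<in> LS"
proof -
  let ?X1 = "strict_lists m (Suc n) \<times> {..<n}" and ?X2 = "monoms_deg k {Suc n}" and ?Y = "S \<times> {..<k}"
  \<comment> \<open>Relations together with one preimage per monomial are independent and as
    numerous as the coordinates, so they represent every \<open>s\<close>. If \<open>s\<close> has
    value 0, the monomials force the coefficients of the preimages to vanish.\<close>
  let ?X = "?X1 <+> ?X2"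
  obtain T where T: "syz_value (T \<mu>) = mmonom \<mu>" if "\<mu> \<in> ?X2" for \<mu>
    using section_exists by metis
  define M where "M x = (case x of Inl u \<Rightarrow> syz u | Inr \<mu> \<Rightarrow> T \<mu>)" for x
  have "finite ?X1" "finite ?X2" by auto
  note split = sum.Plus[OF this, unfolded comp_def]
  have val: "syz_value s' = (\<Sum>\<mu>\<in>?X2. mconst (c (Inr \<mu>)) * mmonom \<mu>)"
    if "\<And>y. y \<in> ?Y \<Longrightarrow> s' y = (\<Sum>x\<in>?X. c x * M x y)" for s' c
  proof -
    have "syz_value s' = (\<Sum>x\<in>?X. mconst (c x) * syz_value (M x))"
      by (rule syz_value_lincomb) (rule that)
    also have "\<dots> = (\<Sum>\<mu>\<in>?X2. mconst (c (Inr \<mu>)) * mmonom \<mu>)"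
      unfolding split by (simp add: M_def T) (rule sum.neutral, auto simp: syz_value_syz)
    finally show ?thesis .
  qed
  have zero: "c (Inr \<mu>) = 0" if "(\<Sum>\<mu>\<in>?X2. mconst (c (Inr \<mu>)) * mmonom \<mu>) = 0" "\<mu> \<in> ?X2" for c :: "_ \<Rightarrow> complex" and \<mu>
  proof -
    have "0 = mcoeff (\<Sum>\<mu>\<in>?X2. mconst (c (Inr \<mu>)) * mmonom \<mu>) \<mu>" using that(1) by simp
    also have "\<dots> = (\<Sum>\<nu>\<in>?X2. if \<nu> = \<mu> then c (Inr \<nu>) else 0)"
      unfolding lookup_sum by (intro sum.cong) (auto simp: lookup_single)
    finally show ?thesis using that(2) by simp
  qed
  have "\<exists>c. \<forall>y\<in>?Y. (\<Sum>x\<in>?X. c x * M x y) = s y"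
  proof (rule square_span)
    show "finite ?X" "finite ?Y" by auto
    show "card ?X = card ?Y"
      using card_syzygies by (simp add: card_Plus card_strict_lists card_monoms_homog mult.commute)
    fix c assume c: "\<And>y. y \<in> ?Y \<Longrightarrow> (\<Sum>x\<in>?X. c x * M x y) = 0"
    have "syz_value (\<lambda>_. 0) = (\<Sum>\<mu>\<in>?X2. mconst (c (Inr \<mu>)) * mmonom \<mu>)"
      by (rule val) (use c in simp)
    then have "(\<Sum>\<mu>\<in>?X2. mconst (c (Inr \<mu>)) * mmonom \<mu>) = 0" by (simp add: syz_value_def)
    note c2 = zero[OF this]
    have "(\<Sum>u\<in>?X1. c (Inl u) * syz u y) = 0" if "y \<in> ?Y" for y
      using c[OF that] unfolding split by (simp add: c2 M_def)
    then have "c (Inl (H, a)) = 0" if "H \<in> strict_lists m (Suc n)" "a < n" for H a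
      using syz_independent[of "\<lambda>u. c (Inl u)"] that by blast
    with c2 show "\<forall>x\<in>?X. c x = 0" by auto
  qed
  then obtain c where c: "\<forall>y\<in>?Y. (\<Sum>x\<in>?X. c x * M x y) = s y" by blast
  have "syz_value s = (\<Sum>\<mu>\<in>?X2. mconst (c (Inr \<mu>)) * mmonom \<mu>)"
    by (rule val) (rule c[rule_format, symmetric])
  then have "(\<Sum>\<mu>\<in>?X2. mconst (c (Inr \<mu>)) * mmonom \<mu>) = 0" by (simp only: s)
  note c2 = zero[OF this]
  have "s y = (\<Sum>u\<in>?X1. c (Inl u) * syz u y)" if "y \<in> ?Y" for y
    using bspec[OF c that] unfolding split by (simp add: c2 M_def)
  then have "(\<Sum>y\<in>?Y. mconst (s y) * (mvar (snd y) * f (fst y)))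
      = (\<Sum>y\<in>?Y. mconst (\<Sum>u\<in>?X1. c (Inl u) * syz u y) * (mvar (snd y) * f (fst y)))"
    by (intro sum.cong refl) simp
  also have "\<dots> = (\<Sum>u\<in>?X1. mconst (c (Inl u)) * (\<Sum>y\<in>?Y. mconst (syz u y) * (mvar (snd y) * f (fst y))))"
    by (rule lincomb_swap)
  also have "\<dots> \<in> LS"
  proof -
    have "(\<Sum>y\<in>?Y. mconst (syz u y) * (mvar (snd y) * f (fst y))) \<in> LS" if "u \<in> ?X1" for u
      using syz_lift[of "fst u" "snd u"] that by (simp add: case_prod_beta mem_Times_iff)
    then have "mconst (c (Inl u)) * (\<Sum>y\<in>?Y. mconst (syz u y) * (mvar (snd y) * f (fst y))) \<in> LS"
      if "u \<in> ?X1" for u using that by (simp only: LS_closed(4))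
    then show ?thesis by (rule LS_closed(5))
  qed
  finally show ?thesis by (simp add: case_prod_beta)
qed

section \<open>Commuting multiplication operators and normal forms\<close>

definition X :: "nat \<Rightarrow> mpoly \<Rightarrow> mpoly" where
  "X i p = red (mvar i * p)"

lemma X_deglt: "i < k \<Longrightarrow> p \<in> deglt k n \<Longrightarrow> X i p \<in> deglt k n"
  unfolding X_def by (intro red_deglt mvar_mult_deglt)

text \<open>The criterion familiar from border bases. The two unreduced products differ by
  \<open>\<Delta>\<close>, a combination of the minors with linear coefficients that nevertheless
  has degree at most \<open>n\<close>. Its part of degree \<open>n + 1\<close> therefore cancels,
  which is a linear syzygy of the leading forms; it lifts, so \<open>\<Delta>\<close> lies in
  \<open>LS\<close> and reduces to 0.\<close>

lemma X_commute:
  assumes i: "i < k" and j: "j < k" and p: "p \<in> deglt k n"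
  shows "X i (X j p) = X j (X i p)"
proof -
  have "mvar i * p - X i p \<in> LS" "mvar j * p - X j p \<in> LS"
    unfolding X_def using i j p by (auto intro!: red_diff mvar_mult_deglt)
  then obtain ci cj where ci: "mvar i * p - X i p = (\<Sum>J\<in>S. mconst (ci J) * f J)"
    and cj: "mvar j * p - X j p = (\<Sum>J\<in>S. mconst (cj J) * f J)"
    by (auto simp: LS_def)
  define \<Delta> where "\<Delta> = mvar i * X j p - mvar j * X i p"
  define s where "s = (\<lambda>(J, l). (if l = j then ci J else 0) - (if l = i then cj J else 0))"
  have comb: "(\<Sum>(J, l)\<in>S \<times> {..<k}. mconst (s (J, l)) * (mvar l * h J))
      = (\<Sum>J\<in>S. mconst (ci J) * (mvar j * h J)) - (\<Sum>J\<in>S. mconst (cj J) * (mvar i * h J))" for h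
  proof -
    have "(\<Sum>l<k. mconst (s (J, l)) * (mvar l * h J))
        = (\<Sum>l<k. if l = j then mconst (ci J) * (mvar j * h J) else 0)
          - (\<Sum>l<k. if l = i then mconst (cj J) * (mvar i * h J) else 0)" for J
      unfolding sum_subtractf[symmetric]
      by (intro sum.cong refl) (auto simp: s_def mconst_diff mconst_uminus algebra_simps)
    then show ?thesis
      using i j by (simp add: sum_subtractf flip: sum.cartesian_product)
  qed
  have \<Delta>: "\<Delta> = (\<Sum>(J, l)\<in>S \<times> {..<k}. mconst (s (J, l)) * (mvar l * f J))"
  proof -
    have "\<Delta> = mvar j * (mvar i * p - X i p) - mvar i * (mvar j * p - X j p)"
      by (simp add: \<Delta>_def algebra_simps)
    then show ?thesis
      unfolding comb ci cj sum_distrib_left by (simp add: mult.left_commute)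
  qed
  have \<Delta>_deg: "\<Delta> \<in> degle k n"
    unfolding \<Delta>_def using i j p by (intro supported_diff mvar_mult_deglt X_deglt)
  have "syz_value s = 0"
  proof (rule homog_deglt_0)
    show "syz_value s \<in> homog k (Suc n)"
      unfolding syz_value_def case_prod_beta
      using homog_mult[OF mvar_homog f0_homog] by (intro supported_sum supported_scale) auto
    have "mvar l * (f J - f0 J) \<in> degle k n" if "J \<in> S" "l < k" for J l
      using mvar_mult_deglt[OF that(2) f_lead[OF that(1)]] .
    then have "\<Delta> - syz_value s \<in> degle k n"
      unfolding \<Delta> syz_value_def case_prod_beta sum_subtractf[symmetric] right_diff_distrib[symmetric]
      by (intro supported_sum supported_scale) auto
    from supported_diff[OF \<Delta>_deg this] show "syz_value s \<in> deglt k (Suc n)"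
      by (simp add: deglt_Suc)
  qed
  then have "red \<Delta> = 0"
    unfolding \<Delta> by (intro red_LS linear_syzygy_lift)
  moreover have "mvar i * X j p = mvar j * X i p + \<Delta>" by (simp add: \<Delta>_def)
  ultimately show ?thesis
    using red_add[OF mvar_mult_deglt[OF j X_deglt[OF i p]] \<Delta>_deg] by (simp add: X_def[of i "X j p"] X_def[of j "X i p"])
qed

text \<open>Made total by the value 0, so that commutation holds on the whole type, as folding over
  a multiset requires.\<close>

definition X' :: "nat \<Rightarrow> mpoly \<Rightarrow> mpoly" where
  "X' i p = (if i < k \<and> p \<in> deglt k n then X i p else 0)"

lemma X_0 [simp]: "X i 0 = 0"
  by (simp add: X_def red_id)

interpretation X': comp_fun_commute X'
proof
  fix i j
  show "X' j \<circ> X' i = X' i \<circ> X' j"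
    by (rule ext) (auto simp: X'_def X_deglt X_commute)
qed

text \<open>One operator for each variable of the monomial, applied to \<open>1\<close>; commutation
  removes the dependence on the order.\<close>

definition nf :: "(nat \<Rightarrow>\<^sub>0 nat) \<Rightarrow> mpoly" where
  "nf \<mu> = fold_mset X' 1 (monom_mset \<mu>)"

lemma one_deglt: "1 \<in> deglt k n"
  using n supported_single[of 0 "monoms_deg k {..<n}" 1] by (simp add: monoms_deg_def)

lemma nf_0: "nf 0 = 1"
proof -
  have "monom_mset 0 = {#}" by (rule multiset_eqI) (simp add: count_monom_mset)
  then show ?thesis by (simp add: nf_def)
qed

lemma nf_add: "nf (Poly_Mapping.single i 1 + \<mu>) = X' i (nf \<mu>)"
proof -
  have "monom_mset (Poly_Mapping.single i 1 + \<mu>) = add_mset i (monom_mset \<mu>)"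
    by (rule multiset_eqI) (simp add: count_monom_mset lookup_add lookup_single when_def)
  then show ?thesis by (simp add: nf_def)
qed

lemma nf_deglt: "nf \<mu> \<in> deglt k n"
  by (induct \<mu> rule: monom_induct) (auto simp: nf_0 nf_add one_deglt X'_def X_deglt simp del: One_nat_def)

lemma nf_var: "i < k \<Longrightarrow> nf (Poly_Mapping.single i 1 + \<mu>) = X i (nf \<mu>)"
  using nf_deglt by (simp add: nf_add X'_def del: One_nat_def)

lemma nf_red: "\<mu> \<in> monoms_deg k {..n} \<Longrightarrow> nf \<mu> = red (mmonom \<mu>)"
proof (induct \<mu> rule: monom_induct)
  case zero
  then show ?case using one_deglt by (simp add: nf_0 red_id)
next
  case (add i \<mu>)
  then have i: "i < k" and \<mu>: "\<mu> \<in> monoms_deg k {..<n}"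
    by (auto simp: monoms_deg_def monoms_def keys_add_nat)
  then have "\<mu> \<in> monoms_deg k {..n}" by (auto simp: monoms_deg_def)
  then have "nf \<mu> = mmonom \<mu>"
    using add(1) red_id[OF supported_single[OF \<mu>]] by simp
  then show ?case by (simp only: nf_var[OF i] X_def mvar_mmonom)
qed

definition NF :: "mpoly \<Rightarrow> mpoly" where
  "NF p = (\<Sum>\<mu>\<in>Poly_Mapping.keys p. mconst (mcoeff p \<mu>) * nf \<mu>)"

lemma NF_superset:
  assumes "finite T" "Poly_Mapping.keys p \<subseteq> T"
  shows "NF p = (\<Sum>\<mu>\<in>T. mconst (mcoeff p \<mu>) * nf \<mu>)"
  unfolding NF_def by (rule sum.mono_neutral_left) (use assms in \<open>auto simp: in_keys_iff\<close>)

lemma NF_add: "NF (p + q) = NF p + NF q"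
proof -
  let ?T = "Poly_Mapping.keys p \<union> Poly_Mapping.keys q"
  show ?thesis
    using Poly_Mapping.keys_add[of p q]
    by (simp add: NF_superset[of ?T] lookup_add mconst_add sum.distrib algebra_simps)
qed

lemma NF_single: "NF (Poly_Mapping.single \<mu> c) = mconst c * nf \<mu>"
  by (subst NF_superset[of "{\<mu>}"]) auto

lemma NF_scale: "NF (mconst c * p) = mconst c * NF p"
proof (induct p rule: mpoly_induct)
  case (single \<mu> d)
  show ?case by (simp only: mconst_single NF_single mconst_mult mult.assoc)
qed (simp only: distrib_left NF_add)

lemma NF_0 [simp]: "NF 0 = 0"
  by (simp add: NF_def)

lemma NF_diff: "NF (p - q) = NF p - NF q"
proof -
  have "p - q = p + mconst (- 1) * q" by (simp add: mconst_uminus)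
  then show ?thesis by (simp only: NF_add NF_scale) (simp add: mconst_uminus)
qed

lemma NF_sum: "NF (sum g T) = (\<Sum>x\<in>T. NF (g x))"
  by (induct T rule: infinite_finite_induct) (simp_all add: NF_add)

lemma NF_deglt: "NF p \<in> deglt k n"
  unfolding NF_def by (intro supported_sum supported_scale nf_deglt)

text \<open>Because multiplication by a variable is carried to \<open>X i\<close>, the kernel of
  \<open>NF\<close> is closed under multiplication by polynomials and contains the ideal as soon as
  it contains the minors.\<close>

lemma NF_mvar:
  assumes i: "i < k"
  shows "NF (mvar i * p) = X i (NF p)"
proof (induct p rule: mpoly_induct)
  case (single \<mu> c)
  have "mvar i * Poly_Mapping.single \<mu> c = Poly_Mapping.single (Poly_Mapping.single i 1 + \<mu>) c"
    by (simp add: mvar_def mult_single)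
  then have "NF (mvar i * Poly_Mapping.single \<mu> c) = mconst c * X i (nf \<mu>)"
    by (simp only: NF_single nf_var[OF i])
  also have "\<dots> = X i (mconst c * nf \<mu>)"
    unfolding X_def mult.left_commute[of "mvar i"]
    by (rule red_scale[symmetric]) (rule mvar_mult_deglt[OF i nf_deglt])
  finally show ?case by (simp only: NF_single)
next
  case (add p q)
  then show ?case
    by (simp add: distrib_left NF_add X_def red_add mvar_mult_deglt[OF i NF_deglt])
qed

lemma NF_red:
  assumes "p \<in> degle k n"
  shows "NF p = red p"
proof -
  have fin: "finite (monoms_deg k {..n})" using finite_monoms_lt[of k "Suc n"] by (simp add: lessThan_Suc_atMost)
  have keys: "Poly_Mapping.keys p \<subseteq> monoms_deg k {..n}" using assms by (simp add: supported_def)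
  have d: "mmonom \<mu> \<in> degle k n" if "\<mu> \<in> monoms_deg k {..n}" for \<mu>
    by (rule supported_single[OF that])
  have "NF p = (\<Sum>\<mu>\<in>monoms_deg k {..n}. red (mconst (mcoeff p \<mu>) * mmonom \<mu>))"
    unfolding NF_superset[OF fin keys] by (intro sum.cong refl) (simp add: nf_red red_scale d)
  also have "\<dots> = red p"
    using d by (subst (2) mpoly_expand[OF fin keys]) (simp add: red_sum supported_scale)
  finally show ?thesis .
qed

lemma NF_id: "p \<in> deglt k n \<Longrightarrow> NF p = p"
  by (simp add: NF_red deglt_degle red_id)

section \<open>The ideal of maximal minors as the kernel of the normal form\<close>

definition I :: "mpoly set" where
  "I = {p. \<exists>g. (\<forall>J. g J \<in> polys k) \<and> p = (\<Sum>J\<in>S. g J * f J)}"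

lemma I_add: "p \<in> I \<Longrightarrow> q \<in> I \<Longrightarrow> p + q \<in> I"
proof -
  assume "p \<in> I" "q \<in> I"
  then obtain g h where g: "\<forall>J. g J \<in> polys k" "p = (\<Sum>J\<in>S. g J * f J)"
    and h: "\<forall>J. h J \<in> polys k" "q = (\<Sum>J\<in>S. h J * f J)" by (auto simp: I_def)
  then show ?thesis
    unfolding I_def by (auto intro!: exI[of _ "\<lambda>J. g J + h J"] polys_add simp: distrib_right sum.distrib)
qed

lemma I_mult: "q \<in> polys k \<Longrightarrow> p \<in> I \<Longrightarrow> q * p \<in> I"
proof -
  assume q: "q \<in> polys k" and "p \<in> I"
  then obtain g where g: "\<forall>J. g J \<in> polys k" "p = (\<Sum>J\<in>S. g J * f J)" by (auto simp: I_def)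
  then show ?thesis
    unfolding I_def using q
    by (auto intro!: exI[of _ "\<lambda>J. q * g J"] polys_mult simp: sum_distrib_left mult.assoc)
qed

lemma I_0: "0 \<in> I"
  unfolding I_def by (auto intro!: exI[of _ "\<lambda>_. 0"])

lemma I_uminus: "p \<in> I \<Longrightarrow> - p \<in> I"
  using I_mult[of "- 1" p] polys_uminus[OF polys_1, of k] by simp

lemma I_diff: "p \<in> I \<Longrightarrow> q \<in> I \<Longrightarrow> p - q \<in> I"
  using I_add[of p "- q"] I_uminus[of q] by simp

lemma I_sum: "(\<And>x. x \<in> T \<Longrightarrow> g x \<in> I) \<Longrightarrow> sum g T \<in> I"
  by (induct T rule: infinite_finite_induct) (simp_all add: I_0 I_add)

lemma LS_imp_I: "p \<in> LS \<Longrightarrow> p \<in> I"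
proof -
  assume "p \<in> LS"
  then obtain c where "p = (\<Sum>J\<in>S. mconst (c J) * f J)" by (auto simp: LS_def)
  then show ?thesis
    unfolding I_def by (auto intro!: exI[of _ "\<lambda>J. mconst (c J)"])
qed

lemma f_I: "J \<in> S \<Longrightarrow> f J \<in> I"
  by (intro LS_imp_I f_LS)

lemma I_polys: "p \<in> I \<Longrightarrow> p \<in> polys k"
  unfolding I_def by (auto intro!: polys_sum polys_mult degle_polys[OF f_degle])

lemma NF_mult_0:
  assumes "q \<in> polys k"
  shows "NF p = 0 \<Longrightarrow> NF (q * p) = 0"
  using assms
proof (induct q arbitrary: p rule: polys_induct)
  case (mult q1 q2)
  then show ?case by (simp add: mult.assoc)
qed (simp_all add: NF_scale NF_mvar NF_add distrib_right)

lemma NF_I: "p \<in> I \<Longrightarrow> NF p = 0"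
  unfolding I_def
  by (auto simp: NF_sum intro!: sum.neutral NF_mult_0) (simp add: NF_red f_degle red_LS f_LS)

lemma nf_diff_I: "\<mu> \<in> monoms k \<Longrightarrow> mmonom \<mu> - nf \<mu> \<in> I"
proof (induct \<mu> rule: monom_induct)
  case zero
  then show ?case by (simp add: nf_0 I_0)
next
  case (add i \<mu>)
  then have i: "i < k" and \<mu>: "\<mu> \<in> monoms k"
    by (auto simp: monoms_def keys_add_nat)
  have "mmonom (Poly_Mapping.single i 1 + \<mu>) - nf (Poly_Mapping.single i 1 + \<mu>)
      = mvar i * (mmonom \<mu> - nf \<mu>) + (mvar i * nf \<mu> - X i (nf \<mu>))"
    unfolding nf_var[OF i] mvar_mmonom[symmetric] by (simp add: algebra_simps)
  moreover have "mvar i * nf \<mu> - X i (nf \<mu>) \<in> I"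
    unfolding X_def by (intro LS_imp_I red_diff mvar_mult_deglt i nf_deglt)
  ultimately show ?case
    using I_add[OF I_mult[OF polys_mvar[OF i] add(1)[OF \<mu>]]] by simp
qed

lemma NF_diff_I:
  assumes "p \<in> polys k"
  shows "p - NF p \<in> I"
proof -
  have "p - NF p = (\<Sum>\<mu>\<in>Poly_Mapping.keys p. mconst (mcoeff p \<mu>) * (mmonom \<mu> - nf \<mu>))"
    unfolding NF_def right_diff_distrib sum_subtractf using mpoly_expand[of "Poly_Mapping.keys p" p] by simp
  also have "\<dots> \<in> I"
    using assms by (intro I_sum I_mult polys_mconst nf_diff_I) (auto simp: polys_eq supported_def)
  finally show ?thesis .
qed

text \<open>Together with \<open>NF_id\<close> this identifies \<open>polys k\<close> modulo
  \<open>I\<close> with \<open>deglt k n\<close>, a space of dimension \<open>N\<close>.\<close>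

lemma NF_eq_0_iff: "p \<in> polys k \<Longrightarrow> NF p = 0 \<longleftrightarrow> p \<in> I"
  using NF_I NF_diff_I[of p] by auto

end

section \<open>Univariate partitions of unity\<close>

lemma prod_dvd_if_coprime:
  fixes q :: "'a \<Rightarrow> complex poly"
  assumes "finite Z" "\<And>a. a \<in> Z \<Longrightarrow> q a dvd x" "\<And>a b. a \<in> Z \<Longrightarrow> b \<in> Z \<Longrightarrow> a \<noteq> b \<Longrightarrow> coprime (q a) (q b)"
  shows "prod q Z dvd x"
  using assms
proof (induct Z rule: finite_induct)
  case (insert a Z)
  have "coprime (q a) (prod q Z)"
    by (rule prod_coprime_right) (use insert in auto)
  then show ?case using insert by (simp add: divides_mult)
qed simp

lemma coprime_linear_powers:
  fixes a b :: complex
  assumes "a \<noteq> b"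
  shows "coprime ([:- a, 1:] ^ i) ([:- b, 1:] ^ j)"
proof -
  have "is_unit c" if "c dvd [:- a, 1:]" "c dvd [:- b, 1:]" for c :: "complex poly"
  proof -
    have "c dvd [:- a, 1:] - [:- b, 1:]" using that by (rule dvd_diff)
    then have "c dvd [:b - a:]" by simp
    moreover have "is_unit [:b - a:]" using assms by (simp add: is_unit_pCons_iff)
    ultimately show ?thesis using dvd_trans by blast
  qed
  then have "coprime [:- a, 1:] [:- b, 1:]" by (rule coprimeI)
  then show ?thesis by simp
qed

text \<open>Chinese remainder theorem for the powers of linear factors of \<open>g\<close>:
  \<open>u a\<close> is 1 modulo the power at \<open>a\<close> and 0 modulo the powers at the other
  roots. Divisibility by \<open>g\<close> can be tested on these coprime powers.\<close>

lemma univariate_partition: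
  fixes g :: "complex poly"
  assumes g: "g \<noteq> 0"
  defines "Z \<equiv> {a. poly g a = 0}"
  shows "\<exists>u e. (\<forall>a\<in>Z. poly (u a) a = 1 \<and> g dvd u a * [:- a, 1:] ^ e) \<and>
    (\<forall>a\<in>Z. \<forall>b\<in>Z. a \<noteq> b \<longrightarrow> g dvd u a * u b) \<and> g dvd (\<Sum>a\<in>Z. u a) - 1"
proof -
  define q where "q a = [:- a, 1:] ^ order a g" for a
  have fin: "finite Z" unfolding Z_def using poly_roots_finite[OF g] .
  have cop: "coprime (q a) (q b)" if "a \<noteq> b" for a b
    unfolding q_def using that by (rule coprime_linear_powers)
  have "g = smult (lead_coeff g) (prod q Z)"
    unfolding q_def Z_def by (rule complex_poly_decompose[symmetric])
  then have dvdI: "g dvd x" if "\<And>a. a \<in> Z \<Longrightarrow> q a dvd x" for x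
  proof -
    have "prod q Z dvd x" by (rule prod_dvd_if_coprime[OF fin that]) (use cop in auto)
    then have "smult (lead_coeff g) (prod q Z) dvd x" using g by (simp add: smult_dvd_iff)
    then show ?thesis using \<open>g = _\<close> by simp
  qed
  have "\<exists>u. q a dvd u - 1 \<and> (\<forall>b\<in>Z - {a}. q b dvd u)" for a
  proof -
    let ?h = "prod q (Z - {a})"
    have "coprime (q a) ?h"
      by (rule prod_coprime_right) (use cop in auto)
    then have "fst (bezout_coefficients (q a) ?h) * q a + snd (bezout_coefficients (q a) ?h) * ?h = 1"
      by (simp add: bezout_coefficients_fst_snd)
    then have "snd (bezout_coefficients (q a) ?h) * ?h - 1 = - fst (bezout_coefficients (q a) ?h) * q a"
      by (simp add: algebra_simps eq_neg_iff_add_eq_0)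
    moreover have "q b dvd ?h" if "b \<in> Z - {a}" for b
      using that fin by (intro dvd_prodI) auto
    ultimately show ?thesis
      by (intro exI[of _ "snd (bezout_coefficients (q a) ?h) * ?h"]) auto
  qed
  then obtain u where u1: "q a dvd u a - 1" and u0: "b \<in> Z \<Longrightarrow> b \<noteq> a \<Longrightarrow> q b dvd u a" for a b
    by (metis Diff_iff singletonD)
  have "poly (u a) a = 1" if "a \<in> Z" for a
  proof -
    have "order a g \<noteq> 0" using that g by (simp add: Z_def order_root)
    then have "[:- a, 1:] dvd u a - 1"
      using u1[of a] unfolding q_def by (meson dvd_power dvd_trans gr0I)
    then show ?thesis by (simp add: poly_eq_0_iff_dvd[symmetric])
  qed
  \<comment> \<open>The degree of \<open>g\<close> bounds the order at every root and thus serves as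
    a common exponent.\<close>
  moreover have "g dvd u a * [:- a, 1:] ^ degree g" if "a \<in> Z" for a
  proof (rule dvdI)
    fix b assume b: "b \<in> Z"
    show "q b dvd u a * [:- a, 1:] ^ degree g"
    proof (cases "b = a")
      case True
      have "q a dvd [:- a, 1:] ^ degree g"
        unfolding q_def by (rule le_imp_power_dvd) (rule order_degree[OF g])
      then show ?thesis using True by simp
    qed (use u0 b in auto)
  qed
  moreover have "g dvd u a * u b" if "a \<noteq> b" for a b
    by (rule dvdI) (metis dvd_mult dvd_mult2 that u0)
  moreover have "g dvd (\<Sum>a\<in>Z. u a) - 1"
  proof (rule dvdI)
    fix b assume b: "b \<in> Z"
    have eq: "(\<Sum>a\<in>Z. u a) - 1 = (u b - 1) + (\<Sum>a\<in>Z - {b}. u a)"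
      using fin b by (simp add: sum.remove)
    show "q b dvd (\<Sum>a\<in>Z. u a) - 1"
      unfolding eq by (intro dvd_add u1 dvd_sum) (use u0 b in auto)
  qed
  ultimately show ?thesis
    by (intro exI[of _ u] exI[of _ "degree g"]) auto
qed

section \<open>Univariate polynomials in one of the variables\<close>

definition upoly :: "nat \<Rightarrow> complex poly \<Rightarrow> mpoly" where
  "upoly i p = fold_coeffs (\<lambda>a b. mconst a + mvar i * b) p 0"

lemma upoly_0 [simp]: "upoly i 0 = 0"
  by (simp add: upoly_def)

lemma upoly_pCons [simp]: "upoly i (pCons a p) = mconst a + mvar i * upoly i p"
  by (cases "p = 0 \<and> a = 0") (auto simp: upoly_def)

lemma upoly_add: "upoly i (p + q) = upoly i p + upoly i q"
  by (induct p q rule: poly_induct2) (simp_all add: mconst_add algebra_simps)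

lemma upoly_smult: "upoly i (smult a q) = mconst a * upoly i q"
proof (induct q)
  case (pCons b q)
  then show ?case by (simp only: smult_pCons upoly_pCons mconst_mult distrib_left mult.left_commute[of "mvar i"])
qed simp

lemma upoly_mult: "upoly i (p * q) = upoly i p * upoly i q"
proof (induct p)
  case (pCons a p)
  then show ?case
    by (simp only: mult_pCons_left upoly_add upoly_smult upoly_pCons mconst_0 add_0_left distrib_right mult.assoc)
qed simp

lemma upoly_1 [simp]: "upoly i 1 = 1"
  by (simp add: one_pCons)

lemma upoly_diff: "upoly i (p - q) = upoly i p - upoly i q"
  using upoly_add[of i "p - q" q] by simp

lemma upoly_sum: "upoly i (sum h T) = (\<Sum>x\<in>T. upoly i (h x))"
  by (induct T rule: infinite_finite_induct) (simp_all add: upoly_add)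

lemma upoly_power: "upoly i (p ^ e) = upoly i p ^ e"
  by (induct e) (simp_all add: upoly_mult)

lemma upoly_monom: "upoly i (Polynomial.monom c j) = mconst c * mvar i ^ j"
proof (induct j)
  case (Suc j)
  then show ?case by (simp only: monom_Suc upoly_pCons mconst_0 add_0_left power_Suc mult.left_commute)
qed (simp add: monom_0)

lemma upoly_polys: "i < v \<Longrightarrow> upoly i p \<in> polys v"
  by (induct p) (auto intro!: polys_add polys_mult)

lemma meval_upoly: "meval (upoly i p) x = poly p (x $ i)"
  by (induct p) (simp_all add: meval_add meval_mult)

lemma polys_of_nat [simp]: "of_nat c \<in> polys v"
  by (metis of_int_of_nat_eq polys_of_int)

section \<open>Splitting the quotient ring\<close>

context rmep_regular
begin

lemma NF_mult_NF: "p \<in> polys k \<Longrightarrow> q \<in> polys k \<Longrightarrow> NF (q * NF p) = NF (q * p)"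
  using NF_I[OF I_mult[OF _ NF_diff_I], of q p] by (simp add: right_diff_distrib NF_diff)

lemma NF_polys [simp]: "NF p \<in> polys k"
  by (rule deglt_polys[OF NF_deglt])

lemma mpoly_eqI_deglt:
  "p \<in> deglt k n \<Longrightarrow> q \<in> deglt k n \<Longrightarrow> (\<And>\<mu>. \<mu> \<in> monoms_deg k {..<n} \<Longrightarrow> mcoeff p \<mu> = mcoeff q \<mu>) \<Longrightarrow> p = q"
  by (rule poly_mapping_eqI) (metis supportedD)

text \<open>The normal forms of the \<open>N + 1\<close> powers of a variable lie in a space of
  dimension \<open>N\<close>.\<close>

lemma annihilator_exists:
  assumes i: "i < k"
  shows "\<exists>g. g \<noteq> 0 \<and> upoly i g \<in> I"
proof -
  let ?Y = "monoms_deg k {..<n}"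
  have "card ?Y < card {..N}" using card_monoms_lt[of k n] k n by simp
  then obtain c where c: "\<exists>j\<in>{..N}. c j \<noteq> 0"
    and z: "\<forall>\<mu>\<in>?Y. (\<Sum>j\<le>N. c j * mcoeff (NF (mvar i ^ j)) \<mu>) = 0"
    using exists_dependency[of "{..N}" ?Y "\<lambda>j \<mu>. mcoeff (NF (mvar i ^ j)) \<mu>"] by auto
  define g where "g = (\<Sum>j\<le>N. Polynomial.monom (c j) j)"
  have ug: "upoly i g = (\<Sum>j\<le>N. mconst (c j) * mvar i ^ j)"
    by (simp add: g_def upoly_sum upoly_monom)
  have "NF (upoly i g) = 0"
  proof (rule mpoly_eqI_deglt[OF NF_deglt supported_0])
    fix \<mu> assume "\<mu> \<in> ?Y"
    then show "mcoeff (NF (upoly i g)) \<mu> = mcoeff 0 \<mu>"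
      using z by (simp add: ug NF_sum NF_scale lookup_sum)
  qed
  then have "upoly i g \<in> I" using NF_eq_0_iff upoly_polys[OF i] by blast
  moreover have "Polynomial.coeff g j = c j" if "j \<le> N" for j
    using that by (simp add: g_def coeff_sum if_distrib sum.delta cong: if_cong)
  then have "g \<noteq> 0" using c by (metis atMost_iff coeff_0)
  ultimately show ?thesis by blast
qed

definition ann :: "nat \<Rightarrow> complex poly" where
  "ann i = (SOME g. g \<noteq> 0 \<and> upoly i g \<in> I)"

lemma ann: "i < k \<Longrightarrow> ann i \<noteq> 0" "i < k \<Longrightarrow> upoly i (ann i) \<in> I"
  using someI_ex[OF annihilator_exists] by (auto simp: ann_def)

definition roots :: "nat \<Rightarrow> complex set" where
  "roots i = {a. poly (ann i) a = 0}"

lemma finite_roots: "i < k \<Longrightarrow> finite (roots i)"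
  unfolding roots_def by (rule poly_roots_finite) (rule ann)

lemma ann_dvd_I: "i < k \<Longrightarrow> ann i dvd p \<Longrightarrow> upoly i p \<in> I"
  by (auto elim!: dvdE simp: upoly_mult mult.commute intro!: I_mult upoly_polys ann)

definition part :: "nat \<Rightarrow> complex \<Rightarrow> complex poly" where
  "part i = (SOME u. \<exists>e. (\<forall>a\<in>roots i. poly (u a) a = 1 \<and> ann i dvd u a * [:- a, 1:] ^ e) \<and>
    (\<forall>a\<in>roots i. \<forall>b\<in>roots i. a \<noteq> b \<longrightarrow> ann i dvd u a * u b) \<and> ann i dvd (\<Sum>a\<in>roots i. u a) - 1)"

lemma part:
  assumes i: "i < k"
  shows "a \<in> roots i \<Longrightarrow> poly (part i a) a = 1"
    and "a \<in> roots i \<Longrightarrow> \<exists>e. upoly i (part i a * [:- a, 1:] ^ e) \<in> I"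
    and "a \<in> roots i \<Longrightarrow> b \<in> roots i \<Longrightarrow> a \<noteq> b \<Longrightarrow> upoly i (part i a * part i b) \<in> I"
    and "upoly i ((\<Sum>a\<in>roots i. part i a) - 1) \<in> I"
proof -
  have "\<exists>e. (\<forall>a\<in>roots i. poly (part i a) a = 1 \<and> ann i dvd part i a * [:- a, 1:] ^ e) \<and>
    (\<forall>a\<in>roots i. \<forall>b\<in>roots i. a \<noteq> b \<longrightarrow> ann i dvd part i a * part i b) \<and> ann i dvd (\<Sum>a\<in>roots i. part i a) - 1"
    using someI_ex[OF univariate_partition[OF ann(1)[OF i], folded roots_def]]
    unfolding part_def[symmetric] .
  then show "a \<in> roots i \<Longrightarrow> poly (part i a) a = 1"
    "a \<in> roots i \<Longrightarrow> \<exists>e. upoly i (part i a * [:- a, 1:] ^ e) \<in> I"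
    "a \<in> roots i \<Longrightarrow> b \<in> roots i \<Longrightarrow> a \<noteq> b \<Longrightarrow> upoly i (part i a * part i b) \<in> I"
    "upoly i ((\<Sum>a\<in>roots i. part i a) - 1) \<in> I"
    by (metis ann_dvd_I[OF i])+
qed

text \<open>A finite set of candidates containing all common zeros of the minors. It may contain
  further points; their components turn out to be trivial in \<open>basis_empty\<close>.
  Extensionality of \<open>PiE\<close> makes such a function determined by its point.\<close>

definition grid :: "(nat \<Rightarrow> complex) set" where
  "grid = PiE {..<k} roots"

lemma finite_grid: "finite grid"
  unfolding grid_def by (rule finite_PiE) (auto intro: finite_roots)

lemma grid_roots: "\<phi> \<in> grid \<Longrightarrow> i < k \<Longrightarrow> \<phi> i \<in> roots i"
  by (auto simp: grid_def)

text \<open>A product of univariate idempotents, one per coordinate; modulo \<open>I\<close> it is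
  the projection to the part of the quotient supported at \<open>\<phi>\<close>.\<close>

definition idem :: "(nat \<Rightarrow> complex) \<Rightarrow> mpoly" where
  "idem \<phi> = (\<Prod>i<k. upoly i (part i (\<phi> i)))"

lemma idem_polys [simp]: "idem \<phi> \<in> polys k"
  unfolding idem_def by (intro polys_prod upoly_polys) auto

lemma idem_factor: "i < k \<Longrightarrow> \<exists>r\<in>polys k. idem \<phi> = r * upoly i (part i (\<phi> i))"
  unfolding idem_def
  by (subst prod.remove[of _ i]) (auto simp: mult.commute intro!: polys_prod upoly_polys bexI[of _ "\<Prod>i\<in>{..<k} - {i}. upoly i (part i (\<phi> i))"])

text \<open>The partitions of unity of the coordinates are multiplied together and expanded.\<close>

lemma idem_sum: "(\<Sum>\<phi>\<in>grid. idem \<phi>) - 1 \<in> I"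
proof -
  have "(\<Sum>\<phi>\<in>grid. idem \<phi>) = (\<Prod>i<k. \<Sum>a\<in>roots i. upoly i (part i a))"
    unfolding idem_def grid_def by (rule prod_sum_PiE[symmetric]) (auto intro: finite_roots)
  also have "\<dots> - 1 \<in> I"
  proof -
    have "(\<Prod>i\<in>T. \<Sum>a\<in>roots i. upoly i (part i a)) - 1 \<in> I \<and> (\<Prod>i\<in>T. \<Sum>a\<in>roots i. upoly i (part i a)) \<in> polys k"
      if "finite T" "T \<subseteq> {..<k}" for T
      using that
    proof (induct T rule: finite_induct)
      case (insert i T)
      let ?s = "\<Sum>a\<in>roots i. upoly i (part i a)" and ?P = "\<Prod>i\<in>T. \<Sum>a\<in>roots i. upoly i (part i a)"
      have i: "i < k" using insert by auto
      have s: "?s - 1 \<in> I" using part(4)[OF i] by (simp add: upoly_diff upoly_sum)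
      have sp: "?s \<in> polys k" using i by (intro polys_sum upoly_polys)
      have "?s * ?P - 1 = ?s * (?P - 1) + (?s - 1)" by (simp add: algebra_simps)
      also have "\<dots> \<in> I"
        by (rule I_add[OF I_mult[OF sp] s]) (use insert in auto)
      finally have "?s * ?P - 1 \<in> I" .
      then show ?case using insert sp by (simp add: polys_mult)
    qed (simp add: I_0)
    from this[of "{..<k}"] show ?thesis by simp
  qed
  finally show ?thesis .
qed

lemma I_mult_right: "q \<in> polys k \<Longrightarrow> p \<in> I \<Longrightarrow> p * q \<in> I"
  using I_mult[of q p] by (simp add: mult.commute)

lemma idem_mult:
  assumes "\<phi> \<in> grid" "\<psi> \<in> grid" "\<phi> \<noteq> \<psi>"
  shows "idem \<phi> * idem \<psi> \<in> I"
proof -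
  obtain i where i: "i < k" "\<phi> i \<noteq> \<psi> i"
    using assms by (metis PiE_ext grid_def lessThan_iff)
  obtain r where r: "r \<in> polys k" "idem \<phi> = r * upoly i (part i (\<phi> i))" using idem_factor[OF i(1)] by blast
  obtain r' where r': "r' \<in> polys k" "idem \<psi> = r' * upoly i (part i (\<psi> i))" using idem_factor[OF i(1)] by blast
  have "idem \<phi> * idem \<psi> = (r * r') * upoly i (part i (\<phi> i) * part i (\<psi> i))"
    by (simp add: r r' upoly_mult algebra_simps)
  also have "\<dots> \<in> I"
    using assms i by (intro I_mult[OF polys_mult[OF r(1) r'(1)]] part(3) grid_roots)
  finally show ?thesis .
qed

text \<open>Multiply the partition of unity by \<open>idem \<phi>\<close>; orthogonality removes the
  other terms.\<close>

lemma idem_square: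
  assumes \<phi>: "\<phi> \<in> grid"
  shows "idem \<phi> * idem \<phi> - idem \<phi> \<in> I"
proof -
  have "(\<Sum>\<psi>\<in>grid. idem \<psi>) = idem \<phi> + (\<Sum>\<psi>\<in>grid - {\<phi>}. idem \<psi>)"
    using \<phi> finite_grid by (simp add: sum.remove)
  then have "idem \<phi> * idem \<phi> - idem \<phi> = idem \<phi> * ((\<Sum>\<psi>\<in>grid. idem \<psi>) - 1) - (\<Sum>\<psi>\<in>grid - {\<phi>}. idem \<phi> * idem \<psi>)"
    by (simp add: algebra_simps sum_distrib_left)
  also have "\<dots> \<in> I"
    using \<phi> by (intro I_diff I_mult idem_sum idem_polys I_sum idem_mult) auto
  finally show ?thesis .
qed

lemma meval_idem: "\<phi> \<in> grid \<Longrightarrow> meval (idem \<phi>) (vec k \<phi>) = 1"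
  by (simp add: idem_def meval.hom_prod meval_upoly part(1) grid_roots)

text \<open>The polynomials that become nilpotent in the factor ring belonging to
  \<open>idem \<phi>\<close>.\<close>

definition nilpotent_at :: "(nat \<Rightarrow> complex) \<Rightarrow> mpoly set" where
  "nilpotent_at \<phi> = {p \<in> polys k. \<exists>e. idem \<phi> * p ^ e \<in> I}"

lemma nilpotent_at_mult:
  "p \<in> nilpotent_at \<phi> \<Longrightarrow> q \<in> polys k \<Longrightarrow> p * q \<in> nilpotent_at \<phi>"
  unfolding nilpotent_at_def
  by (auto simp: power_mult_distrib mult.assoc[symmetric] intro!: polys_mult I_mult_right polys_power)

lemma nilpotent_at_add:
  assumes "p \<in> nilpotent_at \<phi>" "q \<in> nilpotent_at \<phi>"
  shows "p + q \<in> nilpotent_at \<phi>"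
proof -
  obtain a b where p: "p \<in> polys k" "idem \<phi> * p ^ a \<in> I" and q: "q \<in> polys k" "idem \<phi> * q ^ b \<in> I"
    using assms by (auto simp: nilpotent_at_def)
  \<comment> \<open>In every term of the binomial expansion one of the two exponents reaches
    \<open>a\<close> or \<open>b\<close>.\<close>
  have "idem \<phi> * (of_nat c * p ^ j * q ^ (a + b - j)) \<in> I" if "j \<le> a + b" for c j
  proof (cases "a \<le> j")
    case True
    then have eq: "p ^ j = p ^ (j - a) * p ^ a" by (simp flip: power_add)
    have "idem \<phi> * (of_nat c * p ^ j * q ^ (a + b - j)) = (of_nat c * p ^ (j - a) * q ^ (a + b - j)) * (idem \<phi> * p ^ a)"
      unfolding eq by (simp only: ac_simps)
    also have "\<dots> \<in> I"
      by (rule I_mult) (use p q in \<open>auto intro!: polys_mult polys_power\<close>)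
    finally show ?thesis .
  next
    case False
    then have eq: "q ^ (a + b - j) = q ^ (a - j) * q ^ b" by (simp flip: power_add)
    have "idem \<phi> * (of_nat c * p ^ j * q ^ (a + b - j)) = (of_nat c * p ^ j * q ^ (a - j)) * (idem \<phi> * q ^ b)"
      unfolding eq by (simp only: ac_simps)
    also have "\<dots> \<in> I"
      by (rule I_mult) (use p q in \<open>auto intro!: polys_mult polys_power\<close>)
    finally show ?thesis .
  qed
  then have "idem \<phi> * (p + q) ^ (a + b) \<in> I"
    unfolding binomial_ring sum_distrib_left by (intro I_sum) auto
  then show ?thesis using p q by (auto simp: nilpotent_at_def polys_add)
qed

text \<open>For a variable this is the property of \<open>part\<close> that a power of
  \<open>\<lambda>\<^sub>i - \<phi>\<^sub>i\<close> is annihilated; sums and products inherit it. It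
  makes the factor ring of \<open>\<phi>\<close> local.\<close>

lemma nilpotent_at_vanishing:
  assumes \<phi>: "\<phi> \<in> grid" and "p \<in> polys k"
  shows "p - mconst (meval p (vec k \<phi>)) \<in> nilpotent_at \<phi>"
  using assms(2)
proof (induct p rule: polys_induct)
  case (const c)
  show ?case by (auto simp: nilpotent_at_def I_0 intro!: exI[of _ 1])
next
  case (var i)
  obtain e where e: "upoly i (part i (\<phi> i) * [:- \<phi> i, 1:] ^ e) \<in> I"
    using part(2)[OF var grid_roots[OF \<phi> var]] by blast
  obtain r where r: "r \<in> polys k" "idem \<phi> = r * upoly i (part i (\<phi> i))" using idem_factor[OF var] by blast
  have "upoly i [:- \<phi> i, 1:] = mvar i - mconst (\<phi> i)"
    by (simp add: mconst_uminus)
  then have "idem \<phi> * (mvar i - mconst (\<phi> i)) ^ e = r * upoly i (part i (\<phi> i) * [:- \<phi> i, 1:] ^ e)"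
    unfolding upoly_mult upoly_power r(2) by (simp add: mult.assoc)
  then have "idem \<phi> * (mvar i - mconst (\<phi> i)) ^ e \<in> I"
    using I_mult[OF r(1) e] by simp
  then show ?case using var by (auto simp: nilpotent_at_def polys_diff)
next
  case (add p q)
  have "(p + q) - mconst (meval (p + q) (vec k \<phi>))
      = (p - mconst (meval p (vec k \<phi>))) + (q - mconst (meval q (vec k \<phi>)))"
    by (simp add: meval_add mconst_add)
  then show ?case using nilpotent_at_add[OF add(3,4)] by (simp only:)
next
  case (mult p q)
  let ?a = "mconst (meval p (vec k \<phi>))" and ?b = "mconst (meval q (vec k \<phi>))"
  have "p * q - mconst (meval (p * q) (vec k \<phi>)) = (p - ?a) * q + (q - ?b) * ?a"
    by (simp only: meval_mult mconst_mult) (simp add: algebra_simps)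
  then show ?case
    using nilpotent_at_add[OF nilpotent_at_mult[OF mult(3,2)] nilpotent_at_mult[OF mult(4) polys_mconst]] by (simp only:)
qed

text \<open>With \<open>c\<close> the value of \<open>s\<close> at the point, \<open>s\<close> is
  \<open>c * (1 - t)\<close> where \<open>t\<close> vanishes there and is therefore nilpotent on the
  component; a finite geometric series inverts \<open>1 - t\<close>.\<close>

lemma local_inverse:
  assumes \<phi>: "\<phi> \<in> grid" and s: "s \<in> polys k" and s0: "meval s (vec k \<phi>) \<noteq> 0"
  shows "\<exists>s'\<in>polys k. idem \<phi> * (s' * s - 1) \<in> I"
proof -
  define c where "c = meval s (vec k \<phi>)"
  define t where "t = mconst (- 1 / c) * (s - mconst c)"
  have "t \<in> nilpotent_at \<phi>"
    using nilpotent_at_mult[OF nilpotent_at_vanishing[OF \<phi> s], of "mconst (- 1 / c)"]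
    by (simp add: t_def c_def mult.commute)
  then obtain e where t: "t \<in> polys k" "idem \<phi> * t ^ e \<in> I" by (auto simp: nilpotent_at_def)
  have "mconst (- 1 / c) * mconst c = mconst (- 1)"
    using s0 by (simp add: c_def flip: mconst_mult)
  then have "t = mconst (- 1 / c) * s + 1"
    unfolding t_def right_diff_distrib by (simp add: mconst_uminus)
  then have s_t: "mconst (1 / c) * s = 1 - t" by (simp add: mconst_uminus)
  let ?s' = "(\<Sum>j<e. t ^ j) * mconst (1 / c)"
  have "?s' * s = (\<Sum>j<e. t ^ j) * (mconst (1 / c) * s)" by (simp only: mult.assoc)
  also have "\<dots> = (\<Sum>j<e. t ^ j) * (1 - t)" by (simp only: s_t)
  also have "\<dots> = (1 - t) * (\<Sum>j<e. t ^ j)" by (rule mult.commute)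
  also have "\<dots> = 1 - t ^ e" by (rule one_diff_power_eq[symmetric])
  finally have "idem \<phi> * (?s' * s - 1) = - (idem \<phi> * t ^ e)" by simp
  moreover have "?s' \<in> polys k" using t by (intro polys_mult polys_sum polys_power polys_mconst)
  ultimately show ?thesis using I_uminus[OF t(2)] by (intro bexI[of _ ?s']) simp_all
qed

text \<open>The image of \<open>idem \<phi>\<close> acting on normal forms, a model of the local
  ring at \<open>\<phi>\<close> inside a finite-dimensional space.\<close>

definition component :: "(nat \<Rightarrow> complex) \<Rightarrow> mpoly set" where
  "component \<phi> = {w \<in> deglt k n. NF (idem \<phi> * w) = w}"

lemma subspace_component: "mp.subspace (component \<phi>)"
proof (rule mp.subspaceI)
  fix c x assume "x \<in> component \<phi>"
  then show "mconst c * x \<in> component \<phi>"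
    by (simp add: component_def supported_scale mult.left_commute[of _ "mconst c"] NF_scale)
qed (auto simp: component_def supported_add distrib_left NF_add)

lemma component_NF:
  assumes "\<phi> \<in> grid" "p \<in> polys k"
  shows "NF (idem \<phi> * p) \<in> component \<phi>"
proof -
  have "(idem \<phi> * idem \<phi> - idem \<phi>) * p \<in> I" using idem_square assms by (intro I_mult_right)
  then have "NF (idem \<phi> * (idem \<phi> * p)) = NF (idem \<phi> * p)"
    using NF_I[of "(idem \<phi> * idem \<phi> - idem \<phi>) * p"] by (simp add: left_diff_distrib NF_diff mult.assoc)
  then show ?thesis
    using assms by (simp add: component_def NF_deglt NF_mult_NF polys_mult)
qed

lemma NF_idem_other:
  assumes "\<phi> \<in> grid" "\<psi> \<in> grid" "\<phi> \<noteq> \<psi>" "w \<in> component \<phi>"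
  shows "NF (idem \<psi> * w) = 0"
proof -
  have w: "w \<in> polys k" "w = NF (idem \<phi> * w)" using assms(4) by (auto simp: component_def deglt_polys)
  have "NF (idem \<psi> * w) = NF (idem \<psi> * (idem \<phi> * w))"
    by (subst w(2)) (simp add: NF_mult_NF w(1) polys_mult)
  also have "\<dots> = NF ((idem \<psi> * idem \<phi>) * w)" by (simp only: mult.assoc)
  also have "\<dots> = 0" by (intro NF_I I_mult_right[OF w(1)] idem_mult) (use assms in auto)
  finally show ?thesis .
qed

definition basis :: "(nat \<Rightarrow> complex) \<Rightarrow> mpoly set" where
  "basis \<phi> = (SOME B. B \<subseteq> component \<phi> \<and> mp.independent B \<and> component \<phi> \<subseteq> mp.span B)"

lemma basis: "basis \<phi> \<subseteq> component \<phi>" "mp.independent (basis \<phi>)" "component \<phi> \<subseteq> mp.span (basis \<phi>)"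
proof -
  have "\<exists>B. B \<subseteq> component \<phi> \<and> mp.independent B \<and> component \<phi> \<subseteq> mp.span B"
    by (rule mp.maximal_independent_subset[of "component \<phi>"]) blast
  from someI_ex[OF this] show "basis \<phi> \<subseteq> component \<phi>" "mp.independent (basis \<phi>)" "component \<phi> \<subseteq> mp.span (basis \<phi>)"
    by (simp_all add: basis_def)
qed

lemma deglt_span: "deglt k n \<subseteq> mp.span (mmonom ` monoms_deg k {..<n})"
proof
  fix p assume "p \<in> deglt k n"
  then have "p = (\<Sum>\<mu>\<in>monoms_deg k {..<n}. mconst (mcoeff p \<mu>) * mmonom \<mu>)"
    by (intro mpoly_expand) (auto simp: supported_def)
  also have "\<dots> \<in> mp.span (mmonom ` monoms_deg k {..<n})"
    by (intro mp.span_sum mp.span_scale mp.span_base) auto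
  finally show "p \<in> mp.span (mmonom ` monoms_deg k {..<n})" .
qed

lemma finite_basis: "finite (basis \<phi>)"
proof -
  have "basis \<phi> \<subseteq> mp.span (mmonom ` monoms_deg k {..<n})"
    using basis(1) deglt_span by (auto simp: component_def)
  then show ?thesis
    using mp.independent_span_bound[of "mmonom ` monoms_deg k {..<n}" "basis \<phi>"] basis(2) by simp
qed

lemma inj_mmonom: "inj_on mmonom T"
  by (rule inj_onI) (metis lookup_single_eq lookup_single_not_eq one_neq_zero)

lemma independent_mmonom:
  assumes "finite T"
  shows "mp.independent (mmonom ` T)"
proof -
  have "\<forall>\<mu>\<in>T. u (mmonom \<mu>) = 0" if "(\<Sum>v\<in>mmonom ` T. mconst (u v) * v) = 0" for u
  proof
    fix \<mu> assume \<mu>: "\<mu> \<in> T"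
    have "0 = mcoeff (\<Sum>v\<in>mmonom ` T. mconst (u v) * v) \<mu>" using that by simp
    also have "\<dots> = (\<Sum>\<nu>\<in>T. if \<nu> = \<mu> then u (mmonom \<nu>) else 0)"
      unfolding sum.reindex[OF inj_mmonom] lookup_sum by (intro sum.cong) (auto simp: lookup_single)
    finally show "u (mmonom \<mu>) = 0" using \<mu> assms by simp
  qed
  then show ?thesis using assms by (auto simp: mp.dependent_finite)
qed

text \<open>The components form a direct sum: \<open>idem \<psi>\<close> projects a relation to the
  component of \<open>\<psi>\<close>, and the idempotents add up to 1 modulo \<open>I\<close>. The
  united bases are compared with the basis of monomials of degree less than
  \<open>n\<close>.\<close>

lemma sum_card_basis: "(\<Sum>\<phi>\<in>grid. card (basis \<phi>)) = N"
proof -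
  let ?B = "\<Union>\<phi>\<in>grid. basis \<phi>"
  have zero: "0 \<notin> basis \<phi>" for \<phi> using basis(2) mp.dependent_zero by blast
  have disj: "basis \<phi> \<inter> basis \<psi> = {}" if "\<phi> \<in> grid" "\<psi> \<in> grid" "\<phi> \<noteq> \<psi>" for \<phi> \<psi>
  proof -
    have "w = 0" if w: "w \<in> basis \<phi>" "w \<in> basis \<psi>" for w
    proof -
      have "w \<in> component \<psi>" using w(2) basis(1) by blast
      then have "w = NF (idem \<psi> * w)" by (simp add: component_def)
      also have "\<dots> = 0" using NF_idem_other[OF \<open>\<phi> \<in> grid\<close> \<open>\<psi> \<in> grid\<close> \<open>\<phi> \<noteq> \<psi>\<close>] w basis(1) by blast
      finally show ?thesis .
    qed
    then show ?thesis using zero by blast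
  qed
  have fin: "finite ?B" using finite_grid finite_basis by simp
  have ind: "mp.independent ?B"
  proof -
    have "u w = 0" if u: "(\<Sum>v\<in>?B. mconst (u v) * v) = 0" and \<psi>: "\<psi> \<in> grid" and w: "w \<in> basis \<psi>" for u \<psi> w
    proof -
      have "(\<Sum>v\<in>?B. mconst (u v) * v) = (\<Sum>\<phi>\<in>grid. \<Sum>v\<in>basis \<phi>. mconst (u v) * v)"
        by (rule sum.UNION_disjoint) (use finite_grid finite_basis disj in auto)
      then have "0 = NF (idem \<psi> * (\<Sum>\<phi>\<in>grid. \<Sum>v\<in>basis \<phi>. mconst (u v) * v))" using u by simp
      also have "\<dots> = (\<Sum>\<phi>\<in>grid. \<Sum>v\<in>basis \<phi>. mconst (u v) * NF (idem \<psi> * v))"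
        by (simp only: sum_distrib_left NF_sum mult.left_commute[of "idem \<psi>"] NF_scale)
      also have "\<dots> = (\<Sum>\<phi>\<in>grid. if \<phi> = \<psi> then \<Sum>v\<in>basis \<psi>. mconst (u v) * v else 0)"
      proof (rule sum.cong[OF refl])
        fix \<phi> assume \<phi>: "\<phi> \<in> grid"
        have "NF (idem \<psi> * v) = (if \<phi> = \<psi> then v else 0)" if "v \<in> basis \<phi>" for v
        proof -
          have "v \<in> component \<phi>" using that basis(1) by blast
          then show ?thesis
            using NF_idem_other[OF \<phi> \<psi>] by (auto simp: component_def)
        qed
        then show "(\<Sum>v\<in>basis \<phi>. mconst (u v) * NF (idem \<psi> * v)) = (if \<phi> = \<psi> then \<Sum>v\<in>basis \<psi>. mconst (u v) * v else 0)"
          by auto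
      qed
      also have "\<dots> = (\<Sum>v\<in>basis \<psi>. mconst (u v) * v)" using \<psi> finite_grid by simp
      finally show ?thesis
        using basis(2)[of \<psi>] w finite_basis[of \<psi>] by (auto simp: mp.dependent_finite)
    qed
    then show ?thesis unfolding mp.dependent_finite[OF fin] by blast
  qed
  have sp1: "?B \<subseteq> deglt k n" using basis(1) by (auto simp: component_def)
  have sp2: "deglt k n \<subseteq> mp.span ?B"
  proof
    fix w assume w: "w \<in> deglt k n"
    have wp: "w \<in> polys k" by (rule deglt_polys[OF w])
    have "NF (((\<Sum>\<phi>\<in>grid. idem \<phi>) - 1) * w) = 0" by (rule NF_I[OF I_mult_right[OF wp idem_sum]])
    then have "w = (\<Sum>\<phi>\<in>grid. NF (idem \<phi> * w))"
      using NF_id[OF w] by (simp add: left_diff_distrib NF_diff sum_distrib_right NF_sum)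
    also have "\<dots> \<in> mp.span ?B"
    proof (rule mp.span_sum)
      fix \<phi> assume \<phi>: "\<phi> \<in> grid"
      have "mp.span (basis \<phi>) \<subseteq> mp.span ?B" using \<phi> by (intro mp.span_mono) auto
      then show "NF (idem \<phi> * w) \<in> mp.span ?B" using component_NF[OF \<phi> wp] basis(3) by blast
    qed
    finally show "w \<in> mp.span ?B" .
  qed
  let ?M = "mmonom ` monoms_deg k {..<n}"
  have "?M \<subseteq> deglt k n" by (auto intro: supported_single)
  then have "mp.span ?M = mp.span (deglt k n)" "mp.span ?B = mp.span (deglt k n)"
    using deglt_span sp1 sp2 mp.span_superset[of "deglt k n"] unfolding mp.span_eq by blast+
  then have "card ?B = card ?M"
    using mp.dim_eq_card[OF _ ind] mp.dim_eq_card[OF _ independent_mmonom, of "monoms_deg k {..<n}"] by (metis finite_monoms_lt)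
  also have "\<dots> = N"
    using card_monoms_lt[of k n] k n by (simp add: card_image[OF inj_mmonom])
  finally have "card ?B = N" .
  moreover have "card ?B = (\<Sum>\<phi>\<in>grid. card (basis \<phi>))"
    by (rule card_UN_disjoint) (use finite_grid finite_basis disj in auto)
  ultimately show ?thesis by simp
qed

lemma meval_I:
  assumes "p \<in> I" "\<And>J. J \<in> S \<Longrightarrow> meval (f J) x = 0"
  shows "meval p x = 0"
  using assms by (auto simp: I_def meval.hom_sum meval_mult)

definition zeros :: "complex vec set" where
  "zeros = {x \<in> carrier_vec k. \<forall>J\<in>S. meval (f J) x = 0}"

lemma zeros_grid:
  assumes x: "x \<in> zeros"
  shows "\<exists>\<phi>\<in>grid. x = vec k \<phi>"
proof -
  let ?\<phi> = "restrict (($) x) {..<k}"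
  have "poly (ann i) (x $ i) = 0" if "i < k" for i
    using meval_I[OF ann(2)[OF that], of x] x by (simp add: zeros_def meval_upoly)
  then have "?\<phi> \<in> grid" by (auto simp: grid_def roots_def)
  moreover have "x = vec k ?\<phi>" using x by (intro eq_vecI) (auto simp: zeros_def)
  ultimately show ?thesis by blast
qed

text \<open>A minor that does not vanish at the point is invertible on the component, yet acts as 0
  there because it lies in \<open>I\<close>.\<close>

lemma basis_empty:
  assumes \<phi>: "\<phi> \<in> grid" and x: "vec k \<phi> \<notin> zeros"
  shows "basis \<phi> = {}"
proof -
  obtain J where J: "J \<in> S" "meval (f J) (vec k \<phi>) \<noteq> 0" using x by (auto simp: zeros_def)
  obtain s' where s': "s' \<in> polys k" "idem \<phi> * (s' * f J - 1) \<in> I"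
    using local_inverse[OF \<phi> I_polys[OF f_I[OF J(1)]] J(2)] by blast
  have "idem \<phi> = (idem \<phi> * s') * f J - idem \<phi> * (s' * f J - 1)" by (simp add: algebra_simps)
  also have "\<dots> \<in> I"
    by (rule I_diff[OF I_mult[OF polys_mult[OF idem_polys s'(1)] f_I[OF J(1)]] s'(2)])
  finally have "idem \<phi> \<in> I" .
  then have "w = 0" if "w \<in> component \<phi>" for w
    using that NF_I[OF I_mult_right[OF deglt_polys]] by (force simp: component_def)
  then show ?thesis using basis(1,2) mp.dependent_zero by blast
qed

lemma finite_zeros: "finite zeros"
proof -
  have "zeros \<subseteq> vec k ` grid" using zeros_grid by blast
  then show ?thesis using finite_grid finite_subset by blast
qed

lemma sum_card_basis_zeros:
  "(\<Sum>x\<in>zeros. card (basis (restrict (($) x) {..<k}))) = N"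
proof -
  let ?\<phi> = "\<lambda>x. restrict (($) x) {..<k}"
  have bk: "?\<phi> (vec k \<phi>) = \<phi>" if "\<phi> \<in> grid" for \<phi>
    using that by (auto simp: grid_def PiE_def extensional_def restrict_def)
  have "(\<Sum>x\<in>zeros. card (basis (?\<phi> x))) = (\<Sum>\<phi>\<in>?\<phi> ` zeros. card (basis \<phi>))"
  proof (rule sum.reindex[symmetric, unfolded comp_def])
    show "inj_on ?\<phi> zeros"
    proof (rule inj_onI)
      fix x y assume "x \<in> zeros" "y \<in> zeros" "?\<phi> x = ?\<phi> y"
      then show "x = y" using zeros_grid bk by metis
    qed
  qed
  also have "\<dots> = (\<Sum>\<phi>\<in>grid. card (basis \<phi>))"
  proof (rule sum.mono_neutral_left[OF finite_grid])
    show "?\<phi> ` zeros \<subseteq> grid" using zeros_grid bk by fastforce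
    show "\<forall>\<phi>\<in>grid - ?\<phi> ` zeros. card (basis \<phi>) = 0"
      using basis_empty bk by (metis DiffE card.empty imageI)
  qed
  also have "\<dots> = N" by (rule sum_card_basis)
  finally show ?thesis .
qed

end

section \<open>Local rings\<close>

abbreviation Fr :: "mpoly \<Rightarrow> mpoly \<Rightarrow> mpoly fract" where
  "Fr \<equiv> Fraction_Field.Fract"

text \<open>\<open>pick I\<close> enumerates \<open>I\<close> in increasing order, hence agrees with
  the sorted list.\<close>

lemma det_submatrix_eq_minor:
  assumes I: "I \<subseteq> {..<dim_row M}" "card I = dim_col M"
  shows "det (submatrix M I UNIV) = minor (\<lambda>r q. M $$ (r, q)) (sorted_list_of_set I)"
proof -
  have fin: "finite I" using I(1) finite_subset by blast
  have 1: "{i. i < dim_row M \<and> i \<in> I} = I" using I(1) by auto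
  have len: "length (sorted_list_of_set I) = dim_col M" using I(2) fin by simp
  have pick: "pick I p = sorted_list_of_set I ! p" if p: "p < card I" for p
  proof -
    let ?xs = "sorted_list_of_set I"
    have s: "sorted_wrt (<) ?xs" by simp
    have p': "p < length ?xs" using p fin by simp
    then have in_I: "?xs ! p \<in> I" using fin nth_mem set_sorted_list_of_set by blast
    have "{a \<in> I. a < ?xs ! p} = (!) ?xs ` {..<p}"
    proof (rule Set.set_eqI, rule iffI)
      fix a assume "a \<in> {a \<in> I. a < ?xs ! p}"
      then have "a \<in> set ?xs" and lt: "a < ?xs ! p" using fin by auto
      then obtain j where j: "j < length ?xs" "a = ?xs ! j" by (auto simp: in_set_conv_nth)
      have "j < p"
      proof (rule ccontr)
        assume "\<not> j < p"
        then have "?xs ! p \<le> ?xs ! j" using j(1) by (intro sorted_nth_mono) auto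
        then show False using lt j(2) by simp
      qed
      then show "a \<in> (!) ?xs ` {..<p}" using j by auto
    next
      fix a assume "a \<in> (!) ?xs ` {..<p}"
      then obtain j where "j < p" "a = ?xs ! j" by auto
      moreover from this have "?xs ! j < ?xs ! p" using s p' by (simp add: sorted_wrt_iff_nth_less)
      moreover have "?xs ! j \<in> I" using \<open>j < p\<close> p' fin nth_mem[of j ?xs] by simp
      ultimately show "a \<in> {a \<in> I. a < ?xs ! p}" by simp
    qed
    moreover have "inj_on ((!) ?xs) {..<p}"
      using p' by (auto intro!: inj_on_nth)
    ultimately have "card {a \<in> I. a < ?xs ! p} = p" by (simp add: card_image)
    then show ?thesis using pick_card_in_set[OF in_I] by simp
  qed
  show ?thesis
    unfolding minor_def len
    by (rule arg_cong[where f = det], rule eq_matI) (auto simp: submatrix_def 1 I(2) pick pick_UNIV)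
qed

context rmep_regular
begin

lemma poly_pencil_index:
  assumes "r < m" "a < n"
  shows "poly_pencil A Bs $$ (r, a) = F r a"
proof -
  have "Bs ! l \<in> carrier_mat m n" if "l < k" for l using Bs len that nth_mem by blast
  then have entry: "map_mat mconst (Bs ! l) $$ (r, a) = mconst (Bs ! l $$ (r, a))" if "l < k" for l
    using that assms by fastforce
  have "poly_pencil A Bs $$ (r, a)
      = mconst (A $$ (r, a)) + (\<Sum>l<k. mvar l * map_mat mconst (Bs ! l) $$ (r, a))"
    using assms A len by (simp add: poly_pencil_def pencil_def)
  then show ?thesis by (simp add: entry F_def)
qed

lemma poly_pencil_dim [simp]: "dim_row (poly_pencil A Bs) = m" "dim_col (poly_pencil A Bs) = n"
  using A by (simp_all add: poly_pencil_def pencil_def)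

lemma maximal_minors_eq: "maximal_minors (poly_pencil A Bs) = f ` S"
proof -
  let ?M = "poly_pencil A Bs"
  have det: "det (submatrix ?M T UNIV) = f (sorted_list_of_set T)" if T: "T \<subseteq> {..<m}" "card T = n" for T
  proof -
    have "finite T" using T(1) finite_subset by blast
    then have "minor (\<lambda>r q. ?M $$ (r, q)) (sorted_list_of_set T) = f (sorted_list_of_set T)"
      using T by (intro minor_cong poly_pencil_index) auto
    then show ?thesis using det_submatrix_eq_minor[of T ?M] T by simp
  qed
  have "maximal_minors ?M = (\<lambda>T. f (sorted_list_of_set T)) ` {T. T \<subseteq> {..<m} \<and> card T = n}"
  proof -
    have "maximal_minors ?M = (\<lambda>T. det (submatrix ?M T UNIV)) ` {T. T \<subseteq> {..<m} \<and> card T = n}"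
      unfolding maximal_minors_def poly_pencil_dim by blast
    also have "\<dots> = (\<lambda>T. f (sorted_list_of_set T)) ` {T. T \<subseteq> {..<m} \<and> card T = n}"
      by (intro image_cong refl) (simp add: det)
    finally show ?thesis .
  qed
  also have "\<dots> = (\<lambda>T. f (sorted_list_of_set T)) ` set ` S"
    using strict_lists_bij[of m n] by (simp add: bij_betw_def)
  also have "\<dots> = f ` S"
    unfolding image_image by (intro image_cong refl) (auto simp: strict_lists_def strict_sorted_iff sorted_list_of_set.idem_if_sorted_distinct)
  finally show ?thesis .
qed

end

section \<open>The local ring at an eigenvalue and its dimension\<close>

locale rmep_point = rmep_regular +
  fixes v :: "complex vec"
  assumes v: "v \<in> zeros"
begin

abbreviation "L \<equiv> local_ring k v"

definition Den :: "mpoly set" where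
  "Den = {q \<in> polys k. meval q v \<noteq> 0}"

lemma L_simps [simp]:
  "carrier L = {Fr p q | p q. p \<in> polys k \<and> q \<in> Den}"
  "x \<otimes>\<^bsub>L\<^esub> y = x * y" "x \<oplus>\<^bsub>L\<^esub> y = x + y" "\<one>\<^bsub>L\<^esub> = 1" "\<zero>\<^bsub>L\<^esub> = 0"
  by (auto simp: local_ring_def Den_def)

lemma Den_nz: "q \<in> Den \<Longrightarrow> q \<noteq> 0"
  by (auto simp: Den_def)

lemma Den_mult: "p \<in> Den \<Longrightarrow> q \<in> Den \<Longrightarrow> p * q \<in> Den"
  and Den_1: "1 \<in> Den"
  and Den_polys: "q \<in> Den \<Longrightarrow> q \<in> polys k"
  by (auto simp: Den_def polys_mult meval_mult)

lemma L_I: "p \<in> polys k \<Longrightarrow> q \<in> Den \<Longrightarrow> Fr p q \<in> carrier L"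
  by auto

lemma L_cring: "cring L"
proof (rule cringI)
  have add: "x + y \<in> carrier L" and mult: "x * y \<in> carrier L" and neg: "- x \<in> carrier L"
    if xy: "x \<in> carrier L" "y \<in> carrier L" for x y
  proof -
    obtain a b c d where *: "x = Fr a b" "y = Fr c d" "a \<in> polys k" "c \<in> polys k" "b \<in> Den" "d \<in> Den"
      using xy by auto
    note nz = Den_nz[OF *(5)] Den_nz[OF *(6)]
    have "x + y = Fr (a * d + c * b) (b * d)" using * nz by simp
    then show "x + y \<in> carrier L"
      using * Den_polys L_I[of "a * d + c * b" "b * d"]
      by (simp del: L_simps(1) add: polys_add polys_mult Den_mult)
    have "x * y = Fr (a * c) (b * d)" using * by simp
    then show "x * y \<in> carrier L"
      using * L_I[of "a * c" "b * d"] by (simp del: L_simps(1) add: polys_mult Den_mult)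
    have "- x = Fr (- a) b" using * by simp
    then show "- x \<in> carrier L"
      using * L_I[of "- a" b] by (simp del: L_simps(1) add: polys_uminus)
  qed
  have one: "1 \<in> carrier L" and zero: "0 \<in> carrier L"
    unfolding One_fract_def Zero_fract_def by (rule L_I[OF polys_1 Den_1], rule L_I[OF polys_0 Den_1])
  show "abelian_group L"
  proof (rule abelian_groupI)
    fix x assume "x \<in> carrier L"
    then show "\<exists>y\<in>carrier L. y \<oplus>\<^bsub>L\<^esub> x = \<zero>\<^bsub>L\<^esub>"
      using neg[of x x] by (intro bexI[of _ "- x"]) simp_all
  qed (use add zero in \<open>simp_all del: L_simps(1) add: add.assoc add.commute\<close>)
  show "comm_monoid L"
    by (rule comm_monoidI) (use mult one in \<open>simp_all del: L_simps(1) add: mult.assoc mult.commute\<close>)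
qed (simp del: L_simps(1) add: distrib_right)

interpretation L: cring L by (rule L_cring)

definition J :: "mpoly fract set" where
  "J = minors_ideal A Bs v"

lemma Fr_mem_I: "Fr a b = Fr p q \<Longrightarrow> p \<in> I \<Longrightarrow> b \<noteq> 0 \<Longrightarrow> q \<noteq> 0 \<Longrightarrow> b \<in> polys k \<Longrightarrow> q * a \<in> I"
  using I_mult[of b p] by (simp add: eq_fract(1) mult.commute)

text \<open>The fractions with numerator in \<open>I\<close> form an ideal that contains the
  generators; conversely, a combination of the minors over a common denominator lies in the ideal
  they generate.\<close>

lemma J_eq: "J = {Fr p q | p q. p \<in> I \<and> q \<in> Den}"
proof
  let ?J = "{Fr p q | p q. p \<in> I \<and> q \<in> Den}"
  let ?gens = "(\<lambda>p. Fr p 1) ` maximal_minors (poly_pencil A Bs)"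
  have JI: "J = genideal L ?gens" by (simp add: J_def minors_ideal_def len)
  have gens: "?gens \<subseteq> carrier L"
    unfolding maximal_minors_eq by (auto intro!: exI L_I I_polys f_I Den_1)
  have idl: "ideal ?J L"
  proof (rule idealI)
    show "ring L" by (rule L.ring_axioms)
    have sub: "?J \<subseteq> carrier L" using I_polys by auto
    have add: "x + y \<in> ?J" and neg: "- x \<in> ?J" if xy: "x \<in> ?J" "y \<in> ?J" for x y
    proof -
      obtain a b c d where *: "x = Fr a b" "y = Fr c d" "a \<in> I" "c \<in> I" "b \<in> Den" "d \<in> Den"
        using xy by auto
      have "x + y = Fr (d * a + b * c) (b * d)" using * Den_nz by (simp add: mult.commute)
      moreover have "d * a + b * c \<in> I" using * by (intro I_add I_mult Den_polys)
      ultimately show "x + y \<in> ?J" using Den_mult * by blast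
      have "- x = Fr (- a) b" using * by simp
      then show "- x \<in> ?J" using I_uminus * by blast
    qed
    have zero: "0 \<in> ?J" unfolding Zero_fract_def using I_0 Den_1 by blast
    show "subgroup ?J (add_monoid L)"
    proof (rule L.add.subgroupI)
      show "?J \<subseteq> carrier L" by (rule sub)
      show "?J \<noteq> {}" using zero by blast
      fix x assume x: "x \<in> ?J"
      then have xL: "x \<in> carrier L" using sub by blast
      have "\<ominus>\<^bsub>L\<^esub> x = - x"
      proof (rule L.minus_equality)
        show "- x \<oplus>\<^bsub>L\<^esub> x = \<zero>\<^bsub>L\<^esub>" by simp
        show "x \<in> carrier L" by (rule xL)
        show "- x \<in> carrier L" using neg[OF x x] sub by blast
      qed
      then show "\<ominus>\<^bsub>L\<^esub> x \<in> ?J" using neg[OF x x] by simp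
    next
      fix x y assume "x \<in> ?J" "y \<in> ?J"
      then show "x \<oplus>\<^bsub>L\<^esub> y \<in> ?J" using add by simp
    qed
    have mult: "x * y \<in> ?J" if xy: "x \<in> ?J" "y \<in> carrier L" for x y
    proof -
      obtain a b c d where *: "x = Fr a b" "y = Fr c d" "a \<in> I" "c \<in> polys k" "b \<in> Den" "d \<in> Den"
        using xy by auto
      then have "x * y = Fr (c * a) (b * d)" by (simp add: mult.commute)
      then show ?thesis using I_mult Den_mult * by blast
    qed
    fix a x assume "a \<in> ?J" "x \<in> carrier L"
    then show "a \<otimes>\<^bsub>L\<^esub> x \<in> ?J" "x \<otimes>\<^bsub>L\<^esub> a \<in> ?J"
      using mult by (simp_all only: L_simps mult.commute[of x a])
  qed
  have "?gens \<subseteq> ?J"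
    unfolding maximal_minors_eq using f_I Den_1 by blast
  then show "J \<subseteq> ?J" unfolding JI by (rule L.genideal_minimal[OF idl])
  interpret G: ideal J L unfolding JI by (rule L.genideal_ideal[OF gens])
  have gen_J: "Fr (f K) 1 \<in> J" if "K \<in> S" for K
    using L.genideal_self[OF gens] that unfolding JI maximal_minors_eq by blast
  show "?J \<subseteq> J"
  proof
    fix x assume "x \<in> ?J"
    then obtain p q where x: "x = Fr p q" "p \<in> I" and q: "q \<in> Den" by auto
    obtain g where g: "\<forall>K. g K \<in> polys k" and p: "p = (\<Sum>K\<in>S. g K * f K)" using x(2) by (auto simp: I_def)
    have "Fr (\<Sum>K\<in>T. g K * f K) q \<in> J" if "finite T" "T \<subseteq> S" for T
      using that
    proof (induct T rule: finite_induct)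
      case empty
      show ?case using G.zero_closed by (simp add: fract_collapse)
    next
      case (insert K T)
      have "Fr (g K) q \<otimes>\<^bsub>L\<^esub> Fr (f K) 1 \<in> J"
        using G.I_l_closed[OF gen_J L_I] g q insert by blast
      moreover have "Fr (\<Sum>K\<in>T. g K * f K) q \<in> J" using insert by simp
      ultimately have "(Fr (g K) q \<otimes>\<^bsub>L\<^esub> Fr (f K) 1) \<oplus>\<^bsub>L\<^esub> Fr (\<Sum>K\<in>T. g K * f K) q \<in> J"
        by (rule G.a_closed)
      moreover have "(Fr (g K) q * Fr (f K) 1) + Fr (\<Sum>K\<in>T. g K * f K) q = Fr (\<Sum>K\<in>insert K T. g K * f K) q"
        using insert Den_nz[OF q] by (simp add: eq_fract algebra_simps)
      ultimately show ?case by (simp del: L_simps(1))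
    qed
    from this[of S] show "x \<in> J" by (simp add: x p)
  qed
qed

text \<open>A criterion for a given numerator: another representative of the fraction may be the one
  with numerator in \<open>I\<close>, and cross multiplication brings in the factor
  \<open>s\<close>.\<close>

lemma J_iff:
  assumes "a \<in> polys k" "b \<in> Den"
  shows "Fr a b \<in> J \<longleftrightarrow> (\<exists>s\<in>Den. s * a \<in> I)"
proof
  assume "Fr a b \<in> J"
  then obtain p q where "Fr a b = Fr p q" "p \<in> I" "q \<in> Den" by (auto simp: J_eq)
  then show "\<exists>s\<in>Den. s * a \<in> I"
    using Fr_mem_I[of a b p q] assms Den_nz Den_polys by blast
next
  assume "\<exists>s\<in>Den. s * a \<in> I"
  then obtain s where s: "s \<in> Den" "s * a \<in> I" by blast
  then have "Fr a b = Fr (s * a) (s * b)" using Den_nz by (simp add: eq_fract Den_nz assms)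
  then show "Fr a b \<in> J" using s Den_mult assms by (auto simp: J_eq)
qed

lemma ideal_J: "ideal J L"
proof -
  have "(\<lambda>p. Fr p 1) ` maximal_minors (poly_pencil A Bs) \<subseteq> carrier L"
    unfolding maximal_minors_eq by (auto intro!: exI L_I I_polys f_I Den_1)
  then show ?thesis
    using L.genideal_ideal by (simp add: J_def minors_ideal_def len)
qed

abbreviation "Q \<equiv> eigen_local_ring A Bs v"
abbreviation "\<rho> \<equiv> \<lambda>x. J +>\<^bsub>L\<^esub> x"

lemma Q_eq: "Q = L Quot J"
  by (simp add: eigen_local_ring_def J_def len)

lemma Q_cring: "cring Q"
  unfolding Q_eq by (rule ideal.quotient_is_cring[OF ideal_J L_cring])

interpretation Q: cring Q by (rule Q_cring)

lemma rho_hom: "\<rho> \<in> Ring.ring_hom L Q"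
  unfolding Q_eq by (rule ideal.rcos_ring_hom[OF ideal_J])

lemma Q_carrier: "carrier Q = \<rho> ` carrier L"
  by (auto simp: Q_eq FactRing_def A_RCOSETS_def')

definition emb :: "mpoly \<Rightarrow> mpoly fract set" where
  "emb p = \<rho> (Fr p 1)"

lemma emb_carrier [simp]: "p \<in> polys k \<Longrightarrow> emb p \<in> carrier Q"
  unfolding emb_def Q_carrier by (intro imageI L_I Den_1)

lemma emb_add: "p \<in> polys k \<Longrightarrow> q \<in> polys k \<Longrightarrow> emb (p + q) = emb p \<oplus>\<^bsub>Q\<^esub> emb q"
  using ring_hom_add[OF rho_hom L_I[OF _ Den_1] L_I[OF _ Den_1], of p q] by (simp add: emb_def)

lemma emb_mult: "p \<in> polys k \<Longrightarrow> q \<in> polys k \<Longrightarrow> emb (p * q) = emb p \<otimes>\<^bsub>Q\<^esub> emb q"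
  using ring_hom_mult[OF rho_hom L_I[OF _ Den_1] L_I[OF _ Den_1], of p q] by (simp add: emb_def)

lemma emb_1: "emb 1 = \<one>\<^bsub>Q\<^esub>"
  using ring_hom_one[OF rho_hom] by (simp add: emb_def fract_collapse)

lemma rho_eq_iff:
  assumes "x \<in> carrier L" "y \<in> carrier L"
  shows "\<rho> x = \<rho> y \<longleftrightarrow> x - y \<in> J"
proof -
  have "\<ominus>\<^bsub>L\<^esub> y = - y"
  proof (rule L.minus_equality)
    show "- y \<oplus>\<^bsub>L\<^esub> y = \<zero>\<^bsub>L\<^esub>" by simp
    show "y \<in> carrier L" by (rule assms)
    obtain a b where ab: "y = Fr a b" "a \<in> polys k" "b \<in> Den" using assms by auto
    then have "- y = Fr (- a) b" by simp
    then show "- y \<in> carrier L" using L_I[OF polys_uminus] ab by metis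
  qed
  then have "x \<ominus>\<^bsub>L\<^esub> y = x - y" by (simp add: a_minus_def del: L_simps(1))
  then show ?thesis using L.quotient_eq_iff_same_a_r_cos[OF ideal_J assms] by simp
qed

lemma emb_0: "emb 0 = \<zero>\<^bsub>Q\<^esub>"
proof -
  have "emb 0 \<oplus>\<^bsub>Q\<^esub> emb 0 = emb 0" using emb_add[of 0 0] by simp
  then show ?thesis using Q.add.l_cancel_one[of "emb 0" "emb 0"] by simp
qed

lemma emb_eq_0_iff: "p \<in> polys k \<Longrightarrow> emb p = \<zero>\<^bsub>Q\<^esub> \<longleftrightarrow> (\<exists>s\<in>Den. s * p \<in> I)"
  using rho_eq_iff[of "Fr p 1" "Fr 0 1"] J_iff[of p 1] Den_1 L_I[OF _ Den_1]
  by (simp add: emb_0[symmetric] emb_def del: L_simps(1))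

abbreviation "K \<equiv> eigen_constants A Bs v"

lemma K_eq: "K = (\<lambda>c. emb (mconst c)) ` UNIV"
  by (simp add: eigen_constants_def emb_def J_def len)

text \<open>Here the point has to be a zero of the minors: all of \<open>I\<close> vanishes at
  \<open>v\<close>, whereas denominators do not.\<close>

lemma one_not_zero: "\<one>\<^bsub>Q\<^esub> \<noteq> \<zero>\<^bsub>Q\<^esub>"
proof
  assume "\<one>\<^bsub>Q\<^esub> = \<zero>\<^bsub>Q\<^esub>"
  then obtain s where "s \<in> Den" "s \<in> I" using emb_eq_0_iff[of 1] by (auto simp: emb_1)
  moreover have "meval s v = 0" using meval_I[OF \<open>s \<in> I\<close>] v by (auto simp: zeros_def)
  ultimately show False by (simp add: Den_def)
qed

text \<open>The image of a field in a nonzero ring; \<open>class_ring\<close> is the field of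
  complex numbers as an algebraic structure.\<close>

lemma subfield_K: "subfield K Q"
proof -
  let ?C = "class_ring :: complex ring"
  have C: "Ring.field ?C" by (rule class_field)
  then have ring_C: "Ring.ring ?C" by (simp add: Ring.field_def domain_def cring_def)
  have "(\<lambda>c. emb (mconst c)) \<in> Ring.ring_hom ?C Q"
    by (rule ring_hom_memI) (simp_all add: class_ring_simps mconst_mult mconst_add emb_add emb_mult emb_1)
  then have "ring_hom_ring ?C Q (\<lambda>c. emb (mconst c))"
    by (intro ring_hom_ringI2 ring_C Q.ring_axioms)
  from ring_hom_ring.img_is_subfield(2)[OF this field.carrier_is_subfield[OF C] one_not_zero]
  show ?thesis by (simp add: K_eq class_ring_simps)
qed

text \<open>The polynomial counterpart of \<open>combine\<close>, which likewise stops at the end of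
  the shorter list.\<close>

definition zip_sum :: "complex list \<Rightarrow> mpoly list \<Rightarrow> mpoly" where
  "zip_sum cs us = (\<Sum>(c, u)\<leftarrow>zip cs us. mconst c * u)"

lemma zip_sum_polys: "set us \<subseteq> polys k \<Longrightarrow> zip_sum cs us \<in> polys k"
proof (induct cs arbitrary: us)
  case (Cons c cs)
  then show ?case by (cases us) (auto simp: zip_sum_def intro!: polys_add polys_mult)
qed (simp add: zip_sum_def)

lemma combine_emb:
  assumes "set us \<subseteq> polys k"
  shows "ring.combine Q (map (\<lambda>c. emb (mconst c)) cs) (map emb us) = emb (zip_sum cs us)"
  using assms
proof (induct cs arbitrary: us)
  case (Cons c cs)
  show ?case
  proof (cases us)
    case (Cons u us')
    then have "set us' \<subseteq> polys k" "u \<in> polys k" using Cons.prems by auto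
    then show ?thesis
      using Cons.hyps[of us'] zip_sum_polys[of us' cs]
      by (simp add: Cons zip_sum_def emb_add emb_mult polys_mult)
  qed (simp add: zip_sum_def emb_0)
qed (simp add: zip_sum_def emb_0)

lemma zip_sum_eq:
  assumes "distinct us"
  shows "zip_sum cs us = (\<Sum>u\<in>set (take (length cs) us). mconst (the (map_of (zip us cs) u)) * u)"
  using assms
proof (induct us arbitrary: cs)
  case (Cons u us)
  show ?case
  proof (cases cs)
    case (Cons c cs')
    have u: "u \<notin> set (take (length cs') us)" using Cons.prems in_set_takeD by fastforce
    then have "(\<Sum>w\<in>set (take (length cs') us). mconst (the (map_of (zip (u # us) cs) w)) * w)
        = (\<Sum>w\<in>set (take (length cs') us). mconst (the (map_of (zip us cs') w)) * w)"
      by (intro sum.cong refl) (auto simp: Cons)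
    then show ?thesis using Cons.hyps[of cs'] Cons.prems u by (simp add: Cons zip_sum_def)
  qed (simp add: zip_sum_def)
qed (simp add: zip_sum_def)

abbreviation "pt \<equiv> restrict (($) v) {..<k}"

lemma pt: "pt \<in> grid" "v = vec k pt"
proof -
  obtain \<phi> where \<phi>: "\<phi> \<in> grid" "v = vec k \<phi>" using zeros_grid[OF v] by blast
  then have "pt = \<phi>" by (auto simp: grid_def PiE_def extensional_def restrict_def)
  with \<phi> show "pt \<in> grid" "v = vec k pt" by simp_all
qed

text \<open>Injectivity of the map from the component to \<open>Q\<close>: by
  \<open>local_inverse\<close> the denominator \<open>s\<close> is invertible on the
  component.\<close>

lemma component_zero:
  assumes w: "w \<in> component pt" and s: "s \<in> Den" "s * w \<in> I"
  shows "w = 0"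
proof -
  have wp: "w \<in> polys k" using w by (auto simp: component_def deglt_polys)
  obtain s' where s': "s' \<in> polys k" "idem pt * (s' * s - 1) \<in> I"
    using local_inverse[OF pt(1), of s] s pt(2) by (auto simp: Den_def)
  have "idem pt * w = (idem pt * s') * (s * w) - (idem pt * (s' * s - 1)) * w"
    by (simp add: algebra_simps)
  also have "\<dots> \<in> I"
    by (rule I_diff[OF I_mult[OF polys_mult[OF idem_polys s'(1)] s(2)] I_mult_right[OF wp s'(2)]])
  finally show ?thesis using NF_I w by (fastforce simp: component_def)
qed

text \<open>Surjectivity: if \<open>q'\<close> inverts \<open>q\<close> on the component, the normal
  form of \<open>idem pt * (q' * p)\<close> represents the fraction. Equality has to hold only after
  multiplication by \<open>idem pt\<close>, which has the value 1 at \<open>v\<close> and so is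
  itself a denominator.\<close>

lemma component_approx:
  assumes p: "p \<in> polys k" and q: "q \<in> Den"
  shows "\<exists>w\<in>component pt. \<rho> (Fr p q) = emb w"
proof -
  have qp: "q \<in> polys k" using q by (rule Den_polys)
  obtain q' where q': "q' \<in> polys k" "idem pt * (q' * q - 1) \<in> I"
    using local_inverse[OF pt(1), of q] q pt(2) by (auto simp: Den_def)
  let ?y = "idem pt * (q' * p)"
  define w where "w = NF ?y"
  have w: "w \<in> component pt" unfolding w_def using component_NF[OF pt(1)] q' p polys_mult by blast
  have wp: "w \<in> polys k" by (simp add: w_def)
  have y: "?y - w \<in> I" unfolding w_def using q' p by (intro NF_diff_I polys_mult idem_polys)
  have "idem pt * (p - q * w) = (idem pt * q) * (?y - w) - (p * q * q') * (idem pt * idem pt - idem pt) - p * (idem pt * (q' * q - 1))"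
    by (simp add: algebra_simps)
  also have "\<dots> \<in> I"
    using p qp q' y idem_square[OF pt(1)] by (intro I_diff I_mult[OF _ y] I_mult[OF _ idem_square[OF pt(1)]] I_mult[OF _ q'(2)] polys_mult idem_polys)
  finally have 1: "idem pt * (p - q * w) \<in> I" .
  have "idem pt \<in> Den" using meval_idem[OF pt(1)] pt(2) by (simp add: Den_def)
  then have "Fr (p - q * w) q \<in> J" using J_iff[of "p - q * w" q] 1 p qp wp q by (auto simp: polys_diff polys_mult)
  moreover have "Fr p q - Fr w 1 = Fr (p - q * w) q"
    using Den_nz[OF q] by (simp add: mult.commute)
  ultimately have "\<rho> (Fr p q) = emb w"
    unfolding emb_def using rho_eq_iff[OF L_I[OF p q] L_I[OF wp Den_1]] by simp
  then show ?thesis using w by blast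
qed

text \<open>The component is carried bijectively and linearly onto \<open>Q\<close>, so a basis of
  it yields a basis of \<open>Q\<close> over the constants.\<close>

lemma multiplicity: "rmep_multiplicity A Bs v = enat (card (basis pt))"
proof -
  obtain us where us: "set us = basis pt" "distinct us" using finite_distinct_list[OF finite_basis] by blast
  have comp: "set us \<subseteq> component pt" using us basis(1) by simp
  then have usp: "set us \<subseteq> polys k" by (auto simp: component_def deglt_polys)
  let ?Us = "map emb us"
  have Us: "set ?Us \<subseteq> carrier Q" using usp by auto
  have KE: "\<exists>cs. Ks = map (\<lambda>c. emb (mconst c)) cs" if "set Ks \<subseteq> K" for Ks
    unfolding ex_map_conv using that by (auto simp: K_eq)
  have span: "Q.Span K ?Us = carrier Q"
  proof (rule antisym)
    show "Q.Span K ?Us \<subseteq> carrier Q" by (rule Q.Span_in_carrier[OF subfieldE(3)[OF subfield_K] Us])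
    show "carrier Q \<subseteq> Q.Span K ?Us"
    proof
      fix X assume "X \<in> carrier Q"
      then obtain p q where pq: "X = \<rho> (Fr p q)" "p \<in> polys k" "q \<in> Den" unfolding Q_carrier by auto
      obtain w where w: "w \<in> component pt" "X = emb w" using component_approx[OF pq(2,3)] pq(1) by auto
      obtain c where c: "w = (\<Sum>u\<in>basis pt. mconst (c u) * u)"
        using basis(3)[of pt] w(1) unfolding mp.span_finite[OF finite_basis] by auto
      have "zip_sum (map c us) us = (\<Sum>u\<leftarrow>us. mconst (c u) * u)"
        by (simp add: zip_sum_def zip_map1 comp_def case_prod_beta zip_same_conv_map)
      also have "\<dots> = w" using us by (simp add: c sum_list_distinct_conv_sum_set)
      finally have "X = Q.combine (map (\<lambda>c. emb (mconst c)) (map c us)) ?Us"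
        using combine_emb[OF usp, of "map c us"] w(2) by simp
      moreover have "set (map (\<lambda>c. emb (mconst c)) (map c us)) \<subseteq> K" by (auto simp: K_eq)
      ultimately show "X \<in> Q.Span K ?Us"
        unfolding Q.Span_eq_combine_set[OF subfield_K Us] by blast
    qed
  qed
  have indep: "Q.independent K ?Us"
  proof (rule Q.trivial_combine_imp_independent[OF subfield_K Us])
    fix Ks assume Ks: "set Ks \<subseteq> K" "Q.combine Ks ?Us = \<zero>\<^bsub>Q\<^esub>"
    obtain cs where cs: "Ks = map (\<lambda>c. emb (mconst c)) cs" using KE[OF Ks(1)] by blast
    let ?w = "zip_sum cs us" and ?T = "set (take (length cs) us)"
    have "emb ?w = \<zero>\<^bsub>Q\<^esub>" using Ks(2) combine_emb[OF usp] by (simp add: cs)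
    then obtain s where s: "s \<in> Den" "s * ?w \<in> I" using emb_eq_0_iff[OF zip_sum_polys[OF usp]] by blast
    have T: "?T \<subseteq> basis pt" using us set_take_subset by metis
    have "?w \<in> component pt"
      unfolding zip_sum_eq[OF us(2)]
      by (intro mp.subspace_sum[OF subspace_component] mp.subspace_scale[OF subspace_component]) (use T basis(1) in blast)
    then have "?w = 0" using component_zero s by blast
    then have z: "the (map_of (zip us cs) u) = 0" if "u \<in> ?T" for u
      using mp.independent_mono[OF basis(2) T] that unfolding zip_sum_eq[OF us(2)]
      by (auto simp: mp.dependent_finite)
    show "set (take (length ?Us) Ks) \<subseteq> {\<zero>\<^bsub>Q\<^esub>}"
    proof
      fix x assume "x \<in> set (take (length ?Us) Ks)"
      then obtain i where i: "i < length us" "i < length cs" "x = emb (mconst (cs ! i))"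
        by (auto simp: in_set_conv_nth cs)
      have "us ! i \<in> ?T" using i by (auto simp: in_set_conv_nth)
      moreover have "map_of (zip us cs) (us ! i) = Some (cs ! i)"
        using i us(2) by (intro map_of_is_SomeI) (auto simp: set_zip map_fst_zip_take)
      ultimately have "cs ! i = 0" using z by fastforce
      then show "x \<in> {\<zero>\<^bsub>Q\<^esub>}" using i(3) by (simp add: emb_0)
    qed
  qed
  have dim: "Q.dimension (length us) K (carrier Q)"
    using Q.dimensionI[OF subfield_K indep span] by simp
  have "Q.dim K (carrier Q) = length us"
    using Q.dimI[OF subfield_K dim] by (simp add: over_def)
  moreover have "length us = card (basis pt)" using us distinct_card by metis
  ultimately show ?thesis
    using Q.finite_dimensionI[OF dim] by (simp add: rmep_multiplicity_def Let_def)
qed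

end

context rmep_regular
begin

lemma sum_multiplicity: "(\<Sum>x\<in>zeros. rmep_multiplicity A Bs x) = enat N"
proof -
  have "rmep_multiplicity A Bs x = enat (card (basis (restrict (($) x) {..<k})))" if "x \<in> zeros" for x
  proof -
    interpret rmep_point n k A Bs x by unfold_locales (rule that)
    show ?thesis by (rule multiplicity)
  qed
  then have "(\<Sum>x\<in>zeros. rmep_multiplicity A Bs x) = (\<Sum>x\<in>zeros. enat (card (basis (restrict (($) x) {..<k}))))"
    by simp
  also have "\<dots> = enat (\<Sum>x\<in>zeros. card (basis (restrict (($) x) {..<k})))"
    by (simp add: of_nat_eq_enat[symmetric])
  finally show ?thesis by (simp only: sum_card_basis_zeros)
qed

end

section \<open>Rank and maximal minors\<close>

lemma minor_row_expansion:
  assumes "p < length xs"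
  shows "minor M xs = (\<Sum>q<length xs. M (xs ! p) q * minor_cofactor M xs p q)"
  unfolding minor_def minor_cofactor_def
  by (subst laplace_expansion_row[OF mat_carrier assms]) (use assms in \<open>auto intro!: sum.cong\<close>)

lemma minor_row_expansion':
  assumes "p < length xs"
  shows "minor M xs = (-1) ^ p * (\<Sum>q<length xs. M (xs ! p) q *
    ((-1) ^ q * minor (\<lambda>r q'. M r (if q' < q then q' else Suc q')) (drop_nth p xs)))"
  unfolding minor_row_expansion[OF assms] sum_distrib_left
  by (intro sum.cong refl) (simp add: minor_cofactor_eq assms power_add)

lemma minor_repeated_row:
  assumes "i < length xs" "j < length xs" "i \<noteq> j" "xs ! i = xs ! j"
  shows "minor M xs = 0"
  unfolding minor_def
  by (rule det_identical_rows[OF mat_carrier assms(3,1,2)]) (use assms in \<open>auto intro!: eq_vecI\<close>)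

lemma insert_strict_list:
  assumes J: "J \<in> strict_lists m n" and r: "r < m" "r \<notin> set J"
  shows "\<exists>H\<in>strict_lists m (Suc n). \<exists>p\<le>n. H ! p = r \<and> drop_nth p H = J"
proof -
  let ?H = "insort r J"
  have s: "sorted J" "distinct J" "length J = n" "set J \<subseteq> {..<m}"
    using J by (auto simp: strict_lists_def index_lists_def strict_sorted_iff)
  have H: "?H \<in> strict_lists m (Suc n)"
    using s r by (auto simp: strict_lists_def index_lists_def strict_sorted_iff sorted_insort distinct_insort set_insort_key)
  obtain p where p: "p < length ?H" "?H ! p = r"
    by (metis in_set_conv_nth insertI1 set_insort_key)
  have split: "?H = take p ?H @ r # drop (Suc p) ?H" using id_take_nth_drop[OF p(1)] p(2) by simp
  then have "distinct (take p ?H @ r # drop (Suc p) ?H)" using s r by (metis distinct_insort)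
  moreover have "set ?H = insert r (set (drop_nth p ?H))"
    unfolding drop_nth_def by (subst split) auto
  ultimately have "set (drop_nth p ?H) = set J"
    using r(2) set_insort_key[of "\<lambda>x. x" r J] by (auto simp: drop_nth_def)
  moreover have p': "p \<le> n" using p(1) s(3) by simp
  ultimately have "drop_nth p ?H = J"
    using drop_nth_strict[OF H p'] J by (auto simp: strict_lists_def strict_sorted_equal)
  then show ?thesis using H p p' by blast
qed

text \<open>Induction on the number of columns. If all minors of the first \<open>n\<close> columns
  vanish, their null vector is extended by 0. Otherwise a nonzero one, on rows \<open>J\<close>,
  supplies cofactors for a further row. Pairing this vector with row \<open>r\<close> gives, up to
  sign, a minor with one row more; it vanishes by assumption, or because \<open>r\<close> is
  repeated.\<close>

lemma kernel_if_minors_vanish: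
  fixes M :: "nat \<Rightarrow> nat \<Rightarrow> complex"
  assumes "\<And>J. J \<in> strict_lists m n \<Longrightarrow> minor M J = 0"
  shows "\<exists>y. (\<exists>a<n. y a \<noteq> 0) \<and> (\<forall>r<m. (\<Sum>a<n. M r a * y a) = 0)"
  using assms
proof (induct n)
  case 0
  have "minor M [] = 1" by (simp add: minor_def)
  moreover have "[] \<in> strict_lists m 0" by (simp add: strict_lists_def index_lists_def)
  ultimately show ?case using 0 by fastforce
next
  case (Suc n)
  show ?case
  proof (cases "\<forall>J\<in>strict_lists m n. minor M J = 0")
    case True
    then obtain y where y: "\<exists>a<n. y a \<noteq> 0" "\<forall>r<m. (\<Sum>a<n. M r a * y a) = 0"
      using Suc.hyps by blast
    let ?y = "\<lambda>a. if a < n then y a else 0"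
    have "(\<Sum>a<Suc n. M r a * ?y a) = (\<Sum>a<n. M r a * y a)" for r by simp
    moreover have "\<exists>a<Suc n. ?y a \<noteq> 0" using y(1) less_SucI by force
    ultimately show ?thesis using y(2) by (intro exI[of _ ?y]) simp
  next
    case False
    then obtain J where J: "J \<in> strict_lists m n" "minor M J \<noteq> 0" by blast
    \<comment> \<open>The cofactors along a row joined to \<open>J\<close>; the last one is the
      nonzero minor up to sign.\<close>
    define y where "y q = (-1) ^ q * minor (\<lambda>r q'. M r (if q' < q then q' else Suc q')) J" for q
    have "minor (\<lambda>r q'. M r (if q' < n then q' else Suc q')) J = minor M J"
      by (rule minor_cong) (simp add: strict_length[OF J(1)])
    then have "y n \<noteq> 0" using J(2) by (simp add: y_def)
    moreover have "(\<Sum>q<Suc n. M r q * y q) = 0" if r: "r < m" for r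
    proof (cases "r \<in> set J")
      case True
      then obtain i where i: "i < length J" "J ! i = r" by (auto simp: in_set_conv_nth)
      have "minor M (r # J) = 0"
        by (rule minor_repeated_row[of 0 _ "Suc i"]) (use i in auto)
      then show ?thesis
        using minor_row_expansion'[of 0 "r # J" M] strict_length[OF J(1)] by (simp add: y_def drop_nth_def)
    next
      case False
      obtain H p where H: "H \<in> strict_lists m (Suc n)" "p \<le> n" "H ! p = r" "drop_nth p H = J"
        using insert_strict_list[OF J(1) r False] by blast
      then show ?thesis
        using minor_row_expansion'[of p H M] Suc.prems[OF H(1)] strict_length[OF H(1)] by (simp add: y_def)
    qed
    ultimately show ?thesis by (intro exI[of _ y]) auto
  qed
qed

lemma minor_vanishes_if_kernel:
  fixes M :: "nat \<Rightarrow> nat \<Rightarrow> complex"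
  assumes J: "J \<in> strict_lists m n" and y: "a < n" "y a \<noteq> 0" "\<And>r. r < m \<Longrightarrow> (\<Sum>a<n. M r a * y a) = 0"
  shows "minor M J = 0"
proof -
  let ?M = "mat n n (\<lambda>(p, q). M (J ! p) q)" and ?y = "vec n y"
  have "?M *\<^sub>v ?y = 0\<^sub>v n"
    using y(3)[OF strict_nth_less[OF J]] by (intro eq_vecI) (auto simp: scalar_prod_def atLeast0LessThan)
  moreover have "?y \<noteq> 0\<^sub>v n" using y(1,2) by (metis index_vec index_zero_vec(1))
  ultimately have "det ?M = 0"
    using det_0_iff_vec_prod_zero[OF mat_carrier, of n "\<lambda>(p, q). M (J ! p) q"] by (metis vec_carrier)
  then show ?thesis by (simp add: minor_def strict_length[OF J])
qed

context rmep_regular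
begin

lemma eigenvalues_eq_zeros: "{x. rmep_eigenvalue A Bs x} = zeros"
proof -
  have "rmep_eigenvalue A Bs x \<longleftrightarrow> (\<forall>J\<in>S. meval (f J) x = 0)" if x: "x \<in> carrier_vec k" for x
  proof -
    let ?M = "\<lambda>r a. meval (F r a) x"
    have M: "(pencil A Bs x *\<^sub>v y) $ r = (\<Sum>a<n. ?M r a * y $ a)" if "y \<in> carrier_vec n" "r < m" for y r
      using that A len by (simp add: pencil_def scalar_prod_def F_def meval_add meval.hom_sum meval_mult atLeast0LessThan)
    have dim: "dim_vec (pencil A Bs x *\<^sub>v y) = m" for y using A by (simp add: pencil_def)
    show ?thesis
    proof
      assume "rmep_eigenvalue A Bs x"
      then obtain y where y: "y \<in> carrier_vec n" "y \<noteq> 0\<^sub>v n" "pencil A Bs x *\<^sub>v y = 0\<^sub>v m"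
        using A by (auto simp: rmep_eigenvalue_def)
      obtain a where a: "a < n" "y $ a \<noteq> 0" using y(1,2) by (auto simp: vec_eq_iff)
      have "(\<Sum>a<n. ?M r a * y $ a) = 0" if "r < m" for r
        using M[OF y(1) that] y(3) that by simp
      then show "\<forall>J\<in>S. meval (f J) x = 0"
        unfolding meval.hom_minor using minor_vanishes_if_kernel[of _ m n a "($) y" ?M] a by blast
    next
      assume "\<forall>J\<in>S. meval (f J) x = 0"
      then obtain y where y: "\<exists>a<n. y a \<noteq> 0" "\<forall>r<m. (\<Sum>a<n. ?M r a * y a) = 0"
        using kernel_if_minors_vanish[of m n ?M] unfolding meval.hom_minor by blast
      have "vec n y \<noteq> 0\<^sub>v n" using y(1) by (metis index_vec index_zero_vec(1))
      moreover have "pencil A Bs x *\<^sub>v vec n y = 0\<^sub>v m"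
        by (rule eq_vecI) (use y(2) M[of "vec n y"] dim in auto)
      ultimately show "rmep_eigenvalue A Bs x"
        using x A len by (auto simp: rmep_eigenvalue_def intro!: bexI[of _ "vec n y"])
    qed
  qed
  moreover have "x \<in> carrier_vec k" if "rmep_eigenvalue A Bs x" for x
    using that len by (simp add: rmep_eigenvalue_def)
  ultimately show ?thesis unfolding zeros_def by blast
qed

end

section \<open>Banded Toeplitz matrices\<close>

text \<open>Column \<open>q\<close> lists the coefficients of
  \<open>t^q * (x 0 + x 1 * t + ... + x (v - 1) * t^(v - 1))\<close>.\<close>

definition toeplitz :: "nat \<Rightarrow> (nat \<Rightarrow> complex) \<Rightarrow> nat \<Rightarrow> nat \<Rightarrow> complex" where
  "toeplitz v x r q = (if q \<le> r \<and> r - q < v then x (r - q) else 0)"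

lemma strict_lists_Suc:
  "strict_lists (Suc M) (Suc j) = (\<lambda>I. 0 # map Suc I) ` strict_lists M j \<union> map Suc ` strict_lists M (Suc j)"
proof (rule antisym; rule subsetI)
  fix H assume H: "H \<in> strict_lists (Suc M) (Suc j)"
  have unmap: "map Suc (map (\<lambda>i. i - 1) L) = L" if "0 \<notin> set L" for L
    using that by (induct L) auto
  have down: "map (\<lambda>i. i - 1) L \<in> strict_lists M i" if "L \<in> strict_lists (Suc M) i" "0 \<notin> set L" for L i
  proof -
    have "sorted_wrt (<) (map (\<lambda>i. i - 1) L)"
      unfolding sorted_wrt_map
    proof (rule sorted_wrt_mono_rel)
      show "sorted_wrt (<) L" using that by (simp add: strict_lists_def)
      fix x y assume "x \<in> set L" "y \<in> set L" "x < y"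
      moreover from this have "x \<noteq> 0" using that(2) by metis
      ultimately show "x - 1 < y - 1" by simp
    qed
    moreover have "set (map (\<lambda>i. i - 1) L) \<subseteq> {..<M}"
    proof
      fix x assume "x \<in> set (map (\<lambda>i. i - 1) L)"
      then obtain y where y: "y \<in> set L" "x = y - 1" by auto
      have "y < Suc M" using that(1) y(1) by (auto simp: strict_lists_def index_lists_def)
      moreover have "y \<noteq> 0" using that(2) y(1) by metis
      ultimately show "x \<in> {..<M}" using y(2) by simp
    qed
    ultimately show ?thesis using that by (auto simp: strict_lists_def index_lists_def)
  qed
  obtain h L where hL: "H = h # L" using strict_length[OF H] by (cases H) auto
  have L: "L \<in> strict_lists (Suc M) j" "0 \<notin> set L" using H by (auto simp: hL strict_lists_def index_lists_def)
  show "H \<in> (\<lambda>I. 0 # map Suc I) ` strict_lists M j \<union> map Suc ` strict_lists M (Suc j)"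
  proof (cases "h = 0")
    case True
    then show ?thesis using down[OF L] unmap[OF L(2)] by (auto simp: hL intro!: image_eqI[of _ _ "map (\<lambda>i. i - 1) L"])
  next
    case False
    then have "0 \<notin> set H" using L by (auto simp: hL)
    then show ?thesis using down[OF H] unmap[of H] by (auto intro!: image_eqI[of _ _ "map (\<lambda>i. i - 1) H"])
  qed
next
  fix H assume "H \<in> (\<lambda>I. 0 # map Suc I) ` strict_lists M j \<union> map Suc ` strict_lists M (Suc j)"
  then show "H \<in> strict_lists (Suc M) (Suc j)"
    by (auto simp: strict_lists_def index_lists_def sorted_wrt_map)
qed

lemma sum_strict_lists_Suc:
  "(\<Sum>H\<in>strict_lists (Suc M) (Suc j). h H)
    = (\<Sum>I\<in>strict_lists M j. h (0 # map Suc I)) + (\<Sum>I\<in>strict_lists M (Suc j). h (map Suc I))"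
proof -
  have "inj_on (\<lambda>I. 0 # map Suc I) (strict_lists M j)" "inj_on (map Suc) (strict_lists M (Suc j))"
    by (auto simp: inj_on_def)
  moreover have "(\<lambda>I. 0 # map Suc I) ` strict_lists M j \<inter> map Suc ` strict_lists M (Suc j) = {}"
  proof -
    have "0 \<in> set H" if "H \<in> (\<lambda>I. 0 # map Suc I) ` strict_lists M j" for H using that by auto
    moreover have "0 \<notin> set H" if "H \<in> map Suc ` strict_lists M (Suc j)" for H using that by auto
    ultimately show ?thesis by blast
  qed
  ultimately show ?thesis
    unfolding strict_lists_Suc by (subst sum.union_disjoint) (simp_all add: sum.reindex comp_def)
qed

lemma minor_map_Suc: "minor M (map Suc I) = minor (\<lambda>r q. M (Suc r) q) I"
  unfolding minor_def by (rule arg_cong[where f = det]) (auto intro!: eq_matI)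

lemma minor_unit_row:
  assumes "\<And>q. q > 0 \<Longrightarrow> M r q = 0"
  shows "minor M (r # I) = M r 0 * minor (\<lambda>r q. M r (Suc q)) I"
proof -
  have "minor M (r # I) = (\<Sum>q<Suc (length I). M r q *
      ((-1) ^ q * minor (\<lambda>r q'. M r (if q' < q then q' else Suc q')) I))"
    using minor_row_expansion'[of 0 "r # I" M] by (simp add: drop_nth_def)
  also have "\<dots> = M r 0 * minor (\<lambda>r q. M r (Suc q)) I"
    using assms by (simp add: sum.lessThan_Suc_shift del: sum.lessThan_Suc)
  finally show ?thesis .
qed

text \<open>Induction on \<open>v + d\<close>, separating the row lists that contain row 0 from the
  others. Row 0 is \<open>x 0\<close> followed by zeros, so its minors are \<open>x 0\<close> times
  minors for \<open>d - 1\<close>. At \<open>x 0 = 0\<close> only the other lists remain, and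
  deleting row 0 leaves the matrix for \<open>v - 1\<close>. Once their coefficients are known to
  vanish, \<open>x 0\<close> can be divided out.\<close>

lemma toeplitz_minors_independent:
  assumes "\<And>x. (\<Sum>I\<in>strict_lists (v + d - 1) d. c I * minor (toeplitz v x) I) = 0"
  shows "\<forall>I\<in>strict_lists (v + d - 1) d. c I = 0"
  using assms
proof (induct "v + d" arbitrary: v d c rule: less_induct)
  case less
  consider "d = 0" | d' where "d = Suc d'" "v = 0" | d' v' where "d = Suc d'" "v = Suc v'"
    by (cases d; cases v) auto
  then show ?case
  proof cases
    case 1
    have "strict_lists (v + d - 1) d = {[]}" by (auto simp: 1 strict_lists_def index_lists_def)
    then show ?thesis using less.prems by (simp add: minor_def)
  next
    case 2
    have "strict_lists (v + d - 1) d = {}"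
    proof -
      have "card (strict_lists (v + d - 1) d) = 0"
        unfolding card_strict_lists by (rule binomial_eq_0) (simp add: 2)
      then show ?thesis by (simp only: card_0_eq[OF finite_strict_lists])
    qed
    then show ?thesis by simp
  next
    case 3
    let ?M = "v' + d'"
    have sum: "(\<Sum>I\<in>strict_lists ?M d'. c (0 # map Suc I) * minor (toeplitz v x) (0 # map Suc I))
        + (\<Sum>I\<in>strict_lists ?M (Suc d'). c (map Suc I) * minor (toeplitz v x) (map Suc I)) = 0" for x
      using less.prems[of x] by (simp add: 3 sum_strict_lists_Suc)
    have row0: "minor (toeplitz v x) (0 # map Suc I) = x 0 * minor (toeplitz v x) I" for x I
    proof -
      have "minor (toeplitz v x) (0 # map Suc I) = toeplitz v x 0 0 * minor (\<lambda>r q. toeplitz v x r (Suc q)) (map Suc I)"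
        by (rule minor_unit_row) (simp add: toeplitz_def)
      moreover have "(\<lambda>r q. toeplitz v x (Suc r) (Suc q)) = toeplitz v x"
        by (intro ext) (simp add: toeplitz_def)
      moreover have "toeplitz v x 0 0 = x 0" by (simp add: toeplitz_def 3)
      ultimately show ?thesis by (simp only: minor_map_Suc)
    qed
    have c1: "c (map Suc I) = 0" if "I \<in> strict_lists ?M (Suc d')" for I
    proof -
      have "(\<Sum>I\<in>strict_lists (v' + d - 1) d. c (map Suc I) * minor (toeplitz v' y) I) = 0" for y
      proof -
        \<comment> \<open>The specialisation \<open>x 0 = 0\<close>; the shift by one row turns the
          parameters into those for \<open>v'\<close>.\<close>
        let ?x = "\<lambda>i. if i = 0 then 0 else y (i - 1)"
        have "(\<lambda>r q. toeplitz v ?x (Suc r) q) = toeplitz v' y"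
          by (intro ext) (auto simp: toeplitz_def 3 Suc_diff_le le_Suc_eq)
        moreover have "minor (toeplitz v ?x) (0 # map Suc I) = 0" for I
          by (simp only: row0) simp
        ultimately show ?thesis using sum[of ?x] by (simp add: minor_map_Suc 3(1))
      qed
      then have "\<forall>I\<in>strict_lists (v' + d - 1) d. c (map Suc I) = 0"
        by (intro less.hyps[of v' d "\<lambda>I. c (map Suc I)"]) (simp_all add: 3)
      then show ?thesis using that by (simp add: 3)
    qed
    let ?h = "\<lambda>x. \<Sum>I\<in>strict_lists ?M d'. c (0 # map Suc I) * minor (toeplitz v x) I"
    have nz: "?h x = 0" if "x 0 \<noteq> 0" for x
    proof -
      have "x 0 * ?h x = 0" using sum[of x] by (simp add: row0 c1 sum_distrib_left mult.left_commute)
      then show ?thesis using that by simp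
    qed
    have "?h x = 0" for x
    proof -
      \<comment> \<open>Dividing by \<open>x 0\<close> settled the points with \<open>x 0\<close>
        nonzero; continuity in this coordinate covers the rest.\<close>
      let ?g = "\<lambda>s. ?h (x(0 := s))"
      have entry: "isCont (\<lambda>s. toeplitz v (x(0 := s)) r q) 0" for r q
      proof -
        have "(\<lambda>s. toeplitz v (x(0 := s)) r q) = (if q \<le> r \<and> r - q < v
            then if r - q = 0 then (\<lambda>s. s) else (\<lambda>_. x (r - q)) else (\<lambda>_. 0))"
          by (auto simp: toeplitz_def fun_eq_iff)
        then show ?thesis by simp
      qed
      have "isCont ?g 0"
        unfolding minor_Leibniz by (intro continuous_intros entry)
      then have "?g \<midarrow>0\<rightarrow> ?g 0" by (simp add: isCont_def)
      moreover have "?g \<midarrow>0\<rightarrow> 0"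
        by (rule tendsto_eventually) (auto simp: eventually_at_filter nz intro!: always_eventually)
      ultimately have "?g 0 = 0" by (rule LIM_unique)
      then show ?thesis
        using nz[of x] by (cases "x 0 = 0") (auto simp: fun_upd_idem)
    qed
    then have "\<forall>I\<in>strict_lists (v + d' - 1) d'. c (0 # map Suc I) = 0"
      by (intro less.hyps[of v d' "\<lambda>I. c (0 # map Suc I)"]) (simp_all add: 3)
    then show ?thesis
      using c1 by (auto simp: 3 strict_lists_Suc)
  qed
qed

lemma toeplitz_nondegenerate: "nondegenerate v d (\<lambda>r q l. if r = q + l then 1 else 0)"
  unfolding nondegenerate_def
proof (intro allI impI)
  let ?\<beta> = "\<lambda>r q l. if r = q + l then 1 else 0 :: complex"
  fix c assume c: "(\<Sum>I\<in>strict_lists (v + d - 1) d. mconst (c I) * minor (linform v ?\<beta>) I) = 0"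
  have "(\<Sum>I\<in>strict_lists (v + d - 1) d. c I * minor (toeplitz v x) I) = 0" for x
  proof -
    have "meval (linform v ?\<beta> r q) (vec v x) = toeplitz v x r q" for r q
    proof -
      have "meval (linform v ?\<beta> r q) (vec v x) = (\<Sum>l<v. if l = r - q \<and> q \<le> r then x l else 0)"
        unfolding linform_def meval.hom_sum meval_mult by (intro sum.cong refl) auto
      then show ?thesis by (cases "q \<le> r") (auto simp: toeplitz_def)
    qed
    then have "meval (minor (linform v ?\<beta>) I) (vec v x) = minor (toeplitz v x) I" for I
      by (simp add: meval.hom_minor)
    moreover have "meval (\<Sum>I\<in>strict_lists (v + d - 1) d. mconst (c I) * minor (linform v ?\<beta>) I) (vec v x) = 0"
      by (simp only: c meval_0)
    ultimately show ?thesis by (simp add: meval.hom_sum meval_mult)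
  qed
  then show "\<forall>I\<in>strict_lists (v + d - 1) d. c I = 0" by (rule toeplitz_minors_independent)
qed

lemma nondegenerate_cong:
  assumes "\<And>r q l. r < v + d - 1 \<Longrightarrow> q < d \<Longrightarrow> l < v \<Longrightarrow> \<beta> r q l = \<gamma> r q l"
  shows "nondegenerate v d \<beta> \<longleftrightarrow> nondegenerate v d \<gamma>"
proof -
  have "minor (linform v \<beta>) I = minor (linform v \<gamma>) I" if "I \<in> strict_lists (v + d - 1) d" for I
    by (rule minor_cong) (use that assms in \<open>auto simp: linform_def strict_lists_def index_lists_def intro!: sum.cong\<close>)
  then show ?thesis by (simp add: nondegenerate_def)
qed

section \<open>Generic tuples\<close>

text \<open>Closed under the operations in a Leibniz expansion, so that the determinants below are
  seen to be polynomial without writing down the polynomial.\<close>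

definition polyfun :: "nat \<Rightarrow> (complex vec \<Rightarrow> complex) \<Rightarrow> bool" where
  "polyfun d h \<longleftrightarrow> (\<exists>p\<in>polys d. \<forall>x. h x = meval p x)"

lemma polyfun_const: "polyfun d (\<lambda>_. c)"
  unfolding polyfun_def by (intro bexI[of _ "mconst c"]) auto

lemma polyfun_coord: "i < d \<Longrightarrow> polyfun d (\<lambda>x. x $ i)"
  unfolding polyfun_def by (intro bexI[of _ "mvar i"]) auto

lemma polyfun_mult: "polyfun d g \<Longrightarrow> polyfun d h \<Longrightarrow> polyfun d (\<lambda>x. g x * h x)"
  unfolding polyfun_def by (metis meval_mult polys_mult)

lemma polyfun_sum: "(\<And>i. i \<in> T \<Longrightarrow> polyfun d (g i)) \<Longrightarrow> polyfun d (\<lambda>x. \<Sum>i\<in>T. g i x)"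
proof (induct T rule: infinite_finite_induct)
  case (insert i T)
  then have "polyfun d (g i)" "polyfun d (\<lambda>x. \<Sum>i\<in>T. g i x)" by auto
  then have "polyfun d (\<lambda>x. g i x + (\<Sum>i\<in>T. g i x))"
    unfolding polyfun_def by (metis meval_add polys_add)
  then show ?case using insert by simp
qed (simp_all add: polyfun_const)

lemma polyfun_prod: "(\<And>i. i \<in> T \<Longrightarrow> polyfun d (g i)) \<Longrightarrow> polyfun d (\<lambda>x. \<Prod>i\<in>T. g i x)"
  by (induct T rule: infinite_finite_induct) (simp_all add: polyfun_const polyfun_mult)

lemma polyfun_det:
  assumes "\<And>x. M x \<in> carrier_mat N N" "\<And>i j. i < N \<Longrightarrow> j < N \<Longrightarrow> polyfun d (\<lambda>x. M x $$ (i, j))"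
  shows "polyfun d (\<lambda>x. det (M x))"
proof -
  have "polyfun d (\<lambda>x. \<Sum>p | p permutes {0..<N}. of_int (sign p) * (\<Prod>i = 0..<N. M x $$ (i, p i)))"
  proof (intro polyfun_sum polyfun_mult polyfun_const polyfun_prod)
    fix p i assume "p \<in> {p. p permutes {0..<N}}" "i \<in> {0..<N}"
    then show "polyfun d (\<lambda>x. M x $$ (i, p i))"
      using assms(2)[of i "p i"] permutes_in_image[of p "{0..<N}" i] by simp
  qed
  then show ?thesis by (simp only: det_def'[OF assms(1)])
qed

lemma polyfun_compressed_det:
  assumes "\<And>x. length (Cs x) = k" "\<And>x. set (Cs x) \<subseteq> carrier_mat (n + k - 1) n"
    and "\<And>r q l. r < n + k - 1 \<Longrightarrow> q < k \<Longrightarrow> l < n \<Longrightarrow> polyfun d (\<lambda>x. (Cs x ! q) $$ (r, l))"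
  shows "polyfun d (\<lambda>x. det (compressed_det n k (Cs x)))"
proof (rule polyfun_det[OF compressed_det_carrier])
  fix r c assume r: "r < (n + k - 1) choose k" and c: "c < (n + k - 1) choose k"
  have "polyfun d (\<lambda>x. \<Sum>js | js \<in> index_lists n k \<and> mset js = mset (col_list n k c). \<Sum>\<sigma> | \<sigma> permutes {..<k}.
      of_int (sign \<sigma>) * (\<Prod>l<k. tuple_coeff (Cs x) (row_list n k r ! l) (\<sigma> l) (js ! l)))"
  proof (intro polyfun_sum polyfun_mult polyfun_const polyfun_prod)
    fix js \<sigma> l
    assume "js \<in> {js \<in> index_lists n k. mset js = mset (col_list n k c)}" "\<sigma> \<in> {\<sigma>. \<sigma> permutes {..<k}}" "l \<in> {..<k}"
    moreover from this have "js ! l < n"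
      using nth_mem[of l js] by (auto simp: index_lists_def simp del: nth_mem)
    ultimately show "polyfun d (\<lambda>x. tuple_coeff (Cs x) (row_list n k r ! l) (\<sigma> l) (js ! l))"
      unfolding tuple_coeff_def using strict_nth_less[OF row_list_in[OF r]] permutes_in_image[of \<sigma> "{..<k}" l]
      by (intro assms(3)) auto
  qed
  then show "polyfun d (\<lambda>x. compressed_det n k (Cs x) $$ (r, c))"
    by (simp only: compressed_det_index[OF assms(1,2) r c])
qed

section \<open>Matrix tuples as points of affine space\<close>

definition point_tuple :: "nat \<Rightarrow> nat \<Rightarrow> nat \<Rightarrow> complex vec \<Rightarrow> complex mat list" where
  "point_tuple k m n x = map (\<lambda>l. mat m n (\<lambda>(r, a). x $ (l * (m * n) + r * n + a))) [0..<k]"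

lemma coordinate_less:
  fixes l r a :: nat
  assumes "l < k" "r < m" "a < n"
  shows "l * (m * n) + r * n + a < k * (m * n)"
proof -
  have "r * n + a < m * n"
  proof -
    have "r * n + a < Suc r * n" using assms(3) by simp
    also have "\<dots> \<le> m * n" using assms(2) by (intro mult_le_mono1) simp
    finally show ?thesis .
  qed
  then have "l * (m * n) + r * n + a < Suc l * (m * n)" by simp
  also have "\<dots> \<le> k * (m * n)" using assms(1) by (intro mult_le_mono1) simp
  finally show ?thesis .
qed

lemma tuple_point_index:
  assumes "l < k" "r < m" "a < n"
  shows "tuple_point k m n Bs $ (l * (m * n) + r * n + a) = (Bs ! l) $$ (r, a)"
proof -
  have ra: "r * n + a < m * n" using coordinate_less[of 0 1 r m a n] assms by simp
  have "(l * X + y) div X = l" "(l * X + y) mod X = y" if "y < X" for X y :: nat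
    using that by simp_all
  from this[OF ra] have "(l * (m * n) + r * n + a) div (m * n) = l" "(l * (m * n) + r * n + a) mod (m * n) = r * n + a"
    by (simp_all only: add.assoc)
  moreover have "(r * n + a) div n = r" "(r * n + a) mod n = a" using assms(3) by simp_all
  ultimately show ?thesis
    using coordinate_less[OF assms] by (simp add: tuple_point_def)
qed

lemma tuple_point_point_tuple:
  assumes x: "x \<in> carrier_vec (k * (m * n))"
  shows "tuple_point k m n (point_tuple k m n x) = x"
proof (rule eq_vecI)
  fix t assume "t < dim_vec x"
  then have t: "t < k * (m * n)" using x by simp
  then have "m * n > 0" by (auto intro: Nat.gr0I)
  then have l: "t div (m * n) < k" and "t mod (m * n) < m * n"
    using t by (simp_all add: less_mult_imp_div_less)
  then have r: "t mod (m * n) div n < m" by (simp add: less_mult_imp_div_less)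
  have a: "t mod (m * n) mod n < n" using \<open>m * n > 0\<close> by simp
  have "t = (t div (m * n)) * (m * n) + (t mod (m * n) div n) * n + t mod (m * n) mod n"
    using div_mult_mod_eq[of t "m * n"] div_mult_mod_eq[of "t mod (m * n)" n] by linarith
  then show "tuple_point k m n (point_tuple k m n x) $ t = x $ t"
    using tuple_point_index[OF l r a, of "point_tuple k m n x"] l r a
    by (simp add: point_tuple_def)
qed (use x in \<open>simp add: tuple_point_def\<close>)

lemma point_tuple_in: "point_tuple k m n x \<in> mat_tuples k m n"
  by (auto simp: point_tuple_def mat_tuples_def)

lemma point_tuple_tuple_point:
  assumes Bs: "Bs \<in> mat_tuples k m n"
  shows "point_tuple k m n (tuple_point k m n Bs) = Bs"
proof (rule nth_equalityI)
  show "length (point_tuple k m n (tuple_point k m n Bs)) = length Bs"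
    using Bs by (simp add: point_tuple_def mat_tuples_def)
  fix l assume "l < length (point_tuple k m n (tuple_point k m n Bs))"
  then have l: "l < k" by (simp add: point_tuple_def)
  then have "Bs ! l \<in> carrier_mat m n" using Bs nth_mem by (fastforce simp: mat_tuples_def)
  then show "point_tuple k m n (tuple_point k m n Bs) ! l = Bs ! l"
    using l by (intro eq_matI) (auto simp: point_tuple_def tuple_point_index)
qed

text \<open>The same tensor with the roles of \<open>\<lambda>\<close> and \<open>x\<close> exchanged.\<close>

definition swap_tuple :: "nat \<Rightarrow> nat \<Rightarrow> complex mat list \<Rightarrow> complex mat list" where
  "swap_tuple n k Bs = map (\<lambda>a. mat (k + n - 1) k (\<lambda>(r, l). (Bs ! l) $$ (r, a))) [0..<n]"

text \<open>The generic set. The first determinant is that of \<open>D_0\<close>; the second governs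
  the leading forms in \<lambda>, on which the count of multiplicities rests.\<close>

definition good_tuples :: "nat \<Rightarrow> nat \<Rightarrow> complex mat list set" where
  "good_tuples n k = {Bs \<in> mat_tuples k (n + k - 1) n.
     det (compressed_det n k Bs) \<noteq> 0 \<and> det (compressed_det k n (swap_tuple n k Bs)) \<noteq> 0}"

lemma good_tuples_nondegenerate:
  assumes Bs: "Bs \<in> mat_tuples k (n + k - 1) n"
  shows "det (compressed_det n k Bs) \<noteq> 0 \<longleftrightarrow> nondegenerate n k (tuple_coeff Bs)"
    and "det (compressed_det k n (swap_tuple n k Bs)) \<noteq> 0 \<longleftrightarrow> nondegenerate k n (\<lambda>r a l. Bs ! l $$ (r, a))"
proof -
  show "det (compressed_det n k Bs) \<noteq> 0 \<longleftrightarrow> nondegenerate n k (tuple_coeff Bs)"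
    using Bs nondegenerate_iff_det[of Bs k n] by (simp add: mat_tuples_def)
  have "nondegenerate k n (tuple_coeff (swap_tuple n k Bs)) \<longleftrightarrow> det (compressed_det k n (swap_tuple n k Bs)) \<noteq> 0"
    by (rule nondegenerate_iff_det) (auto simp: swap_tuple_def)
  moreover have "nondegenerate k n (tuple_coeff (swap_tuple n k Bs)) \<longleftrightarrow> nondegenerate k n (\<lambda>r a l. Bs ! l $$ (r, a))"
    by (rule nondegenerate_cong) (simp add: tuple_coeff_def swap_tuple_def)
  ultimately show "det (compressed_det k n (swap_tuple n k Bs)) \<noteq> 0 \<longleftrightarrow> nondegenerate k n (\<lambda>r a l. Bs ! l $$ (r, a))"
    by blast
qed

text \<open>The tensor given by \<open>r = a + l\<close> is symmetric in \<open>a\<close> and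
  \<open>l\<close>, so a single witness meets both conditions.\<close>

lemma toeplitz_good:
  "map (\<lambda>l. mat (n + k - 1) n (\<lambda>(r, a). if r = a + l then 1 else 0)) [0..<k] \<in> good_tuples n k"
proof -
  let ?Bs = "map (\<lambda>l. mat (n + k - 1) n (\<lambda>(r, a). if r = a + l then 1 else 0 :: complex)) [0..<k]"
  have in_tuples: "?Bs \<in> mat_tuples k (n + k - 1) n" by (auto simp: mat_tuples_def)
  have "nondegenerate n k (tuple_coeff ?Bs)"
    using toeplitz_nondegenerate[of n k]
    by (subst nondegenerate_cong[where \<gamma> = "\<lambda>r q l. if r = q + l then 1 else 0"]) (simp_all add: tuple_coeff_def add.commute)
  moreover have "nondegenerate k n (\<lambda>r a l. ?Bs ! l $$ (r, a))"
    using toeplitz_nondegenerate[of k n]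
    by (subst nondegenerate_cong[where \<gamma> = "\<lambda>r q l. if r = q + l then 1 else 0"]) (simp_all add: add.commute)
  ultimately show ?thesis
    using in_tuples good_tuples_nondegenerate[OF in_tuples] by (simp add: good_tuples_def)
qed

text \<open>The product of the two determinants is one polynomial in the entries. The complement
  lies in its zero set, which is proper by the Toeplitz witness.\<close>

lemma generic_good_tuples: "generic_tuples k (n + k - 1) n (good_tuples n k)"
proof -
  let ?m = "n + k - 1"
  let ?d = "k * (?m * n)" and ?tup = "point_tuple k (n + k - 1) n" and ?pt = "tuple_point k (n + k - 1) n"
  have entry: "polyfun ?d (\<lambda>x. ?tup x ! q $$ (r, a))" if "q < k" "r < ?m" "a < n" for q r a
    using that polyfun_coord[OF coordinate_less[OF that]] by (simp add: point_tuple_def)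
  have "polyfun ?d (\<lambda>x. det (compressed_det n k (?tup x)))"
    by (rule polyfun_compressed_det) (use entry point_tuple_in[of k ?m n] in \<open>auto simp: mat_tuples_def\<close>)
  moreover have "polyfun ?d (\<lambda>x. det (compressed_det k n (swap_tuple n k (?tup x))))"
  proof (rule polyfun_compressed_det)
    fix r q l assume "r < k + n - 1" "q < n" "l < k"
    then show "polyfun ?d (\<lambda>x. swap_tuple n k (?tup x) ! q $$ (r, l))"
      using entry[of l r q] by (simp add: swap_tuple_def add.commute)
  qed (auto simp: swap_tuple_def)
  ultimately have "polyfun ?d (\<lambda>x. det (compressed_det n k (?tup x)) * det (compressed_det k n (swap_tuple n k (?tup x))))"
    by (rule polyfun_mult)
  then obtain p where p: "p \<in> polys ?d"
    "\<And>x. meval p x = det (compressed_det n k (?tup x)) * det (compressed_det k n (swap_tuple n k (?tup x)))"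
    by (auto simp: polyfun_def)
  have good: "?tup x \<in> good_tuples n k \<longleftrightarrow> meval p x \<noteq> 0" for x
    using point_tuple_in[of k ?m n x] by (simp add: good_tuples_def p(2))
  have sub: "good_tuples n k \<subseteq> mat_tuples k ?m n" by (auto simp: good_tuples_def)
  have carrier: "?pt Bs \<in> carrier_vec ?d" for Bs by (simp add: tuple_point_def)
  let ?S = "{x \<in> carrier_vec ?d. \<forall>q\<in>{p}. meval q x = 0}"
  have "algebraic_variety ?d ?S"
    unfolding algebraic_variety_def using p(1) by (intro exI[of _ "{p}"]) auto
  moreover have "?S \<noteq> carrier_vec ?d"
  proof -
    obtain Bs where Bs: "Bs \<in> good_tuples n k" using toeplitz_good by blast
    then have "?tup (?pt Bs) \<in> good_tuples n k" using point_tuple_tuple_point sub by (metis subsetD)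
    then have "?pt Bs \<notin> ?S" using good by simp
    then show ?thesis using carrier by blast
  qed
  moreover have "carrier_vec ?d - ?pt ` good_tuples n k \<subseteq> ?S"
  proof
    fix x assume x: "x \<in> carrier_vec ?d - ?pt ` good_tuples n k"
    then have "?pt (?tup x) = x" by (simp add: tuple_point_point_tuple)
    then have "?tup x \<notin> good_tuples n k" using x by (metis DiffD2 imageI)
    then show "x \<in> ?S" using good x by simp
  qed
  ultimately have "generic ?d (?pt ` good_tuples n k)"
    unfolding generic_def using carrier by blast
  then show ?thesis using sub by (simp add: generic_tuples_def)
qed

theorem theorem2:
  fixes n k :: nat
  assumes "n \<ge> 1" and "k \<ge> 2"
  shows "\<exists>\<Omega>. generic_tuples k (n + k - 1) n \<Omega> \<and>
    (\<forall>A \<in> carrier_mat (n + k - 1) n. \<forall>Bs \<in> \<Omega>.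
      (let D = compressed_Delta n k A Bs;
           G = (\<lambda>i. the (mat_inverse (D 0)) * D i);
           E = {v. rmep_eigenvalue A Bs v}
       in invertible_mat (D 0) \<and>
          (finite E \<and> (\<Sum>v\<in>E. rmep_multiplicity A Bs v) = enat ((n + k - 1) choose k)) \<and>
          (\<forall>i\<in>{1..k}. \<forall>j\<in>{1..k}. G i * G j = G j * G i) \<and>
          (\<forall>v \<in> carrier_vec k.
             common_eigenvalue (map G [1..<k + 1]) v \<longleftrightarrow> rmep_eigenvalue A Bs v)))"
proof (intro exI[of _ "good_tuples n k"] conjI ballI)
  show "generic_tuples k (n + k - 1) n (good_tuples n k)" by (rule generic_good_tuples)
  fix A :: "complex mat" and Bs assume carrier: "A \<in> carrier_mat (n + k - 1) n" and good: "Bs \<in> good_tuples n k"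
  then have tuples: "Bs \<in> mat_tuples k (n + k - 1) n" by (simp add: good_tuples_def)
  interpret rmep n k A Bs
    by unfold_locales (use carrier tuples assms in \<open>auto simp: mat_tuples_def\<close>)
  interpret W: rmep_nondegenerate n k A Bs
    by unfold_locales (use good good_tuples_nondegenerate(1)[OF tuples] in \<open>simp add: good_tuples_def\<close>)
  interpret R: rmep_regular n k A Bs
    by unfold_locales (use good good_tuples_nondegenerate(2)[OF tuples] in \<open>simp add: good_tuples_def\<close>)
  let ?G = "\<lambda>i. the (mat_inverse (compressed_Delta n k A Bs 0)) * compressed_Delta n k A Bs i"
  \<comment> \<open>The theorem numbers its matrices from 1, \<open>W.G\<close> from 0.\<close>
  have G: "?G (Suc q) = W.G q" for q by (simp add: W.G_def W.P_def D_def)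
  have inv: "invertible_mat (compressed_Delta n k A Bs 0)"
    using W.P D_carrier[of 0] unfolding D_def
    by (auto simp: invertible_mat_def inverts_mat_def square_mat.simps)
  have commute: "?G i * ?G j = ?G j * ?G i" if "i \<in> {1..k}" "j \<in> {1..k}" for i j
  proof -
    have "i - 1 < k" "j - 1 < k" using that by auto
    then show ?thesis
      using W.G_commute[of "i - 1" "j - 1"] that G[of "i - 1"] G[of "j - 1"] by simp
  qed
  have common: "common_eigenvalue (map ?G [1..<k + 1]) x \<longleftrightarrow> rmep_eigenvalue A Bs x"
    if x: "x \<in> carrier_vec k" for x
  proof -
    have nth: "map ?G [1..<k + 1] ! q = W.G q" if "q < k" for q
      using that G[of q] by (simp del: upt_Suc)
    have "common_eigenvalue (map ?G [1..<k + 1]) x \<longleftrightarrow> (\<exists>w. \<forall>q<k. eigenvector (W.G q) w (x $ q))"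
      unfolding common_eigenvalue_def using x nth by (simp del: upt_Suc)
    also have "\<dots> \<longleftrightarrow> rmep_eigenvalue A Bs x"
      using W.common_eigenvalue_if W.rmep_eigenvalue_if x by blast
    finally show ?thesis .
  qed
  show "let D = compressed_Delta n k A Bs; G = \<lambda>i. the (mat_inverse (D 0)) * D i; E = {v. rmep_eigenvalue A Bs v}
    in invertible_mat (D 0) \<and>
      (finite E \<and> (\<Sum>v\<in>E. rmep_multiplicity A Bs v) = enat ((n + k - 1) choose k)) \<and>
      (\<forall>i\<in>{1..k}. \<forall>j\<in>{1..k}. G i * G j = G j * G i) \<and>
      (\<forall>v\<in>carrier_vec k. common_eigenvalue (map G [1..<k + 1]) v \<longleftrightarrow> rmep_eigenvalue A Bs v)"
    unfolding Let_def R.eigenvalues_eq_zeros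
    using inv commute common R.finite_zeros R.sum_multiplicity by blast
qed

end
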